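(* Let $d\ge 1$ and $s\geq 0$. Let $V:\mathbb{R}^d\to\mathbb{R}$ satisfy: (i) $V(x)\geq 0$ for all $x\in\mathbb{R}^d$; (ii) $V=\alpha+W$, where $\alpha>0$ is a constant and $W\in\mathcal{B}^s(\mathbb{R}^d)$. Then there is a constant $C$ depending only on $V$, $d$ and $s$ such that for every $f\in\mathcal{B}^s(\mathbb{R}^d)$ the equation $$-\Delta u+Vu=f\quad\text{in }\mathbb{R}^d$$ has a unique solution $u^*$ in $\mathcal{B}^{s+2}(\mathbb{R}^d)$, and this solution satisfies $$\|u^*\|_{\mathcal{B}^{s+2}(\mathbb{R}^d)}\leq C\|f\|_{\mathcal{B}^s(\mathbb{R}^d)}.$$
   Context: The Fourier transform is normalized as $\hat g(\xi)=\frac{1}{(2\pi)^d}\int_{\mathbb{R}^d}g(x)e^{-ix^\top\xi}\,dx$ for $g\in L^1(\mathbb{R}^d)$ and extended to tempered distributions, so that the inverse transform is $g(x)=\int_{\mathbb{R}^d}\hat g(\xi)e^{ix^\top\xi}\,d\xi$. Spectral Barron space: for $s\in\mathbb{R}$ and a real-valued function $g$ on $\mathbb{R}^d$ (understood as a tempered distribution whose Fourier transform is a function), $\|g\|_{\mathcal{B}^s(\mathbb{R}^d)}:=\int_{\mathbb{R}^d}|\hat g(\xi)|(1+|\xi|^2)^{s/2}\,d\xi$, where $|\xi|$ is the Euclidean norm, and $\mathcal{B}^s(\mathbb{R}^d)=\{g:\|g\|_{\mathcal{B}^s(\mathbb{R}^d)}<\infty\}$. For $s\ge 0$, elements of $\mathcal{B}^s(\mathbb{R}^d)$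 have $\hat g\in L^1(\mathbb{R}^d)$ and are identified with their bounded continuous representatives. The equation is understood in the sense of tempered distributions. *)

theory Defs
  imports "HOL-Analysis.Analysis"
begin



definition dir_deriv :: "'a::euclidean_space \<Rightarrow> ('a \<Rightarrow> complex) \<Rightarrow> 'a \<Rightarrow> complex" where
  "dir_deriv b \<phi> x = vector_derivative (\<lambda>t. \<phi> (x + t *\<^sub>R b)) (at 0)"

text \<open>A list of basis vectors serves as a multi-index. Differentiability below is Frechet
  differentiability, so asking it of every iterated partial derivative amounts to smoothness.\<close>

definition iter_deriv :: "'a::euclidean_space list \<Rightarrow> ('a \<Rightarrow> complex) \<Rightarrow> 'a \<Rightarrow> complex" where
  "iter_deriv bs \<phi> = foldr dir_deriv bs \<phi>"

definition schwartz :: "('a::euclidean_space \<Rightarrow> complex) set" where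
  "schwartz = {\<phi>. \<forall>bs \<in> lists Basis.
      (\<forall>x. iter_deriv bs \<phi> differentiable at x) \<and>
      (\<forall>k. \<exists>C. \<forall>x. norm x ^ k * norm (iter_deriv bs \<phi> x) \<le> C)}"

definition laplacian :: "('a::euclidean_space \<Rightarrow> complex) \<Rightarrow> 'a \<Rightarrow> complex" where
  "laplacian \<phi> x = (\<Sum>b\<in>Basis. dir_deriv b (dir_deriv b \<phi>) x)"

definition fourier :: "('a::euclidean_space \<Rightarrow> complex) \<Rightarrow> 'a \<Rightarrow> complex" where
  "fourier g \<xi> = complex_of_real (1 / (2 * pi) ^ DIM('a)) *
     (LINT x|lborel. g x * exp (- \<i> * complex_of_real (x \<bullet> \<xi>)))"

text \<open>A tempered distribution is represented by its action on test functions; only its values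
  on \<^const>\<open>schwartz\<close> are meaningful. The pairing is bilinear (no complex conjugation).\<close>

type_synonym 'a distribution = "('a \<Rightarrow> complex) \<Rightarrow> complex"

definition fun_distribution :: "('a::euclidean_space \<Rightarrow> complex) \<Rightarrow> 'a distribution" where
  "fun_distribution g \<phi> = (LINT x|lborel. g x * \<phi> x)"

definition fourier_distribution :: "'a::euclidean_space distribution \<Rightarrow> 'a distribution" where
  "fourier_distribution T \<phi> = T (fourier \<phi>)"

definition laplacian_distribution :: "'a::euclidean_space distribution \<Rightarrow> 'a distribution" where
  "laplacian_distribution T \<phi> = T (laplacian \<phi>)"

abbreviation real_distribution :: "('a::euclidean_space \<Rightarrow> real) \<Rightarrow> 'a distribution" where
  "real_distribution g \<equiv> fun_distribution (\<lambda>x. complex_of_real (g x))"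

text \<open>The Fourier transform of the distribution given by \<open>g\<close> is the function \<open>G\<close>.\<close>

definition has_fourier_function ::
    "('a::euclidean_space \<Rightarrow> real) \<Rightarrow> ('a \<Rightarrow> complex) \<Rightarrow> bool" where
  "has_fourier_function g G \<longleftrightarrow>
     G \<in> borel_measurable borel \<and>
     (\<forall>\<phi>\<in>schwartz. integrable lborel (\<lambda>\<xi>. G \<xi> * \<phi> \<xi>) \<and>
        fourier_distribution (real_distribution g) \<phi> = fun_distribution G \<phi>)"

text \<open>Determined by \<open>g\<close> up to a null set when it exists.\<close>

definition fourier_function :: "('a::euclidean_space \<Rightarrow> real) \<Rightarrow> 'a \<Rightarrow> complex" where
  "fourier_function g = (SOME G. has_fourier_function g G)"

definition barron_norm :: "real \<Rightarrow> ('a::euclidean_space \<Rightarrow> real) \<Rightarrow> ennreal" where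
  "barron_norm s g =
     (\<integral>\<^sup>+ \<xi>. ennreal (norm (fourier_function g \<xi>) * (1 + (norm \<xi>)\<^sup>2) powr (s / 2)) \<partial>lborel)"

text \<open>Intended for \<open>s \<ge> 0\<close>: elements are identified with their bounded continuous
  representatives, so equality in this set is pointwise equality.\<close>

definition barron_space :: "real \<Rightarrow> ('a::euclidean_space \<Rightarrow> real) set" where
  "barron_space s = {g. continuous_on UNIV g \<and> bounded (range g) \<and>
     (\<exists>G. has_fourier_function g G) \<and> barron_norm s g < \<infinity>}"

text \<open>The equation \<open>- \<Delta> u + V u = f\<close> in the sense of tempered distributions.\<close>

definition schroedinger_solution ::
    "('a::euclidean_space \<Rightarrow> real) \<Rightarrow> ('a \<Rightarrow> real) \<Rightarrow> ('a \<Rightarrow> real) \<Rightarrow> bool" where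
  "schroedinger_solution V f u \<longleftrightarrow>
     (\<forall>\<phi>\<in>schwartz.
        - laplacian_distribution (real_distribution u) \<phi> + real_distribution (\<lambda>x. V x * u x) \<phi>
        = real_distribution f \<phi>)"

end

theory Submission
  imports "HOL-Probability.Characteristic_Functions" Defs
begin

text \<open>Write \<open>\<omega> \<xi> = (1 + |\<xi>|\<^sup>2) powr (s / 2)\<close>, let \<open>G\<close> be the Fourier transform of \<open>W\<close> and put
  \<open>w = \<omega> (\<alpha> + |\<xi>|\<^sup>2) U\<close>, where \<open>U\<close> is the Fourier transform of the unknown \<open>u\<close>. On the Fourier side
  the equation reads \<open>w + T w = \<omega> F\<close> in \<open>L\<^sup>1\<close>, where \<open>F\<close> is the Fourier transform of \<open>f\<close> and
  \<open>T w = \<omega> (G * (w / (\<omega> (\<alpha> + |\<xi>|\<^sup>2))))\<close>. Because translations are continuous in weighted \<open>L\<^sup>1\<close> and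
  \<open>1 / (\<alpha> + |\<xi>|\<^sup>2)\<close> tends to zero, \<open>T\<close> is approximated in operator norm by finite rank operators, so
  the Fredholm alternative reduces solvability, with a bound, to injectivity. An element of the kernel
  gives a solution \<open>u\<close> of \<open>- \<Delta>u + V u = 0\<close> that vanishes at infinity by the Riemann-Lebesgue lemma;
  since \<open>V \<ge> 0\<close>, the maximum principle forces \<open>u = 0\<close>. The same argument gives uniqueness and
  shows that the solution is real.\<close>

section \<open>Continuity of translation in \<open>L\<^sup>1\<close>\<close>

text \<open>\<open>W\<close> need not be small compared with \<alpha>, so I + T cannot simply be
  inverted by a contraction argument. The Fredholm argument uses a contraction only for T minus a
  finite rank operator, where the operator bound 1/2 suffices; the price is a constant that is not
  explicit. Putting the weight and the factor \<alpha> + |\<xi>|^2 into the unknown \<open>w\<close>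
  places the equation in unweighted L1. There an integral operator is bounded by the largest L1 norm
  of a column of its kernel, so every estimate on T is an estimate on columns. The solution is
  accessible only through its transform U: integrability of |\<xi>|^2 U turns the weak equation into
  an identity between continuous functions, and the maximum principle works with second difference
  quotients. Gaussians carry the Fourier theory: Gaussian averages of an L1 function are computed
  from its inverse transform, and continuity of translation in L1 removes the averaging. All test
  functions at which a distributional hypothesis is evaluated are modulated Gaussians.\<close>

lemma integrable_lborel_measurable:
  fixes f :: "'a::euclidean_space \<Rightarrow> 'b::{banach, second_countable_topology}"
  assumes "integrable lborel f"
  shows "f \<in> borel_measurable borel"
  using borel_measurable_integrable[OF assms] by simp

section \<open>Affine changes of variable for Lebesgue measure\<close>

lemma nn_integral_lborel_affine:
  fixes f :: "'a::euclidean_space \<Rightarrow> ennreal"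
  assumes [measurable]: "f \<in> borel_measurable borel" and c: "c \<noteq> 0"
  shows "(\<integral>\<^sup>+x. f x \<partial>lborel) = ennreal (\<bar>c\<bar> ^ DIM('a)) * (\<integral>\<^sup>+x. f (t + c *\<^sub>R x) \<partial>lborel)"
  by (subst lborel_affine[OF c, of t])
     (simp add: nn_integral_density nn_integral_distr nn_integral_cmult)

lemma integrable_lborel_affine:
  fixes f :: "'a::euclidean_space \<Rightarrow> 'b::{banach, second_countable_topology}"
  assumes f: "integrable lborel f" and c: "c \<noteq> 0"
  shows "integrable lborel (\<lambda>x. f (t + c *\<^sub>R x))"
proof -
  note [measurable] = integrable_lborel_measurable[OF f]
  have "ennreal (\<bar>c\<bar> ^ DIM('a)) * (\<integral>\<^sup>+x. norm (f (t + c *\<^sub>R x)) \<partial>lborel) < \<infinity>"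
    using f nn_integral_lborel_affine[of "\<lambda>x. ennreal (norm (f x))" c t] c
    by (simp add: integrable_iff_bounded)
  then show ?thesis
    using c by (auto simp: integrable_iff_bounded ennreal_mult_less_top)
qed

lemma integrable_lborel_affine_iff:
  fixes f :: "'a::euclidean_space \<Rightarrow> 'b::{banach, second_countable_topology}"
  assumes c: "c \<noteq> 0"
  shows "integrable lborel (\<lambda>x. f (t + c *\<^sub>R x)) \<longleftrightarrow> integrable lborel f"
  using c integrable_lborel_affine[of f c t]
    integrable_lborel_affine[of "\<lambda>x. f (t + c *\<^sub>R x)" "1 / c" "- (1 / c) *\<^sub>R t"]
  by (auto simp: scaleR_right_diff_distrib)

lemma integral_lborel_affine:
  fixes f :: "'a::euclidean_space \<Rightarrow> 'b::{banach, second_countable_topology}"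
  assumes c: "c \<noteq> 0"
  shows "(LBINT x. f x) = \<bar>c\<bar> ^ DIM('a) *\<^sub>R (LBINT x. f (t + c *\<^sub>R x))"
proof cases
  assume f[measurable]: "integrable lborel f" then show ?thesis
    using c f[THEN borel_measurable_integrable] integrable_lborel_affine[OF f c, of t]
    by (subst lborel_affine[OF c, of t]) (simp add: integral_density integral_distr)
next
  assume "\<not> integrable lborel f" with c show ?thesis
    by (simp add: integrable_lborel_affine_iff not_integrable_integral_eq)
qed

lemma integrable_lborel_shift:
  fixes f :: "'a::euclidean_space \<Rightarrow> 'b::{banach, second_countable_topology}"
  shows "integrable lborel (\<lambda>x. f (x + a)) \<longleftrightarrow> integrable lborel f"
  using integrable_lborel_affine_iff[of 1 f a] by (simp add: add.commute)

lemma integral_lborel_shift: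
  fixes f :: "'a::euclidean_space \<Rightarrow> 'b::{banach, second_countable_topology}"
  shows "(LBINT x. f (x + a)) = (LBINT x. f x)"
  using integral_lborel_affine[of 1 f a] by (simp add: add.commute)

lemma integral_lborel_reflect:
  fixes f :: "'a::euclidean_space \<Rightarrow> 'b::{banach, second_countable_topology}"
  shows "(LBINT x. f (a - x)) = (LBINT x. f x)"
  using integral_lborel_affine[of "-1" f a] by simp

lemma integrable_bounded_mult:
  fixes f g :: "'a::euclidean_space \<Rightarrow> complex"
  assumes f: "integrable lborel f" and [measurable]: "g \<in> borel_measurable borel"
    and g: "\<And>x. norm (g x) \<le> B"
  shows "integrable lborel (\<lambda>x. f x * g x)" "integrable lborel (\<lambda>x. g x * f x)"
proof -
  note [measurable] = integrable_lborel_measurable[OF f]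
  show "integrable lborel (\<lambda>x. f x * g x)"
    by (rule Bochner_Integration.integrable_bound[where f="\<lambda>x. B * norm (f x)"])
       (use f g in \<open>auto simp: norm_mult mult.commute[of B] intro!: mult_left_mono AE_I2
          intro: order_trans[OF _ abs_ge_self]\<close>)
  then show "integrable lborel (\<lambda>x. g x * f x)"
    by (simp add: mult.commute)
qed

text \<open>Stated along sequences tending to 0, because dominated convergence and the contradiction
  arguments that rely on it work with sequences.\<close>

definition L1_continuous_shift :: "('a::euclidean_space \<Rightarrow> 'b::{banach, second_countable_topology}) \<Rightarrow> bool" where
  "L1_continuous_shift f \<longleftrightarrow> (\<forall>h. h \<longlonglongrightarrow> 0 \<longrightarrow> (\<lambda>n. LBINT x. norm (f (x + h n) - f x)) \<longlonglongrightarrow> 0)"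

lemma norm_diff_chain:
  fixes a :: "'b::real_normed_vector"
  shows "norm (a - d) \<le> norm (a - b) + norm (b - c) + norm (d - c)"
  using norm_triangle_ineq4[of "(a - b) + (b - c)" "d - c"] norm_triangle_ineq[of "a - b" "b - c"]
  by simp

text \<open>Two of the three terms in the estimate are the same number, because Lebesgue measure is
  translation invariant; hence the property passes to L1 limits. It is used once to go from open to
  measurable sets and once for limits of simple functions.\<close>

lemma L1_continuous_shift_approx:
  fixes f :: "'a::euclidean_space \<Rightarrow> 'b::{banach, second_countable_topology}"
  assumes f: "integrable lborel f"
    and approx: "\<And>e. e > 0 \<Longrightarrow> \<exists>g. integrable lborel g \<and> L1_continuous_shift g \<and> (LBINT x. norm (f x - g x)) < e"
  shows "L1_continuous_shift f"
  unfolding L1_continuous_shift_def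
proof (intro allI impI)
  fix h :: "nat \<Rightarrow> 'a" assume h: "h \<longlonglongrightarrow> 0"
  show "(\<lambda>n. LBINT x. norm (f (x + h n) - f x)) \<longlonglongrightarrow> 0"
  proof (rule LIMSEQ_I)
    fix e :: real assume "e > 0"
    then obtain g where g: "integrable lborel g" "L1_continuous_shift g"
      and fg: "(LBINT x. norm (f x - g x)) < e / 3"
      using approx[of "e / 3"] by auto
    have "(\<lambda>n. LBINT x. norm (g (x + h n) - g x)) \<longlonglongrightarrow> 0"
      using g(2) h unfolding L1_continuous_shift_def by auto
    from LIMSEQ_D[OF this, of "e / 3"] \<open>e > 0\<close> obtain N where
      N: "\<And>n. n \<ge> N \<Longrightarrow> (LBINT x. norm (g (x + h n) - g x)) < e / 3"
      by auto
    have "norm ((LBINT x. norm (f (x + h n) - f x)) - 0) < e" if "n \<ge> N" for n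
    proof -
      have i: "integrable lborel (\<lambda>x. f (x + h n))" "integrable lborel (\<lambda>x. g (x + h n))"
        using f g by (simp_all add: integrable_lborel_shift)
      have "(LBINT x. norm (f (x + h n) - f x))
          \<le> (LBINT x. norm (f (x + h n) - g (x + h n)) + norm (g (x + h n) - g x) + norm (f x - g x))"
        using i f g by (intro integral_mono norm_diff_chain) auto
      also have "\<dots> = (LBINT x. norm (f (x + h n) - g (x + h n)))
          + (LBINT x. norm (g (x + h n) - g x)) + (LBINT x. norm (f x - g x))"
        using i f g by simp
      also have "(LBINT x. norm (f (x + h n) - g (x + h n))) = (LBINT x. norm (f x - g x))"
        by (rule integral_lborel_shift[of "\<lambda>x. norm (f x - g x)"])
      finally have "(LBINT x. norm (f (x + h n) - f x)) < e"
        using N[OF that] fg by simp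
      then show ?thesis by simp
    qed
    then show "\<exists>N. \<forall>n\<ge>N. norm ((LBINT x. norm (f (x + h n) - f x)) - 0) < e" by blast
  qed
qed

text \<open>Openness gives convergence at every point: a point of \<open>U\<close> stays in
  \<open>U\<close> under a small shift, and off \<open>U\<close> the product of the indicators is
  already 0, so the boundary causes no trouble. As both sets have the same measure, the symmetric
  difference has measure 2 |U| - 2 |U \<inter> (U - h)|.\<close>

lemma L1_continuous_shift_open:
  fixes c :: "'b::{banach, second_countable_topology}" and U :: "'a::euclidean_space set"
  assumes U: "open U" and fin: "emeasure lborel U < \<infinity>"
  shows "L1_continuous_shift (\<lambda>x. indicator U x *\<^sub>R c)"
  unfolding L1_continuous_shift_def
proof (intro allI impI)
  fix h :: "nat \<Rightarrow> 'a" assume h: "h \<longlonglongrightarrow> 0"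
  have [measurable]: "U \<in> sets borel" using U by simp
  let ?i = "\<lambda>x. indicator U x :: real"
  have iU: "integrable lborel ?i"
    using fin by (simp add: integrable_indicator_iff)
  have iUh: "integrable lborel (\<lambda>x. ?i (x + h n))" for n
    using iU by (simp add: integrable_lborel_shift)
  have iUU: "integrable lborel (\<lambda>x. ?i x * ?i (x + h n))" for n
    by (rule Bochner_Integration.integrable_bound[OF iU]) (auto simp: indicator_def)
  have lim: "(\<lambda>n. LBINT x. ?i x * ?i (x + h n)) \<longlonglongrightarrow> (LBINT x. ?i x)"
  proof (rule integral_dominated_convergence[OF _ _ iU])
    show "AE x in lborel. (\<lambda>n. ?i x * ?i (x + h n)) \<longlonglongrightarrow> ?i x"
    proof (rule AE_I2)
      fix x
      show "(\<lambda>n. ?i x * ?i (x + h n)) \<longlonglongrightarrow> ?i x"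
      proof (cases "x \<in> U")
        case True
        have "(\<lambda>n. x + h n) \<longlonglongrightarrow> x" using tendsto_add[OF tendsto_const h, of x] by simp
        then have "eventually (\<lambda>n. x + h n \<in> U) sequentially"
          using U True by (rule topological_tendstoD)
        then have "eventually (\<lambda>n. ?i x * ?i (x + h n) = ?i x) sequentially"
          by eventually_elim (use True in auto)
        then show ?thesis by (rule tendsto_eventually)
      qed simp
    qed
  qed (auto simp: indicator_def)
  have eq: "(LBINT x. norm (?i (x + h n) *\<^sub>R c - ?i x *\<^sub>R c))
     = norm c * (2 * (LBINT x. ?i x) - 2 * (LBINT x. ?i x * ?i (x + h n)))" for n
  proof -
    have "(LBINT x. norm (?i (x + h n) *\<^sub>R c - ?i x *\<^sub>R c))
      = (LBINT x. norm c * (?i (x + h n) + ?i x - 2 * (?i x * ?i (x + h n))))"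
      by (rule Bochner_Integration.integral_cong) (auto simp: indicator_def)
    also have "\<dots> = norm c * ((LBINT x. ?i (x + h n)) + (LBINT x. ?i x)
        - 2 * (LBINT x. ?i x * ?i (x + h n)))"
      using iU iUh[of n] iUU[of n] by simp
    also have "(LBINT x. ?i (x + h n)) = (LBINT x. ?i x)"
      by (rule integral_lborel_shift)
    finally show ?thesis by simp
  qed
  have "(\<lambda>n. norm c * (2 * (LBINT x. ?i x) - 2 * (LBINT x. ?i x * ?i (x + h n))))
     \<longlonglongrightarrow> norm c * (2 * (LBINT x. ?i x) - 2 * (LBINT x. ?i x))"
    by (intro tendsto_intros lim)
  then show "(\<lambda>n. LBINT x. norm (?i (x + h n) *\<^sub>R c - ?i x *\<^sub>R c)) \<longlonglongrightarrow> 0"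
    unfolding eq by simp
qed

text \<open>Induction over integrable functions; outer regularity replaces a measurable set of
  finite measure by an open one at small cost in L1.\<close>

lemma L1_continuous_shift_integrable:
  fixes f :: "'a::euclidean_space \<Rightarrow> 'b::{banach, second_countable_topology}"
  assumes "integrable lborel f"
  shows "L1_continuous_shift f"
  using assms
proof (induction rule: integrable_induct)
  case (base A c)
  then have [measurable]: "A \<in> sets borel" by simp
  show ?case
  proof (rule L1_continuous_shift_approx)
    fix e :: real assume e: "e > 0"
    \<comment> \<open>The summand 1 keeps the quotient meaningful when \<open>c\<close> is
      0.\<close>
    define e' where "e' = e / (norm c + 1)"
    have "norm c + 1 > 0" by (simp add: add_nonneg_pos)
    then have e': "e' > 0" "norm c * e' < e"
      using e by (simp_all add: e'_def pos_divide_less_eq algebra_simps)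
    obtain U where U: "open U" "A \<subseteq> U" "emeasure lborel (U - A) < ennreal e'"
      using outer_regular_lborel[OF \<open>A \<in> sets borel\<close> e'(1)] by blast
    have [measurable]: "U \<in> sets borel" using U by simp
    have UA: "emeasure lborel U \<le> emeasure lborel A + emeasure lborel (U - A)"
      using U(2) by (metis Un_Diff_cancel emeasure_subadditive sets_lborel sup.absorb2 sets.Diff
        \<open>A \<in> sets borel\<close> \<open>U \<in> sets borel\<close>)
    then have finU: "emeasure lborel U < \<infinity>"
      using base(2) U(3) by (metis ennreal_add_less_top infinity_ennreal_def le_less_trans
        less_trans ennreal_less_top)
    have "(LBINT x. norm (indicator A x *\<^sub>R c - indicator U x *\<^sub>R c))
        = (LBINT x. norm c * indicator (U - A) x)"
      by (rule Bochner_Integration.integral_cong) (use U(2) in \<open>auto simp: indicator_def\<close>)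
    also have "\<dots> = norm c * measure lborel (U - A)"
      by simp
    also have "\<dots> \<le> norm c * e'"
      using U(3) e' by (intro mult_left_mono) (auto simp: measure_def enn2real_leI)
    also have "\<dots> < e" by fact
    finally have "(LBINT x. norm (indicator A x *\<^sub>R c - indicator U x *\<^sub>R c)) < e" .
    moreover have "integrable lborel (\<lambda>x. indicator U x *\<^sub>R c)"
      using finU by (simp add: integrable_indicator_iff)
    ultimately show "\<exists>g. integrable lborel g \<and> L1_continuous_shift g \<and>
        (LBINT x. norm (indicator A x *\<^sub>R c - g x)) < e"
      using L1_continuous_shift_open[OF U(1) finU, of c] by blast
  qed (use base in \<open>simp add: integrable_indicator_iff\<close>)
next
  case (add f g)
  show ?case
    unfolding L1_continuous_shift_def
  proof (intro allI impI)
    fix h :: "nat \<Rightarrow> 'a" assume h: "h \<longlonglongrightarrow> 0"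
    have i: "integrable lborel (\<lambda>x. f (x + h n))" "integrable lborel (\<lambda>x. g (x + h n))" for n
      using add by (simp_all add: integrable_lborel_shift)
    show "(\<lambda>n. LBINT x. norm (f (x + h n) + g (x + h n) - (f x + g x))) \<longlonglongrightarrow> 0"
    proof (rule tendsto_sandwich[OF _ _ tendsto_const])
      show "(\<lambda>n. (LBINT x. norm (f (x + h n) - f x)) + (LBINT x. norm (g (x + h n) - g x))) \<longlonglongrightarrow> 0"
        using add h unfolding L1_continuous_shift_def by (auto intro!: tendsto_add_zero)
      show "\<forall>\<^sub>F n in sequentially. (LBINT x. norm (f (x + h n) + g (x + h n) - (f x + g x)))
         \<le> (LBINT x. norm (f (x + h n) - f x)) + (LBINT x. norm (g (x + h n) - g x))"
      proof (rule always_eventually, rule allI)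
        fix n
        have "(LBINT x. norm (f (x + h n) + g (x + h n) - (f x + g x)))
          \<le> (LBINT x. norm (f (x + h n) - f x) + norm (g (x + h n) - g x))"
          using i add by (intro integral_mono norm_diff_triangle_ineq) auto
        also have "\<dots> = (LBINT x. norm (f (x + h n) - f x)) + (LBINT x. norm (g (x + h n) - g x))"
          using i add by simp
        finally show "(LBINT x. norm (f (x + h n) + g (x + h n) - (f x + g x))) \<le> \<dots>" .
      qed
    qed (auto intro!: always_eventually)
  qed
next
  case (lim f s)
  have s: "integrable lborel (s i)" "integrable lborel f" "(\<lambda>i. s i x) \<longlonglongrightarrow> f x"
    "norm (s i x) \<le> 2 * norm (f x)" for i x
    using lim by auto
  show ?case
  proof (rule L1_continuous_shift_approx)
    fix e :: real assume e: "e > 0"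
    have [measurable]: "f \<in> borel_measurable borel" "\<And>i. s i \<in> borel_measurable borel"
      using s(1,2)[THEN borel_measurable_integrable] by simp_all
    have "(\<lambda>n. LBINT x. norm (f x - s n x)) \<longlonglongrightarrow> (\<integral>x. 0 \<partial>(lborel :: 'a measure))"
    proof (rule integral_dominated_convergence[where w="\<lambda>x. 3 * norm (f x)"])
      show "AE x in lborel. (\<lambda>n. norm (f x - s n x)) \<longlonglongrightarrow> 0"
      proof (rule AE_I2)
        fix x
        have "(\<lambda>n. norm (f x - s n x)) \<longlonglongrightarrow> norm (f x - f x)"
          by (intro tendsto_intros s)
        then show "(\<lambda>n. norm (f x - s n x)) \<longlonglongrightarrow> 0" by simp
      qed
      show "AE x in lborel. norm (norm (f x - s n x)) \<le> 3 * norm (f x)" for n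
      proof (rule AE_I2)
        fix x
        show "norm (norm (f x - s n x)) \<le> 3 * norm (f x)"
          using norm_triangle_ineq4[of "f x" "s n x"] s(4)[of n x] by simp
      qed
    qed (use s in auto)
    from LIMSEQ_D[OF this e] obtain n where "(LBINT x. norm (f x - s n x)) < e" by auto
    then show "\<exists>g. integrable lborel g \<and> L1_continuous_shift g \<and> (LBINT x. norm (f x - g x)) < e"
      using lim by blast
  qed (fact s)
qed

section \<open>The inverse Fourier integral of an integrable function\<close>

lemma measurable_cis [measurable]: "cis \<in> borel_measurable borel"
  by (intro borel_measurable_continuous_onI continuous_intros)

lemma isCont_cis: "isCont cis x"
  using continuous_on_cis[OF continuous_on_id, of UNIV] by (simp add: continuous_on_eq_continuous_at)

lemma fubini_bounded_integrable:
  fixes F :: "'a::euclidean_space \<Rightarrow> complex" and G :: "'b::euclidean_space \<Rightarrow> complex"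
  assumes F: "integrable lborel F" and G: "integrable lborel G"
    and k[measurable]: "case_prod k \<in> borel_measurable (lborel \<Otimes>\<^sub>M lborel)"
    and B: "\<And>x y. norm (k x y) \<le> B"
  shows "integrable (lborel \<Otimes>\<^sub>M lborel) (\<lambda>(x, y). F x * (G y * k x y))"
proof -
  have [measurable]: "F \<in> borel_measurable borel" "G \<in> borel_measurable borel"
    using borel_measurable_integrable[OF F] borel_measurable_integrable[OF G] by simp_all
  have B0: "B \<ge> 0" using B[of undefined undefined] norm_ge_zero order_trans by blast
  have i: "integrable lborel (\<lambda>y. G y * k x y)" for x
    by (rule integrable_bounded_mult[OF G _ B]) measurable
  have b: "(LBINT y. norm (F x * (G y * k x y))) \<le> norm (F x) * ((LBINT y. norm (G y)) * B)" for x
  proof -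
    have "(LBINT y. norm (F x * (G y * k x y))) = norm (F x) * (LBINT y. norm (G y * k x y))"
      by (simp add: norm_mult)
    also have "\<dots> \<le> norm (F x) * (LBINT y. norm (G y) * B)"
      by (intro mult_left_mono integral_mono integrable_norm i)
        (use G B in \<open>auto simp: norm_mult intro!: mult_left_mono\<close>)
    finally show ?thesis by simp
  qed
  show ?thesis
  proof (rule lborel_pair.Fubini_integrable)
    show "integrable lborel (\<lambda>x. LBINT y. norm (case (x, y) of (x, y) \<Rightarrow> F x * (G y * k x y)))"
    proof (rule Bochner_Integration.integrable_bound[where f="\<lambda>x. norm (F x) * ((LBINT y. norm (G y)) * B)"])
      show "AE x in lborel. norm (LBINT y. norm (case (x, y) of (x, y) \<Rightarrow> F x * (G y * k x y)))
        \<le> norm (norm (F x) * ((LBINT y. norm (G y)) * B))"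
        using b B0 by (auto simp: abs_mult integral_nonneg_AE intro!: AE_I2)
    qed (use F in auto)
  qed (use i in auto)
qed

lemma fubini_bounded:
  fixes F :: "'a::euclidean_space \<Rightarrow> complex" and G :: "'b::euclidean_space \<Rightarrow> complex"
  assumes F: "integrable lborel F" and G: "integrable lborel G"
    and k[measurable]: "case_prod k \<in> borel_measurable (lborel \<Otimes>\<^sub>M lborel)"
    and B: "\<And>x y. norm (k x y) \<le> B"
  shows "(LBINT x. F x * (LBINT y. G y * k x y)) = (LBINT y. G y * (LBINT x. F x * k x y))"
proof -
  have "(LBINT x. F x * (LBINT y. G y * k x y)) = (LBINT x. (LBINT y. F x * (G y * k x y)))"
    by simp
  also have "\<dots> = (LBINT y. (LBINT x. F x * (G y * k x y)))"
    by (rule lborel_pair.Fubini_integral[symmetric, OF fubini_bounded_integrable[OF assms]])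
  also have "\<dots> = (LBINT y. (LBINT x. G y * (F x * k x y)))"
    by (simp add: mult.left_commute)
  finally show ?thesis by simp
qed

text \<open>The constant \<open>1 / (2 * pi) ^ DIM('a)\<close> sits in \<open>fourier\<close>, so
  the inverse transform carries none. The forward transform is this integral at the reflected point
  times that constant, and the analysis is carried out with \<open>ift\<close>.\<close>

definition ift :: "('a::euclidean_space \<Rightarrow> complex) \<Rightarrow> 'a \<Rightarrow> complex" where
  "ift G x = (LBINT \<xi>. G \<xi> * cis (x \<bullet> \<xi>))"

lemma fourier_eq_ift: "fourier g \<xi> = of_real (1 / (2 * pi) ^ DIM('a)) * ift g (- \<xi>)"
  for g :: "'a::euclidean_space \<Rightarrow> complex"
  by (simp add: fourier_def ift_def cis_conv_exp inner_commute)

lemma integrable_cis: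
  assumes "integrable lborel (G :: 'a::euclidean_space \<Rightarrow> complex)"
  shows "integrable lborel (\<lambda>\<xi>. G \<xi> * cis (x \<bullet> \<xi>))"
  by (rule integrable_bounded_mult[OF assms, where B=1]) auto

lemma norm_ift_le: "norm (ift G x) \<le> (LBINT \<xi>. norm (G \<xi>))"
  unfolding ift_def by (rule order_trans[OF integral_norm_bound]) (simp add: norm_mult)

lemma measurable_ift [measurable]:
  assumes [measurable]: "G \<in> borel_measurable borel"
  shows "ift G \<in> borel_measurable borel"
  unfolding ift_def by measurable

lemma continuous_ift:
  assumes G: "integrable lborel (G :: 'a::euclidean_space \<Rightarrow> complex)"
  shows "continuous_on UNIV (ift G)"
proof -
  note [measurable] = integrable_lborel_measurable[OF G]
  have "isCont (ift G) x" for x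
    unfolding continuous_at_sequentially
  proof (intro allI impI)
    fix X assume X: "X \<longlonglongrightarrow> x"
    show "(ift G \<circ> X) \<longlonglongrightarrow> ift G x"
      unfolding ift_def comp_def
    proof (rule integral_dominated_convergence[where w="\<lambda>\<xi>. norm (G \<xi>)"])
      have "(\<lambda>n. cis (X n \<bullet> \<xi>)) \<longlonglongrightarrow> cis (x \<bullet> \<xi>)" for \<xi>
        by (rule isCont_tendsto_compose[OF isCont_cis tendsto_inner[OF X tendsto_const]])
      then show "AE \<xi> in lborel. (\<lambda>n. G \<xi> * cis (X n \<bullet> \<xi>)) \<longlonglongrightarrow> G \<xi> * cis (x \<bullet> \<xi>)"
        by (intro AE_I2 tendsto_mult tendsto_const)
    qed (use G in \<open>auto simp: norm_mult\<close>)
  qed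
  then show ?thesis by (simp add: continuous_at_imp_continuous_on)
qed

lemma integral_lborel_prod:
  fixes f :: "'a::euclidean_space \<Rightarrow> real \<Rightarrow> 'b::{real_normed_field, banach, second_countable_topology}"
  assumes f: "\<And>b. b \<in> Basis \<Longrightarrow> integrable lborel (f b)"
  shows "(\<integral>x. (\<Prod>b\<in>Basis. f b (x \<bullet> b)) \<partial>(lborel :: 'a measure)) = (\<Prod>b\<in>Basis. LBINT x. f b x)"
proof -
  interpret product_sigma_finite "\<lambda>_::'a. lborel :: real measure" ..
  have [measurable]: "f b \<in> borel_measurable borel" if "b \<in> Basis" for b
    using borel_measurable_integrable[OF f[OF that]] by simp
  have "(\<integral>x. (\<Prod>b\<in>Basis. f b (x \<bullet> b)) \<partial>(lborel :: 'a measure)) =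
      (\<integral>x. (\<Prod>b\<in>Basis. f b (x b)) \<partial>(\<Pi>\<^sub>M b\<in>Basis. lborel))"
    by (subst lborel_eq) (simp add: integral_distr)
  also have "\<dots> = (\<Prod>b\<in>Basis. LBINT x. f b x)"
    by (rule product_integral_prod) (use f in auto)
  finally show ?thesis .
qed

section \<open>Gaussians and their transforms\<close>

definition std_gaussian :: "'a::euclidean_space \<Rightarrow> real" where
  "std_gaussian x = exp (- (norm x)\<^sup>2 / 2) / sqrt (2 * pi) ^ DIM('a)"

lemma norm_square_eq_sum: "(norm (x::'a::euclidean_space))\<^sup>2 = (\<Sum>b\<in>Basis. (x \<bullet> b)\<^sup>2)"
  by (simp add: norm_eq_sqrt_inner euclidean_inner[of x x] power2_eq_square sum_nonneg)

lemma std_gaussian_prod: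
  "std_gaussian (x :: 'a::euclidean_space) = (\<Prod>b\<in>Basis. std_normal_density (x \<bullet> b))"
  by (simp add: std_gaussian_def norm_square_eq_sum std_normal_density_def prod.distrib exp_sum
      sum_divide_distrib sum_negf[symmetric] power_divide prod_dividef)

lemma std_gaussian_pos: "std_gaussian x > 0"
  by (simp add: std_gaussian_def)

lemma abs_std_gaussian [simp]: "\<bar>std_gaussian x\<bar> = std_gaussian x"
  and std_gaussian_nonneg [simp]: "0 \<le> std_gaussian x"
  using std_gaussian_pos[of x] by auto

lemma measurable_std_gaussian [measurable]: "std_gaussian \<in> borel_measurable borel"
  unfolding std_gaussian_def by measurable

lemma nn_integral_std_gaussian: "(\<integral>\<^sup>+x. std_gaussian (x::'a::euclidean_space) \<partial>lborel) = 1"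
proof -
  have "(\<integral>\<^sup>+x. std_gaussian (x::'a) \<partial>lborel) = (\<integral>\<^sup>+x. (\<Prod>b\<in>Basis. ennreal (std_normal_density ((x::'a) \<bullet> b))) \<partial>lborel)"
    by (simp add: std_gaussian_prod prod_ennreal)
  also have "\<dots> = (\<Prod>b\<in>(Basis :: 'a set). (\<integral>\<^sup>+x. std_normal_density x \<partial>lborel))"
    by (rule nn_integral_lborel_prod) auto
  also have "(\<integral>\<^sup>+x. std_normal_density x \<partial>lborel) = 1"
    by (subst nn_integral_eq_integral) auto
  finally show ?thesis by simp
qed

lemma integrable_std_gaussian [simp]: "integrable lborel (std_gaussian :: 'a::euclidean_space \<Rightarrow> real)"
  and integral_std_gaussian [simp]: "(LBINT x. std_gaussian (x::'a::euclidean_space)) = 1"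
proof -
  show "integrable lborel (std_gaussian :: 'a \<Rightarrow> real)"
    using nn_integral_std_gaussian[where 'a='a]
    by (simp add: integrable_iff_bounded abs_of_pos)
  show "(LBINT x. std_gaussian (x::'a::euclidean_space)) = 1"
    using nn_integral_std_gaussian[where 'a='a]
    by (simp add: integral_eq_nn_integral)
qed

lemma integral_std_normal_cis:
  "(LBINT x. of_real (std_normal_density x) * cis (x * t)) = of_real (exp (- t\<^sup>2 / 2))"
proof -
  have "of_real (exp (- t\<^sup>2 / 2)) = char std_normal_distribution t"
    by (simp add: char_std_normal_distribution)
  also have "\<dots> = (LBINT x. std_normal_density x *\<^sub>R iexp (t * x))"
    unfolding char_def by (subst integral_density) auto
  also have "\<dots> = (LBINT x. of_real (std_normal_density x) * cis (x * t))"
    by (simp add: scaleR_conv_of_real cis_conv_exp mult.commute)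
  finally show ?thesis by simp
qed

lemma ift_std_gaussian:
  "ift (\<lambda>x. of_real (std_gaussian x)) \<xi> = of_real (exp (- (norm (\<xi>::'a::euclidean_space))\<^sup>2 / 2))"
proof -
  have cis_sum: "cis (\<Sum>b\<in>A. f b) = (\<Prod>b\<in>A. cis (f b))" if "finite A" for A :: "'a set" and f
    using that by induction (auto simp: cis_mult[symmetric])
  have "ift (\<lambda>x. of_real (std_gaussian x)) \<xi>
      = (LBINT x. (\<Prod>b\<in>Basis. of_real (std_normal_density (x \<bullet> b)) * cis ((x \<bullet> b) * (\<xi> \<bullet> b))))"
    unfolding ift_def
    by (subst euclidean_inner) (simp add: cis_sum std_gaussian_prod prod.distrib mult.commute)
  also have "\<dots> = (\<Prod>b\<in>Basis. (LBINT x. of_real (std_normal_density x) * cis (x * (\<xi> \<bullet> b))))"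
    by (rule integral_lborel_prod, rule integrable_bounded_mult[where B=1]) auto
  also have "\<dots> = of_real (exp (- (norm \<xi>)\<^sup>2 / 2))"
    by (simp only: integral_std_normal_cis norm_square_eq_sum)
      (simp add: exp_sum[symmetric] sum_divide_distrib sum_negf[symmetric] flip: of_real_prod)
  finally show ?thesis .
qed

text \<open>A convergence factor with value 1 at the origin, tending to 1 pointwise as
  \<open>t\<close> tends to 0. Its inverse transform is, up to the factor
  \<open>(2 * pi) ^ DIM('a)\<close>, a probability density concentrated at scale
  \<open>t\<close>.\<close>

definition damp :: "real \<Rightarrow> 'a::euclidean_space \<Rightarrow> real" where
  "damp t x = exp (- t\<^sup>2 * (norm x)\<^sup>2 / 2)"

lemma measurable_damp [measurable]: "damp t \<in> borel_measurable borel"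
  unfolding damp_def by measurable

lemma damp_bounds [simp]: "0 < damp t x" "0 \<le> damp t x" "damp t x \<le> 1" "\<bar>damp t x\<bar> = damp t x" "damp t x \<noteq> 0"
  by (simp_all add: damp_def)

lemma damp_eq_gaussian:
  "damp t x = sqrt (2 * pi) ^ DIM('a) * std_gaussian (t *\<^sub>R (x::'a::euclidean_space))"
  by (simp add: damp_def std_gaussian_def power_mult_distrib)

lemma integrable_damp:
  assumes "t > 0"
  shows "integrable lborel (damp t :: 'a::euclidean_space \<Rightarrow> real)"
  using integrable_lborel_affine[of "std_gaussian :: 'a \<Rightarrow> real" t 0] assms
  by (simp add: damp_eq_gaussian[abs_def])

lemma ift_damp:
  assumes "t > 0"
  shows "ift (\<lambda>x. of_real (damp t x)) \<xi> = of_real ((2 * pi / t) ^ DIM('a) * std_gaussian ((1 / t) *\<^sub>R (\<xi>::'a::euclidean_space)))"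
proof -
  have "ift (\<lambda>x. of_real (damp t x)) \<xi>
     = (1 / t) ^ DIM('a) *\<^sub>R (\<integral>x. of_real (damp t ((1 / t) *\<^sub>R x)) * cis (\<xi> \<bullet> ((1 / t) *\<^sub>R x)) \<partial>(lborel :: 'a measure))"
    unfolding ift_def using assms by (subst integral_lborel_affine[of "1 / t" _ 0]) auto
  also have "\<dots> = (1 / t) ^ DIM('a) *\<^sub>R (of_real (sqrt (2 * pi) ^ DIM('a)) * ift (\<lambda>x. of_real (std_gaussian x)) ((1 / t) *\<^sub>R \<xi>))"
    using assms by (simp add: ift_def damp_eq_gaussian mult.assoc)
  also have "\<dots> = of_real ((1 / t) ^ DIM('a) * sqrt (2 * pi) ^ DIM('a) * exp (- (norm ((1 / t) *\<^sub>R \<xi>))\<^sup>2 / 2))"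
    unfolding ift_std_gaussian by (simp add: scaleR_conv_of_real)
  \<comment> \<open>One factor \<open>sqrt (2 * pi) ^ DIM('a)\<close> came from
    \<open>damp_eq_gaussian\<close>; this rewriting supplies the second, and together they form the
    power of 2 pi.\<close>
  also have "exp (- (norm ((1 / t) *\<^sub>R \<xi>))\<^sup>2 / 2) = sqrt (2 * pi) ^ DIM('a) * std_gaussian ((1 / t) *\<^sub>R \<xi>)"
    by (simp add: std_gaussian_def)
  also have "(1 / t) ^ DIM('a) * sqrt (2 * pi) ^ DIM('a) * (sqrt (2 * pi) ^ DIM('a) * std_gaussian ((1 / t) *\<^sub>R \<xi>))
     = ((1 / t) * (sqrt (2 * pi) * sqrt (2 * pi))) ^ DIM('a) * std_gaussian ((1 / t) *\<^sub>R \<xi>)"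
    by (simp only: power_mult_distrib mult_ac)
  finally show ?thesis by simp
qed

text \<open>The Gaussian factor makes the double integral absolutely convergent even when
  \<open>ift H\<close> is not integrable. Exchanging the order leaves the transform of
  \<open>damp t\<close> centred at \<open>a\<close>, and \<xi> = a + t z turns that into a Gaussian
  average of \<open>H\<close>. Both inversion and injectivity rest on this identity.\<close>

lemma damped_inversion:
  fixes H :: "'a::euclidean_space \<Rightarrow> complex"
  assumes H: "integrable lborel H" and t: "t > 0"
  shows "(LBINT x. ift H x * (cis (- (x \<bullet> a)) * of_real (damp t x)))
    = of_real ((2 * pi) ^ DIM('a)) * (LBINT z. of_real (std_gaussian z) * H (a + t *\<^sub>R z))"
proof -
  have d: "integrable lborel (\<lambda>x::'a. complex_of_real (damp t x))"
    using integrable_damp[OF t, where 'a='a] by simp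
  have i: "integrable lborel (\<lambda>x. cis (- (x \<bullet> a)) * complex_of_real (damp t x))"
    by (rule integrable_bounded_mult[OF d, where B=1]) auto
  have "(LBINT x. ift H x * (cis (- (x \<bullet> a)) * of_real (damp t x)))
      = (LBINT x. (cis (- (x \<bullet> a)) * of_real (damp t x)) * (LBINT \<xi>. H \<xi> * cis (x \<bullet> \<xi>)))"
    by (simp add: ift_def mult.commute)
  also have "\<dots> = (LBINT \<xi>. H \<xi> * (LBINT x. (cis (- (x \<bullet> a)) * of_real (damp t x)) * cis (x \<bullet> \<xi>)))"
    by (rule fubini_bounded[OF i H, where B=1]) (auto simp: case_prod_beta)
  also have "\<dots> = (LBINT \<xi>. H \<xi> * ift (\<lambda>x. of_real (damp t x)) (\<xi> - a))"
    unfolding ift_def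
  proof (intro Bochner_Integration.integral_cong refl)
    fix \<xi> :: 'a
    have "cis (- (x \<bullet> a)) * cis (x \<bullet> \<xi>) = cis ((\<xi> - a) \<bullet> x)" for x
      by (simp add: cis_mult inner_diff_left inner_commute[of x a] inner_commute[of x \<xi>])
    then have "cis (- (x \<bullet> a)) * of_real (damp t x) * cis (x \<bullet> \<xi>) = of_real (damp t x) * cis ((\<xi> - a) \<bullet> x)" for x :: 'a
      by (simp add: mult_ac)
    then show "H \<xi> * (LBINT x. cis (- (x \<bullet> a)) * of_real (damp t x) * cis (x \<bullet> \<xi>))
      = H \<xi> * (LBINT x. of_real (damp t x) * cis ((\<xi> - a) \<bullet> x))" by presburger
  qed
  also have "\<dots> = \<bar>t\<bar> ^ DIM('a) *\<^sub>R (LBINT z. H (a + t *\<^sub>R z) * ift (\<lambda>x. of_real (damp t x)) (t *\<^sub>R z))"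
    using t by (subst integral_lborel_affine[of t _ a]) auto
  also have "\<dots> = t ^ DIM('a) *\<^sub>R (LBINT z. of_real ((2 * pi / t) ^ DIM('a)) * (of_real (std_gaussian z) * H (a + t *\<^sub>R z)))"
    using t by (simp add: ift_damp mult_ac)
  also have "\<dots> = of_real ((2 * pi) ^ DIM('a)) * (LBINT z. of_real (std_gaussian z) * H (a + t *\<^sub>R z))"
    using t by (simp add: scaleR_conv_of_real power_divide flip: of_real_mult)
  finally show ?thesis .
qed

lemma gaussian_approx_identity:
  fixes f :: "'a::euclidean_space \<Rightarrow> complex"
  assumes f: "continuous_on UNIV f" and B: "\<And>x. norm (f x) \<le> B" and t: "t \<longlonglongrightarrow> 0"
  shows "(\<lambda>n. LBINT z. of_real (std_gaussian z) * f (a + t n *\<^sub>R z)) \<longlonglongrightarrow> f a"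
proof -
  have [measurable]: "f \<in> borel_measurable borel"
    using f by (rule borel_measurable_continuous_onI)
  have "(\<lambda>n. LBINT z. of_real (std_gaussian z) * f (a + t n *\<^sub>R z)) \<longlonglongrightarrow> (LBINT z. of_real (std_gaussian (z::'a)) * f a)"
  proof (rule integral_dominated_convergence[where w="\<lambda>z. std_gaussian z * B"])
    have "(\<lambda>n. f (a + t n *\<^sub>R z)) \<longlonglongrightarrow> f a" for z
    proof (rule isCont_tendsto_compose[where g=f])
      show "isCont f a" using f by (simp add: continuous_on_eq_continuous_at)
      show "(\<lambda>n. a + t n *\<^sub>R z) \<longlonglongrightarrow> a"
        using tendsto_add[OF tendsto_const tendsto_scaleR[OF t tendsto_const], of a z] by simp
    qed
    then show "AE z in lborel. (\<lambda>n. of_real (std_gaussian z) * f (a + t n *\<^sub>R z)) \<longlonglongrightarrow> of_real (std_gaussian z) * f a"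
      by (intro AE_I2 tendsto_intros)
    show "AE z in lborel. norm (of_real (std_gaussian z) * f (a + t n *\<^sub>R z)) \<le> std_gaussian z * B" for n
      using B by (auto simp: norm_mult intro!: mult_left_mono AE_I2)
  qed auto
  then show ?thesis by simp
qed

text \<open>Both sides of \<open>damped_inversion\<close> are followed as t = 1/(n+1) tends to 0:
  integrability of \<open>ift H\<close> removes the damping on the left, while continuity and
  boundedness of \<open>H\<close> collapse the average to \<open>H a\<close> on the right.\<close>

lemma ift_inversion:
  fixes H :: "'a::euclidean_space \<Rightarrow> complex"
  assumes H: "integrable lborel H" "continuous_on UNIV H" "\<And>x. norm (H x) \<le> B"
    and h: "integrable lborel (ift H)"
  shows "(LBINT x. ift H x * cis (- (x \<bullet> a))) = of_real ((2 * pi) ^ DIM('a)) * H a"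
proof (rule LIMSEQ_unique)
  let ?t = "\<lambda>n. 1 / real (Suc n)"
  have t: "?t \<longlonglongrightarrow> 0" using LIMSEQ_inverse_real_of_nat by (simp add: inverse_eq_divide)
  let ?L = "\<lambda>n. LBINT x. ift H x * (cis (- (x \<bullet> a)) * of_real (damp (?t n) x))"
  note [measurable] = integrable_lborel_measurable[OF H(1)]
  show "?L \<longlonglongrightarrow> of_real ((2 * pi) ^ DIM('a)) * H a"
    by (subst damped_inversion[OF H(1)], simp, intro tendsto_intros gaussian_approx_identity[OF H(2,3) t])
  show "?L \<longlonglongrightarrow> (LBINT x. ift H x * cis (- (x \<bullet> a)))"
  proof (rule integral_dominated_convergence[where w="\<lambda>x. norm (ift H x)"])
    have "(\<lambda>n. damp (?t n) x) \<longlonglongrightarrow> exp (- 0\<^sup>2 * (norm x)\<^sup>2 / 2)" for x :: 'a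
      unfolding damp_def by (intro tendsto_intros t) auto
    then have "(\<lambda>n. damp (?t n) x) \<longlonglongrightarrow> 1" for x :: 'a
      by simp
    then have "(\<lambda>n. ift H x * (cis (- (x \<bullet> a)) * of_real (damp (?t n) x))) \<longlonglongrightarrow> ift H x * (cis (- (x \<bullet> a)) * of_real 1)" for x
      by (intro tendsto_intros)
    then show "AE x in lborel. (\<lambda>n. ift H x * (cis (- (x \<bullet> a)) * of_real (damp (?t n) x))) \<longlonglongrightarrow> ift H x * cis (- (x \<bullet> a))"
      by simp
    show "AE x in lborel. norm (ift H x * (cis (- (x \<bullet> a)) * of_real (damp (?t n) x))) \<le> norm (ift H x)" for n
      by (auto simp: norm_mult intro!: mult_left_le AE_I2)
  qed (use h in auto)
qed

text \<open>For a merely integrable \<open>H\<close> the averages have no evident pointwise limit,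
  so the limit is taken in L1. Vanishing averages make \<open>- H a\<close> the Gaussian mean of
  \<open>H (a + t z) - H a\<close>; integrating over \<open>a\<close> bounds the L1 norm of
  \<open>H\<close> by the Gaussian mean of the translation moduli \<open>D (t z)\<close>, which
  tends to 0.\<close>

lemma ift_injective:
  fixes H :: "'a::euclidean_space \<Rightarrow> complex"
  assumes H: "integrable lborel H" and 0: "\<And>x. ift H x = 0"
  shows "AE x in lborel. H x = 0"
proof -
  note [measurable] = integrable_lborel_measurable[OF H]
  define D where "D h = (LBINT a. norm (H (a + h) - H a))" for h
  have Dm[measurable]: "D \<in> borel_measurable borel"
    unfolding D_def by measurable
  have iH: "integrable lborel (\<lambda>x. H (x + h))" for h
    using H by (simp add: integrable_lborel_shift)
  have D: "0 \<le> D h" "D h \<le> 2 * (LBINT a. norm (H a))" for h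
  proof -
    have "D h \<le> (LBINT a. norm (H (a + h)) + norm (H a))"
      unfolding D_def using H iH by (intro integral_mono norm_triangle_ineq4) auto
    also have "\<dots> = (LBINT a. norm (H (a + h))) + (LBINT a. norm (H a))"
      using H iH by simp
    also have "(LBINT a. norm (H (a + h))) = (LBINT a. norm (H a))"
      by (rule integral_lborel_shift[of "\<lambda>a. norm (H a)"])
    finally show "D h \<le> 2 * (LBINT a. norm (H a))" by simp
  qed (simp add: D_def)
  let ?M = "\<lambda>n z. std_gaussian z * D ((1 / real (Suc n)) *\<^sub>R z)"
  let ?C = "2 * (LBINT a. norm (H a))"
  have iM: "integrable lborel (?M n)" for n
  proof (rule Bochner_Integration.integrable_bound[where f="\<lambda>z. std_gaussian z * ?C"])
    show "AE z in lborel. norm (?M n z) \<le> norm (std_gaussian z * ?C)"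
      using D by (intro AE_I2) (simp add: abs_mult mult_left_mono)
  qed auto
  have bound: "(\<integral>\<^sup>+a. norm (H a) \<partial>lborel) \<le> ennreal (LBINT z. ?M n z)" for n
  proof -
    let ?t = "1 / real (Suc n)"
    have pt: "norm (H a) \<le> (LBINT z. norm (of_real (std_gaussian z) * (H (a + ?t *\<^sub>R z) - H a)))" for a
    proof -
      \<comment> \<open>The Gaussian density plays the bounded factor and the rescaled
        \<open>H\<close> the integrable one, so the pointwise estimate holds for every
        \<open>a\<close>.\<close>
      have i1: "integrable lborel (\<lambda>z. of_real (std_gaussian z) * H (a + ?t *\<^sub>R z))"
      proof (rule integrable_bounded_mult(2)[where B="1 / sqrt (2 * pi) ^ DIM('a)"])
        show "integrable lborel (\<lambda>z. H (a + ?t *\<^sub>R z))"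
          using H by (intro integrable_lborel_affine) auto
        show "norm (complex_of_real (std_gaussian z)) \<le> 1 / sqrt (2 * pi) ^ DIM('a)" for z :: 'a
          by (auto simp: std_gaussian_def norm_divide norm_power divide_right_mono)
      qed auto
      have "(LBINT x. ift H x * (cis (- (x \<bullet> a)) * of_real (damp ?t x))) = 0"
        using 0 by simp
      then have "(LBINT z. of_real (std_gaussian z) * H (a + ?t *\<^sub>R z)) = 0"
        by (subst (asm) damped_inversion[OF H]) auto
      then have "- H a = (LBINT z. of_real (std_gaussian z) * H (a + ?t *\<^sub>R z)) - (LBINT z. of_real (std_gaussian (z::'a)) * H a)"
        by simp
      also have "\<dots> = (LBINT z. of_real (std_gaussian z) * (H (a + ?t *\<^sub>R z) - H a))"
        using i1 by (subst Bochner_Integration.integral_diff[symmetric]) (auto simp: algebra_simps)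
      finally have "norm (H a) = norm (LBINT z. of_real (std_gaussian z) * (H (a + ?t *\<^sub>R z) - H a))"
        by (metis norm_minus_cancel)
      then show ?thesis
        using integral_norm_bound[of lborel "\<lambda>z. of_real (std_gaussian z) * (H (a + ?t *\<^sub>R z) - H a)"] by simp
    qed
    have "(\<integral>\<^sup>+a. norm (H a) \<partial>lborel)
       \<le> (\<integral>\<^sup>+a. (\<integral>\<^sup>+z. ennreal (std_gaussian z * norm (H (a + ?t *\<^sub>R z) - H a)) \<partial>lborel) \<partial>lborel)"
    proof (rule nn_integral_mono)
      fix a
      have "ennreal (norm (H a)) \<le> ennreal (LBINT z. norm (of_real (std_gaussian z) * (H (a + ?t *\<^sub>R z) - H a)))"
        using pt by (rule ennreal_leI)
      \<comment> \<open>A non-integrable integrand has Bochner integral 0, so the comparison with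
        the nonnegative integral holds in either case.\<close>
      also have "\<dots> \<le> (\<integral>\<^sup>+z. norm (norm (of_real (std_gaussian z) * (H (a + ?t *\<^sub>R z) - H a))) \<partial>lborel)"
        using integral_norm_bound_ennreal[of lborel "\<lambda>z. norm (of_real (std_gaussian z) * (H (a + ?t *\<^sub>R z) - H a))"]
        by (cases "integrable lborel (\<lambda>z. norm (of_real (std_gaussian z) * (H (a + ?t *\<^sub>R z) - H a)))")
          (auto simp: not_integrable_integral_eq)
      also have "\<dots> = (\<integral>\<^sup>+z. ennreal (std_gaussian z * norm (H (a + ?t *\<^sub>R z) - H a)) \<partial>lborel)"
        by (simp add: norm_mult)
      finally show "ennreal (norm (H a)) \<le> \<dots>" .
    qed
    also have "\<dots> = (\<integral>\<^sup>+z. (\<integral>\<^sup>+a. ennreal (std_gaussian z * norm (H (a + ?t *\<^sub>R z) - H a)) \<partial>lborel) \<partial>lborel)"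
      by (rule lborel_pair.Fubini') auto
    also have "\<dots> = (\<integral>\<^sup>+z. ennreal (?M n z) \<partial>lborel)"
    proof (rule nn_integral_cong)
      fix z :: 'a
      have "(\<integral>\<^sup>+a. ennreal (std_gaussian z * norm (H (a + ?t *\<^sub>R z) - H a)) \<partial>lborel)
        = ennreal (LBINT a. std_gaussian z * norm (H (a + ?t *\<^sub>R z) - H a))"
        using H iH by (intro nn_integral_eq_integral) auto
      then show "(\<integral>\<^sup>+a. ennreal (std_gaussian z * norm (H (a + ?t *\<^sub>R z) - H a)) \<partial>lborel) = ennreal (?M n z)"
        by (simp add: D_def)
    qed
    also have "\<dots> = ennreal (LBINT z. ?M n z)"
      using iM D by (intro nn_integral_eq_integral) (auto intro!: mult_nonneg_nonneg less_imp_le)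
    finally show ?thesis .
  qed
  have "(\<lambda>n. LBINT z. ?M n z) \<longlonglongrightarrow> (\<integral>x. 0 \<partial>(lborel :: 'a measure))"
  proof (rule integral_dominated_convergence[where w="\<lambda>z. std_gaussian z * ?C"])
    have "(\<lambda>n. D ((1 / real (Suc n)) *\<^sub>R z)) \<longlonglongrightarrow> 0" for z
    proof -
      have "(\<lambda>n. (1 / real (Suc n)) *\<^sub>R z) \<longlonglongrightarrow> 0 *\<^sub>R z"
        using LIMSEQ_inverse_real_of_nat by (intro tendsto_intros) (simp add: inverse_eq_divide)
      then show ?thesis
        using L1_continuous_shift_integrable[OF H] unfolding L1_continuous_shift_def D_def by simp
    qed
    then show "AE z in lborel. (\<lambda>n. ?M n z) \<longlonglongrightarrow> 0"
      by (intro AE_I2 tendsto_mult_right_zero)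
    show "AE z in lborel. norm (?M n z) \<le> std_gaussian z * ?C" for n
      using D by (auto simp: abs_mult intro!: mult_left_mono AE_I2)
  qed auto
  then have "(\<lambda>n. ennreal (LBINT z. ?M n z)) \<longlonglongrightarrow> ennreal 0"
    by (intro tendsto_ennrealI) simp
  then have "(\<integral>\<^sup>+a. norm (H a) \<partial>lborel) \<le> ennreal 0"
    by (rule LIMSEQ_le_const) (use bound in auto)
  then have "(\<integral>\<^sup>+a. norm (H a) \<partial>lborel) = 0" by simp
  then show ?thesis
    by (subst (asm) nn_integral_0_iff_AE) auto
qed

text \<open>Translating by h = pi X / |X|^2 changes the phase by pi and flips the sign of the
  character, so \<open>2 * ift G X\<close> is the transform of \<open>G\<close> minus its translate.
  As |h| = pi / |X|, continuity of translation rules out a sequence of points going to infinity at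
  which the transform stays large.\<close>

lemma riemann_lebesgue:
  fixes G :: "'a::euclidean_space \<Rightarrow> complex"
  assumes G: "integrable lborel G" and e: "e > 0"
  shows "\<exists>R. \<forall>x. norm x \<ge> R \<longrightarrow> norm (ift G x) < e"
proof (rule ccontr)
  assume "\<not> ?thesis"
  then have "\<forall>n. \<exists>x. norm x \<ge> real (Suc n) \<and> norm (ift G x) \<ge> e" by (auto simp: not_less)
  then obtain X where X: "\<And>n. norm (X n) \<ge> real (Suc n)" "\<And>n. norm (ift G (X n)) \<ge> e" by metis
  define h where "h n = (pi / (norm (X n))\<^sup>2) *\<^sub>R X n" for n
  have Xpos: "norm (X n) > 0" for n using X(1)[of n] by linarith
  have "h \<longlonglongrightarrow> 0"
  proof (rule Lim_null_comparison)
    show "\<forall>\<^sub>F n in sequentially. norm (h n) \<le> pi * (1 / real (Suc n))"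
    proof (rule always_eventually, rule allI)
      fix n
      have "norm (h n) = pi * (1 / norm (X n))"
        using Xpos[of n] by (simp add: h_def power2_eq_square)
      also have "\<dots> \<le> pi * (1 / real (Suc n))"
        using X(1)[of n] Xpos[of n] by (intro mult_left_mono divide_left_mono mult_pos_pos) auto
      finally show "norm (h n) \<le> pi * (1 / real (Suc n))" .
    qed
    show "(\<lambda>n. pi * (1 / real (Suc n))) \<longlonglongrightarrow> 0"
      using LIMSEQ_inverse_real_of_nat by (intro tendsto_mult_right_zero) (simp add: inverse_eq_divide)
  qed
  then have lim: "(\<lambda>n. LBINT \<xi>. norm (G (\<xi> + h n) - G \<xi>)) \<longlonglongrightarrow> 0"
    using L1_continuous_shift_integrable[OF G] unfolding L1_continuous_shift_def by blast
  have "2 * e \<le> (LBINT \<xi>. norm (G (\<xi> + h n) - G \<xi>))" for n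
  proof -
    have iGh: "integrable lborel (\<lambda>\<xi>. G (\<xi> + h n))"
      using G by (simp add: integrable_lborel_shift)
    have "X n \<bullet> h n = pi"
      using Xpos[of n] by (simp add: h_def power2_norm_eq_inner)
    then have "cis (X n \<bullet> (\<xi> + h n)) = - cis (X n \<bullet> \<xi>)" for \<xi>
      by (simp add: inner_add_right cis_mult[symmetric])
    then have "ift G (X n) = (LBINT \<xi>. G (\<xi> + h n) * - cis (X n \<bullet> \<xi>))"
      unfolding ift_def using integral_lborel_shift[of "\<lambda>\<xi>. G \<xi> * cis (X n \<bullet> \<xi>)" "h n"] by simp
    then have "2 * ift G (X n) = (LBINT \<xi>. G \<xi> * cis (X n \<bullet> \<xi>)) - (LBINT \<xi>. G (\<xi> + h n) * cis (X n \<bullet> \<xi>))"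
      by (simp add: ift_def)
    also have "\<dots> = (LBINT \<xi>. (G \<xi> - G (\<xi> + h n)) * cis (X n \<bullet> \<xi>))"
      using integrable_cis[OF G, of "X n"] integrable_cis[OF iGh, of "X n"]
      by (subst Bochner_Integration.integral_diff[symmetric]) (auto simp: algebra_simps)
    finally have "2 * norm (ift G (X n)) = norm (LBINT \<xi>. (G \<xi> - G (\<xi> + h n)) * cis (X n \<bullet> \<xi>))"
      by (metis norm_mult norm_numeral)
    also have "\<dots> \<le> (LBINT \<xi>. norm (G (\<xi> + h n) - G \<xi>))"
      by (rule order_trans[OF integral_norm_bound]) (simp add: norm_mult norm_minus_commute)
    finally show ?thesis using X(2)[of n] by linarith
  qed
  then have "2 * e \<le> 0" by (intro LIMSEQ_le_const[OF lim]) auto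
  with e show False by simp
qed

section \<open>Schwartz functions\<close>

lemma dir_deriv_eq:
  assumes "(f has_derivative D) (at x)"
  shows "dir_deriv b f x = D b"
    and "((\<lambda>t. f (x + t *\<^sub>R b)) has_vector_derivative D b) (at 0)"
proof -
  have "((\<lambda>t::real. x + t *\<^sub>R b) has_derivative (\<lambda>t. t *\<^sub>R b)) (at 0)"
    by (auto intro!: derivative_eq_intros)
  from has_derivative_compose[OF this, of f D] assms
  have "((\<lambda>t. f (x + t *\<^sub>R b)) has_derivative (\<lambda>t. D (t *\<^sub>R b))) (at 0)"
    by simp
  moreover have "D (t *\<^sub>R b) = t *\<^sub>R D b" for t
    using assms by (simp add: has_derivative_linear linear_scale)
  ultimately show *: "((\<lambda>t. f (x + t *\<^sub>R b)) has_vector_derivative D b) (at 0)"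
    by (simp add: has_vector_derivative_def)
  show "dir_deriv b f x = D b"
    unfolding dir_deriv_def by (rule vector_derivative_at[OF *])
qed

lemma has_vector_derivative_dir_deriv:
  assumes "f differentiable (at (x + t *\<^sub>R b))"
  shows "((\<lambda>t. f (x + t *\<^sub>R b)) has_vector_derivative dir_deriv b f (x + t *\<^sub>R b)) (at t)"
proof -
  obtain D where D: "(f has_derivative D) (at (x + t *\<^sub>R b))"
    using assms by (auto simp: differentiable_def)
  have "((\<lambda>s. x + s *\<^sub>R b) has_derivative (\<lambda>s. s *\<^sub>R b)) (at t)"
    by (auto intro!: derivative_eq_intros)
  from has_derivative_compose[OF this D]
  have "((\<lambda>s. f (x + s *\<^sub>R b)) has_derivative (\<lambda>s. D (s *\<^sub>R b))) (at t)" .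
  moreover have "D (s *\<^sub>R b) = s *\<^sub>R D b" for s
    using D by (simp add: has_derivative_linear linear_scale)
  ultimately show ?thesis
    by (simp add: has_vector_derivative_def dir_deriv_eq(1)[OF D])
qed

lemma schwartz_iter_deriv:
  assumes "\<phi> \<in> schwartz" "bs \<in> lists Basis"
  shows "iter_deriv bs \<phi> differentiable at x" "\<exists>C. \<forall>x. norm x ^ k * norm (iter_deriv bs \<phi> x) \<le> C"
  using assms unfolding schwartz_def by auto

lemma schwartz_dir_deriv:
  assumes "\<phi> \<in> schwartz" "b \<in> Basis"
  shows "dir_deriv b \<phi> \<in> schwartz"
proof -
  \<comment> \<open>\<open>foldr\<close> applies the last entry of the list first, so a derivative
    taken beforehand is appended at the end.\<close>
  have "iter_deriv bs (dir_deriv b \<phi>) = iter_deriv (bs @ [b]) \<phi>" for bs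
    by (simp add: iter_deriv_def)
  then show ?thesis
    using assms unfolding schwartz_def by auto
qed

lemma schwartz_differentiable: "\<phi> \<in> schwartz \<Longrightarrow> \<phi> differentiable at x"
  using schwartz_iter_deriv(1)[of \<phi> "[]"] by (simp add: iter_deriv_def)

lemma schwartz_continuous: "\<phi> \<in> schwartz \<Longrightarrow> continuous_on UNIV \<phi>"
  using schwartz_differentiable by (blast intro: differentiable_imp_continuous_within continuous_at_imp_continuous_on)

lemma schwartz_measurable: "\<phi> \<in> schwartz \<Longrightarrow> \<phi> \<in> borel_measurable borel"
  using schwartz_continuous borel_measurable_continuous_onI by blast

lemma schwartz_decay:
  assumes "\<phi> \<in> schwartz"
  shows "\<exists>C. \<forall>x. norm x ^ k * norm (\<phi> x) \<le> C"
  using schwartz_iter_deriv(2)[OF assms, of "[]"] by (simp add: iter_deriv_def)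

lemma schwartz_bounded:
  assumes "\<phi> \<in> schwartz"
  obtains C where "\<And>x. norm (\<phi> x) \<le> C"
  using schwartz_decay[OF assms, of 0] by auto

text \<open>\<open>arctan\<close> is a bounded primitive on the positive half-line, and reflection
  covers the negative one.\<close>

lemma integrable_inverse_1_plus_square_lborel: "integrable lborel (\<lambda>x::real. 1 / (1 + x\<^sup>2))"
proof -
  let ?f = "\<lambda>x::real. 1 / (1 + x\<^sup>2)"
  have fin: "(\<integral>\<^sup>+x. ennreal (?f x) * indicator {0..} x \<partial>lborel) < \<infinity>"
  proof (subst nn_integral_FTC_atLeast[where F=arctan and T="pi / 2"])
    show "(arctan has_real_derivative ?f x) (at x)" for x
      using DERIV_arctan[of x] by (simp add: inverse_eq_divide)
    show "(arctan \<longlongrightarrow> pi / 2) at_top" by (rule tendsto_arctan_at_top)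
  qed auto
  have "(\<integral>\<^sup>+x. ennreal (?f x) \<partial>lborel)
      \<le> (\<integral>\<^sup>+x. ennreal (?f x) * indicator {0..} x + ennreal (?f (- x)) * indicator {0..} (- x) \<partial>lborel)"
    by (intro nn_integral_mono) (auto simp: indicator_def)
  also have "\<dots> = (\<integral>\<^sup>+x. ennreal (?f x) * indicator {0..} x \<partial>lborel)
      + (\<integral>\<^sup>+x. ennreal (?f (- x)) * indicator {0..} (- x) \<partial>lborel)"
    by (rule nn_integral_add) auto
  also have "(\<integral>\<^sup>+x. ennreal (?f (- x)) * indicator {0..} (- x) \<partial>lborel)
      = (\<integral>\<^sup>+x. ennreal (?f x) * indicator {0..} x \<partial>lborel)"
    using nn_integral_lborel_affine[of "\<lambda>x. ennreal (?f x) * indicator {0..} x" "-1" 0] by simp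
  finally have "(\<integral>\<^sup>+x. ennreal (?f x) \<partial>lborel) < \<infinity>"
    using fin by (simp add: ennreal_add_less_top order.strict_trans1)
  then show ?thesis by (simp add: integrable_iff_bounded)
qed

text \<open>A product over coordinates rather than a power of the norm: its reciprocal integrates by
  Fubini, and each factor corresponds on the Fourier side to the identity minus a second partial
  derivative.\<close>

definition decay_weight :: "'a::euclidean_space \<Rightarrow> real" where
  "decay_weight x = (\<Prod>b\<in>Basis. 1 + (x \<bullet> b)\<^sup>2)"

lemma decay_weight_pos: "decay_weight x > 0"
  unfolding decay_weight_def by (intro prod_pos) (auto intro: add_pos_nonneg)

text \<open>Schwartz bounds control powers of the norm, so the product weight has to be compared
  with one of them; the summand 1 covers the unit ball.\<close>

lemma decay_weight_le: "decay_weight (x::'a::euclidean_space) \<le> 2 ^ DIM('a) * (1 + norm x ^ (2 * DIM('a)))"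
proof -
  have "decay_weight x \<le> (\<Prod>b\<in>(Basis::'a set). 1 + (norm x)\<^sup>2)"
    unfolding decay_weight_def using Basis_le_norm[of _ x] 
    by (intro prod_mono) (auto simp: abs_le_square_iff[symmetric])
  also have "\<dots> = (1 + (norm x)\<^sup>2) ^ DIM('a)" by simp
  also have "\<dots> \<le> 2 ^ DIM('a) * (1 + norm x ^ (2 * DIM('a)))"
  proof (cases "norm x \<le> 1")
    case True
    then have "(1 + (norm x)\<^sup>2) ^ DIM('a) \<le> 2 ^ DIM('a)"
      by (intro power_mono) (auto simp: power_le_one)
    also have "\<dots> \<le> 2 ^ DIM('a) * (1 + norm x ^ (2 * DIM('a)))" by simp
    finally show ?thesis .
  next
    case False
    then have "1 \<le> (norm x)\<^sup>2" by (simp add: one_le_power)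
    then have "(1 + (norm x)\<^sup>2) ^ DIM('a) \<le> (2 * (norm x)\<^sup>2) ^ DIM('a)"
      by (intro power_mono) auto
    also have "\<dots> = 2 ^ DIM('a) * norm x ^ (2 * DIM('a))"
      by (simp add: power_mult_distrib power_mult)
    finally show ?thesis by (simp add: algebra_simps add_increasing)
  qed
  finally show ?thesis .
qed

lemma integrable_inverse_decay_weight: "integrable lborel (\<lambda>x::'a::euclidean_space. 1 / decay_weight x)"
proof -
  have "(\<integral>\<^sup>+x. ennreal (1 / decay_weight (x::'a)) \<partial>lborel)
    = (\<integral>\<^sup>+x. (\<Prod>b\<in>Basis. ennreal (1 / (1 + ((x::'a) \<bullet> b)\<^sup>2))) \<partial>lborel)"
    by (simp add: decay_weight_def prod_ennreal prod_dividef)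
  also have "\<dots> = (\<Prod>b\<in>(Basis :: 'a set). (\<integral>\<^sup>+x. ennreal (1 / (1 + x\<^sup>2)) \<partial>lborel))"
    by (rule nn_integral_lborel_prod) auto
  also have "\<dots> < \<infinity>"
    using integrable_inverse_1_plus_square_lborel
    by (simp add: integrable_iff_bounded power_less_top_ennreal)
  finally show ?thesis
    using decay_weight_pos[THEN less_imp_le, of x for x :: 'a]
    by (simp add: integrable_iff_bounded) (simp add: decay_weight_def)
qed

lemma integrable_decay:
  fixes f :: "'a::euclidean_space \<Rightarrow> complex"
  assumes [measurable]: "f \<in> borel_measurable borel" and C: "\<And>x. decay_weight x * norm (f x) \<le> C"
  shows "integrable lborel f"
proof (rule Bochner_Integration.integrable_bound[where f="\<lambda>x. C * (1 / decay_weight x)"])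
  have "norm (f x) \<le> C * (1 / decay_weight x)" for x
    using C[of x] decay_weight_pos[of x] by (simp add: field_simps)
  then show "AE x in lborel. norm (f x) \<le> norm (C * (1 / decay_weight x))"
    by (intro AE_I2) (metis abs_ge_self order_trans real_norm_def)
  show "integrable lborel (\<lambda>x::'a. C * (1 / decay_weight x))"
    by (intro integrable_mult_right integrable_inverse_decay_weight)
qed simp

lemma schwartz_integrable:
  assumes \<phi>: "\<phi> \<in> schwartz"
  shows "integrable lborel (\<phi> :: 'a::euclidean_space \<Rightarrow> complex)"
proof -
  obtain C0 where C0: "\<And>x. norm (\<phi> x) \<le> C0" using schwartz_bounded[OF \<phi>] by blast
  obtain C1 where C1: "\<And>x. norm x ^ (2 * DIM('a)) * norm (\<phi> x) \<le> C1"
    using schwartz_decay[OF \<phi>] by blast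
  have "decay_weight x * norm (\<phi> x) \<le> 2 ^ DIM('a) * (C0 + C1)" for x
  proof -
    have "decay_weight x * norm (\<phi> x) \<le> 2 ^ DIM('a) * (1 + norm x ^ (2 * DIM('a))) * norm (\<phi> x)"
      by (intro mult_right_mono decay_weight_le) auto
    also have "\<dots> = 2 ^ DIM('a) * (norm (\<phi> x) + norm x ^ (2 * DIM('a)) * norm (\<phi> x))"
      by (simp add: algebra_simps)
    also have "\<dots> \<le> 2 ^ DIM('a) * (C0 + C1)"
      by (intro mult_left_mono add_mono C0 C1) auto
    finally show ?thesis .
  qed
  then show ?thesis
    using integrable_decay[OF schwartz_measurable[OF \<phi>]] by blast
qed

text \<open>Integrating the difference \<open>\<psi> (x + b) - \<psi> x\<close>, written as an integral of the derivative along the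
  segment, gives the vanishing of the integral of a derivative from translation invariance alone.\<close>

lemma integral_directional_derivative_eq_0:
  fixes \<psi> \<psi>' :: "'a::euclidean_space \<Rightarrow> complex"
  assumes deriv: "\<And>x t. ((\<lambda>t. \<psi> (x + t *\<^sub>R b)) has_vector_derivative \<psi>' (x + t *\<^sub>R b)) (at t)"
    and cont: "continuous_on UNIV \<psi>'" and i: "integrable lborel \<psi>" "integrable lborel \<psi>'"
  shows "(LBINT x. \<psi>' x) = 0"
proof -
  have [measurable]: "\<psi>' \<in> borel_measurable borel"
    using cont by (rule borel_measurable_continuous_onI)
  let ?I = "indicator {0..1::real} :: real \<Rightarrow> real"
  have ftc: "(LBINT t. ?I t *\<^sub>R \<psi>' (x + t *\<^sub>R b)) = \<psi> (x + b) - \<psi> x" for x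
  proof -
    have "(LBINT t. ?I t *\<^sub>R \<psi>' (x + t *\<^sub>R b)) = \<psi> (x + 1 *\<^sub>R b) - \<psi> (x + 0 *\<^sub>R b)"
    proof (rule integral_FTC_Icc)
      show "continuous_on {0..1} (\<lambda>t. \<psi>' (x + t *\<^sub>R b))"
        by (rule continuous_on_compose2[OF cont]) (auto intro!: continuous_intros)
    qed (auto intro: has_vector_derivative_at_within deriv)
    then show ?thesis by simp
  qed
  have shift: "integrable lborel (\<lambda>x. \<psi>' (x + t *\<^sub>R b))" for t
    using i by (simp add: integrable_lborel_shift)
  have F: "integrable (lborel \<Otimes>\<^sub>M lborel) (\<lambda>(t, x). ?I t *\<^sub>R \<psi>' (x + t *\<^sub>R b))"
  proof (rule lborel_pair.Fubini_integrable)
    have "(LBINT x. norm (\<psi>' (x + t *\<^sub>R b))) = (LBINT x. norm (\<psi>' x))" for t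
      by (rule integral_lborel_shift[of "\<lambda>x. norm (\<psi>' x)"])
    then show "integrable lborel (\<lambda>t. LBINT x. norm (case (t, x) of (t, x) \<Rightarrow> ?I t *\<^sub>R \<psi>' (x + t *\<^sub>R b)))"
      by simp
  qed (use shift in auto)
  have "0 = (LBINT x. \<psi> (x + b) - \<psi> x)"
    using i by (subst Bochner_Integration.integral_diff) (auto simp: integrable_lborel_shift integral_lborel_shift)
  also have "\<dots> = (LBINT x. (LBINT t. ?I t *\<^sub>R \<psi>' (x + t *\<^sub>R b)))"
    by (simp add: ftc)
  also have "\<dots> = (LBINT t. (LBINT x. ?I t *\<^sub>R \<psi>' (x + t *\<^sub>R b)))"
    by (rule lborel_pair.Fubini_integral[OF F])
  also have "\<dots> = (LBINT t. ?I t *\<^sub>R (LBINT x. \<psi>' x))"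
    by (simp add: integral_lborel_shift)
  also have "\<dots> = (LBINT x. \<psi>' x)"
    by simp
  finally show ?thesis by simp
qed

section \<open>Transforms of derivatives and inversion on Schwartz functions\<close>

lemma has_vector_derivative_cis:
  "((\<lambda>t. cis (c + t * d)) has_vector_derivative (\<i> * of_real d * cis (c + t * d))) (at t)"
proof -
  have eq: "cis (c + t * d) = cis c * exp (t *\<^sub>R (\<i> * of_real d))" for t
    by (simp add: cis_conv_exp scaleR_conv_of_real ring_distribs mult_ac flip: exp_add)
  have "((\<lambda>t. cis c * exp (t *\<^sub>R (\<i> * of_real d))) has_vector_derivative
      cis c * (exp (t *\<^sub>R (\<i> * of_real d)) * (\<i> * of_real d))) (at t)"
    by (intro has_vector_derivative_mult_right exp_scaleR_has_vector_derivative_right)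
  then show ?thesis
    unfolding eq by (simp only: mult_ac)
qed

text \<open>Integration by parts: the function \<open>?\<psi>'\<close> is the derivative along
  \<open>b\<close> of \<phi> times the character, and such a derivative has integral 0.\<close>

lemma ift_dir_deriv:
  fixes \<phi> :: "'a::euclidean_space \<Rightarrow> complex"
  assumes \<phi>: "\<phi> \<in> schwartz" and b: "b \<in> Basis"
  shows "ift (dir_deriv b \<phi>) x = - (\<i> * of_real (x \<bullet> b)) * ift \<phi> x"
proof -
  let ?\<psi>' = "\<lambda>\<xi>. dir_deriv b \<phi> \<xi> * cis (x \<bullet> \<xi>) + \<i> * of_real (x \<bullet> b) * (\<phi> \<xi> * cis (x \<bullet> \<xi>))"
  note \<phi>' = schwartz_dir_deriv[OF \<phi> b]
  have i: "integrable lborel (\<lambda>\<xi>. \<phi> \<xi> * cis (x \<bullet> \<xi>))" "integrable lborel (\<lambda>\<xi>. dir_deriv b \<phi> \<xi> * cis (x \<bullet> \<xi>))"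
    by (intro integrable_cis schwartz_integrable \<phi> \<phi>')+
  have "(LBINT \<xi>. ?\<psi>' \<xi>) = 0"
  proof (rule integral_directional_derivative_eq_0)
    fix \<xi> t
    have "((\<lambda>t. \<phi> (\<xi> + t *\<^sub>R b) * cis (x \<bullet> \<xi> + t * (x \<bullet> b))) has_vector_derivative
        \<phi> (\<xi> + t *\<^sub>R b) * (\<i> * of_real (x \<bullet> b) * cis (x \<bullet> \<xi> + t * (x \<bullet> b)))
        + dir_deriv b \<phi> (\<xi> + t *\<^sub>R b) * cis (x \<bullet> \<xi> + t * (x \<bullet> b))) (at t)"
      by (intro has_vector_derivative_mult has_vector_derivative_cis has_vector_derivative_dir_deriv
          schwartz_differentiable \<phi>)
    then show "((\<lambda>t. \<phi> (\<xi> + t *\<^sub>R b) * cis (x \<bullet> (\<xi> + t *\<^sub>R b))) has_vector_derivative ?\<psi>' (\<xi> + t *\<^sub>R b)) (at t)"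
      by (simp add: inner_add_right algebra_simps)
  next
    show "continuous_on UNIV ?\<psi>'"
      by (intro continuous_intros schwartz_continuous \<phi> \<phi>')
  qed (use i in auto)
  then show ?thesis
    using i by (simp add: ift_def add_eq_0_iff2)
qed

lemma ift_dir_deriv2:
  fixes \<phi> :: "'a::euclidean_space \<Rightarrow> complex"
  assumes \<phi>: "\<phi> \<in> schwartz" and b: "b \<in> Basis"
  shows "ift (dir_deriv b (dir_deriv b \<phi>)) x = - of_real ((x \<bullet> b)\<^sup>2) * ift \<phi> x"
proof -
  have "ift (dir_deriv b (dir_deriv b \<phi>)) x
      = ((\<i> * of_real (x \<bullet> b)) * (\<i> * of_real (x \<bullet> b))) * ift \<phi> x"
    by (simp add: ift_dir_deriv \<phi> b schwartz_dir_deriv del: complex_i_mult_minus)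
  also have "(\<i> * of_real (x \<bullet> b)) * (\<i> * of_real (x \<bullet> b)) = - of_real ((x \<bullet> b)\<^sup>2)"
    by (simp add: complex_eq_iff power2_eq_square)
  finally show ?thesis .
qed

lemma schwartz_laplacian_integrable:
  assumes \<phi>: "\<phi> \<in> schwartz"
  shows "integrable lborel (laplacian \<phi>)"
  unfolding laplacian_def
  by (intro Bochner_Integration.integrable_sum schwartz_integrable schwartz_dir_deriv \<phi>)

lemma ift_laplacian:
  fixes \<phi> :: "'a::euclidean_space \<Rightarrow> complex"
  assumes \<phi>: "\<phi> \<in> schwartz"
  shows "ift (laplacian \<phi>) x = - of_real ((norm x)\<^sup>2) * ift \<phi> x"
proof -
  have "ift (laplacian \<phi>) x = (LBINT \<xi>. (\<Sum>b\<in>Basis. dir_deriv b (dir_deriv b \<phi>) \<xi> * cis (x \<bullet> \<xi>)))"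
    by (simp add: ift_def laplacian_def sum_distrib_right)
  also have "\<dots> = (\<Sum>b\<in>Basis. ift (dir_deriv b (dir_deriv b \<phi>)) x)"
    unfolding ift_def
    by (intro Bochner_Integration.integral_sum integrable_cis schwartz_integrable schwartz_dir_deriv \<phi>)
  also have "\<dots> = (\<Sum>b\<in>Basis. - of_real ((x \<bullet> b)\<^sup>2) * ift \<phi> x)"
    by (simp add: ift_dir_deriv2 \<phi>)
  finally show ?thesis
    by (simp add: norm_square_eq_sum sum_distrib_right sum_negf)
qed

text \<open>The product weight is built up one coordinate at a time. A new factor splits the bound
  into one for \<open>ift \<phi>\<close> and one for the transform of a second derivative of \<phi>,
  so the induction hypothesis is needed for both functions and \<phi> is generalized.\<close>

lemma schwartz_integrable_ift:
  assumes \<phi>: "\<phi> \<in> schwartz"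
  shows "integrable lborel (ift \<phi> :: 'a::euclidean_space \<Rightarrow> complex)"
proof -
  have "\<exists>C. \<forall>x. (\<Prod>b\<in>S. 1 + (x \<bullet> b)\<^sup>2) * norm (ift \<phi> x) \<le> C" if "finite S" "S \<subseteq> Basis" for S
    using that \<phi>
  proof (induction arbitrary: \<phi> rule: finite_induct)
    case empty
    then show ?case using norm_ift_le by auto
  next
    case (insert b S)
    let ?\<phi>2 = "dir_deriv b (dir_deriv b \<phi>)"
    have \<phi>2: "?\<phi>2 \<in> schwartz" using insert.prems by (auto intro!: schwartz_dir_deriv)
    obtain C1 where C1: "\<And>x. (\<Prod>b\<in>S. 1 + (x \<bullet> b)\<^sup>2) * norm (ift \<phi> x) \<le> C1"
      using insert by blast
    obtain C2 where C2: "\<And>x. (\<Prod>b\<in>S. 1 + (x \<bullet> b)\<^sup>2) * norm (ift ?\<phi>2 x) \<le> C2"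
      using insert.IH[OF _ \<phi>2] insert.prems by blast
    have "norm (ift ?\<phi>2 x) = (x \<bullet> b)\<^sup>2 * norm (ift \<phi> x)" for x
      using insert.prems by (simp add: ift_dir_deriv2 norm_mult norm_power)
    then have "(\<Prod>b\<in>insert b S. 1 + (x \<bullet> b)\<^sup>2) * norm (ift \<phi> x) \<le> C1 + C2" for x
      using C1[of x] C2[of x] insert.hyps by (simp add: algebra_simps)
    then show ?case by blast
  qed
  from this[OF finite_Basis order_refl]
  obtain C where C: "\<And>x. decay_weight x * norm (ift \<phi> x) \<le> C" unfolding decay_weight_def by blast
  have "ift \<phi> \<in> borel_measurable borel"
    using schwartz_measurable[OF \<phi>] by measurable
  then show ?thesis using C by (rule integrable_decay)
qed

lemma schwartz_integrable_fourier:
  assumes \<phi>: "\<phi> \<in> schwartz"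
  shows "integrable lborel (fourier \<phi> :: 'a::euclidean_space \<Rightarrow> complex)"
  using integrable_lborel_affine[OF schwartz_integrable_ift[OF \<phi>], of "-1" 0]
  by (simp add: fourier_eq_ift[abs_def])

lemma ift_fourier:
  assumes \<phi>: "\<phi> \<in> schwartz"
  shows "ift (fourier \<phi>) (a :: 'a::euclidean_space) = \<phi> a"
proof -
  obtain B where B: "\<And>x. norm (\<phi> x) \<le> B" using schwartz_bounded[OF \<phi>] by blast
  define c where "c = complex_of_real ((2 * pi) ^ DIM('a))"
  have c: "c \<noteq> 0" by (simp add: c_def)
  have "ift (fourier \<phi>) a = inverse c * (LBINT x. ift \<phi> (- x) * cis (a \<bullet> x))"
    by (simp add: ift_def[of "fourier \<phi>"] fourier_eq_ift mult.assoc inverse_eq_divide c_def)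
  also have "(LBINT x. ift \<phi> (- x) * cis (a \<bullet> x)) = (LBINT x. ift \<phi> x * cis (- (x \<bullet> a)))"
    using integral_lborel_reflect[of "\<lambda>x. ift \<phi> x * cis (- (x \<bullet> a))" 0] by (simp add: inner_commute)
  also have "\<dots> = c * \<phi> a"
    unfolding c_def by (rule ift_inversion[OF schwartz_integrable[OF \<phi>] schwartz_continuous[OF \<phi>] B schwartz_integrable_ift[OF \<phi>]])
  finally show ?thesis using c by simp
qed

section \<open>Modulated Gaussians as Schwartz functions\<close>

inductive complex_polynomial :: "('a::euclidean_space \<Rightarrow> complex) \<Rightarrow> bool" where
  const: "complex_polynomial (\<lambda>x. c)"
| coord: "complex_polynomial (\<lambda>x. of_real (x \<bullet> b))"
| add: "complex_polynomial p \<Longrightarrow> complex_polynomial q \<Longrightarrow> complex_polynomial (\<lambda>x. p x + q x)"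
| mult: "complex_polynomial p \<Longrightarrow> complex_polynomial q \<Longrightarrow> complex_polynomial (\<lambda>x. p x * q x)"

lemma complex_polynomial_derivative:
  assumes "complex_polynomial p"
  shows "\<exists>p'. complex_polynomial p' \<and> (\<forall>x. \<exists>D. (p has_derivative D) (at x) \<and> D b = p' x)"
  using assms
proof induction
  case (const c)
  show ?case by (rule exI[of _ "\<lambda>_. 0"]) (auto intro!: complex_polynomial.const exI[of _ "\<lambda>_. 0"])
next
  case (coord c)
  show ?case
    by (rule exI[of _ "\<lambda>_. of_real (b \<bullet> c)"])
      (auto intro!: complex_polynomial.const exI[of _ "\<lambda>h. of_real (h \<bullet> c)"] derivative_eq_intros)
next
  case (add p q)
  then obtain p' q' where *: "complex_polynomial p'" "\<And>x. \<exists>D. (p has_derivative D) (at x) \<and> D b = p' x"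
    "complex_polynomial q'" "\<And>x. \<exists>D. (q has_derivative D) (at x) \<and> D b = q' x" by blast
  show ?case
  proof (rule exI[of _ "\<lambda>x. p' x + q' x"], intro conjI allI)
    fix x
    obtain D E where "(p has_derivative D) (at x)" "D b = p' x" "(q has_derivative E) (at x)" "E b = q' x"
      using * by blast
    then show "\<exists>D. ((\<lambda>x. p x + q x) has_derivative D) (at x) \<and> D b = p' x + q' x"
      by (intro exI[of _ "\<lambda>h. D h + E h"]) (auto intro!: derivative_intros)
  qed (use * in \<open>auto intro: complex_polynomial.intros\<close>)
next
  case (mult p q)
  then obtain p' q' where *: "complex_polynomial p'" "\<And>x. \<exists>D. (p has_derivative D) (at x) \<and> D b = p' x"
    "complex_polynomial q'" "\<And>x. \<exists>D. (q has_derivative D) (at x) \<and> D b = q' x" by blast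
  show ?case
  proof (rule exI[of _ "\<lambda>x. p x * q' x + p' x * q x"], intro conjI allI)
    fix x
    obtain D E where "(p has_derivative D) (at x)" "D b = p' x" "(q has_derivative E) (at x)" "E b = q' x"
      using * by blast
    then show "\<exists>D. ((\<lambda>x. p x * q x) has_derivative D) (at x) \<and> D b = p x * q' x + p' x * q x"
      by (intro exI[of _ "\<lambda>h. p x * E h + D h * q x"]) (auto intro!: derivative_intros)
  qed (use * mult in \<open>auto intro: complex_polynomial.intros\<close>)
qed

lemma complex_polynomial_growth:
  assumes "complex_polynomial p"
  shows "\<exists>C m. C \<ge> 0 \<and> (\<forall>x. norm (p x) \<le> C * (1 + norm x) ^ m)"
  using assms
proof induction
  case (const c)
  show ?case by (intro exI[of _ "norm c"] exI[of _ 0]) auto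
next
  case (coord b)
  have "\<bar>x \<bullet> b\<bar> \<le> norm b * (1 + norm x) ^ 1" for x
    using Cauchy_Schwarz_ineq2[of x b] by (simp add: algebra_simps add_increasing)
  then show ?case by (intro exI[of _ "norm b"] exI[of _ 1]) auto
next
  case (add p q)
  then obtain C m D n where *: "C \<ge> 0" "\<And>x. norm (p x) \<le> C * (1 + norm x) ^ m"
      "D \<ge> 0" "\<And>x. norm (q x) \<le> D * (1 + norm x) ^ n" by blast
  have "norm (p x + q x) \<le> (C + D) * (1 + norm x) ^ (m + n)" for x
  proof -
    have "norm (p x + q x) \<le> C * (1 + norm x) ^ m + D * (1 + norm x) ^ n"
      using *(2,4)[of x] norm_triangle_ineq[of "p x" "q x"] by linarith
    also have "\<dots> \<le> C * (1 + norm x) ^ (m + n) + D * (1 + norm x) ^ (m + n)"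
      by (intro add_mono mult_left_mono power_increasing *) auto
    finally show ?thesis by (simp add: algebra_simps)
  qed
  then show ?case using * by (intro exI[of _ "C + D"] exI[of _ "m + n"]) auto
next
  case (mult p q)
  then obtain C m D n where *: "C \<ge> 0" "\<And>x. norm (p x) \<le> C * (1 + norm x) ^ m"
      "D \<ge> 0" "\<And>x. norm (q x) \<le> D * (1 + norm x) ^ n" by blast
  have "norm (p x * q x) \<le> (C * D) * (1 + norm x) ^ (m + n)" for x
  proof -
    have "norm (p x * q x) \<le> (C * (1 + norm x) ^ m) * (D * (1 + norm x) ^ n)"
      unfolding norm_mult by (intro mult_mono *) (use * in auto)
    then show ?thesis by (simp add: power_add mult_ac)
  qed
  then show ?case using * by (intro exI[of _ "C * D"] exI[of _ "m + n"]) auto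
qed

text \<open>The elementary bound \<open>1 + norm x \<le> K * exp (c * (norm x)\<^sup>2)\<close> is
  raised to the power \<open>N\<close>.\<close>

lemma polynomial_damp_bounded:
  assumes t: "t > 0"
  shows "\<exists>C. \<forall>x::'a::euclidean_space. (1 + norm x) ^ N * damp t x \<le> C"
proof (cases "N = 0")
  case True
  then show ?thesis by (intro exI[of _ 1]) auto
next
  case False
  \<comment> \<open>Chosen so that the \<open>N\<close>-th power of
    \<open>exp (c * (norm x)\<^sup>2)\<close> cancels \<open>damp t x\<close> exactly; the division
    by \<open>N\<close> is why the exponent 0 is treated separately.\<close>
  define c where "c = t\<^sup>2 / (2 * real N)"
  have c: "c > 0" "real N * c = t\<^sup>2 / 2" using t False by (auto simp: c_def)
  \<comment> \<open>The two lower bounds \<open>K \<ge> 2\<close> and \<open>K * c \<ge> 1\<close>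
    turn \<open>2 + (norm x)\<^sup>2\<close> into at most
    \<open>K * (1 + c * (norm x)\<^sup>2)\<close>.\<close>
  define K where "K = max 2 (1 / c)"
  have "1 / c \<le> K" by (simp add: K_def)
  then have "K * c \<ge> 1" using c(1) by (simp add: pos_divide_le_eq)
  moreover have "K \<ge> 2" by (simp add: K_def)
  ultimately have K: "K \<ge> 2" "K * c \<ge> 1" by auto
  have "(1 + norm x) ^ N * damp t x \<le> K ^ N" for x :: 'a
  proof -
    have "0 \<le> (norm x - 1)\<^sup>2" by simp
    then have "2 * norm x \<le> 1 + (norm x)\<^sup>2" by (simp add: power2_diff)
    then have "1 + norm x \<le> 2 + (norm x)\<^sup>2" using norm_ge_zero[of x] by linarith
    also have "\<dots> \<le> K + (K * c) * (norm x)\<^sup>2"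
      using K mult_right_mono[OF K(2), of "(norm x)\<^sup>2"] by simp
    also have "\<dots> = K * (1 + c * (norm x)\<^sup>2)" by (simp add: algebra_simps)
    also have "\<dots> \<le> K * exp (c * (norm x)\<^sup>2)"
      using K by (intro mult_left_mono exp_ge_add_one_self) auto
    finally have "(1 + norm x) ^ N \<le> (K * exp (c * (norm x)\<^sup>2)) ^ N"
      by (intro power_mono) auto
    also have "\<dots> = K ^ N * exp ((real N * c) * (norm x)\<^sup>2)"
      by (simp only: power_mult_distrib exp_of_nat_mult mult.assoc)
    finally have "(1 + norm x) ^ N * damp t x \<le> K ^ N * exp ((real N * c) * (norm x)\<^sup>2) * damp t x"
      by (rule mult_right_mono) simp
    moreover have "exp ((real N * c) * (norm x)\<^sup>2) * damp t x = 1"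
      unfolding damp_def c(2) by (simp flip: exp_add)
    then have "K ^ N * exp ((real N * c) * (norm x)\<^sup>2) * damp t x = K ^ N"
      by (simp only: mult.assoc mult_1_right)
    ultimately show ?thesis by simp
  qed
  then show ?thesis by blast
qed

text \<open>Integrating a function against this wave gives the inverse transform, at
  \<open>a\<close>, of the damped function. The Fourier transform of the wave is a Gaussian of width
  \<open>t\<close> centred at \<open>a\<close>, so on the other side the same pairing averages a
  function near \<open>a\<close>.\<close>

definition gaussian_wave :: "real \<Rightarrow> 'a::euclidean_space \<Rightarrow> 'a \<Rightarrow> complex" where
  "gaussian_wave t a x = of_real (damp t x) * cis (x \<bullet> a)"

lemma gaussian_wave_derivative:
  "\<exists>D. (gaussian_wave t a has_derivative D) (at x) \<and>
     D b = (- of_real (t\<^sup>2) * of_real (x \<bullet> b) + \<i> * of_real (b \<bullet> a)) * gaussian_wave t a x"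
proof -
  \<comment> \<open>Rewritten as one exponential of a complex quadratic, so that a single use of the
    chain rule suffices.\<close>
  have *: "gaussian_wave t a = (\<lambda>x. exp (of_real (- t\<^sup>2 / 2 * (x \<bullet> x)) + \<i> * of_real (x \<bullet> a)))"
  proof
    fix x :: 'a
    have "complex_of_real (damp t x) = exp (of_real (- t\<^sup>2 / 2 * (x \<bullet> x)))"
      by (simp only: damp_def power2_norm_eq_inner exp_of_real) simp
    then show "gaussian_wave t a x = exp (of_real (- t\<^sup>2 / 2 * (x \<bullet> x)) + \<i> * of_real (x \<bullet> a))"
      by (simp only: gaussian_wave_def cis_conv_exp exp_add)
  qed
  let ?g = "\<lambda>x. complex_of_real (- t\<^sup>2 / 2 * (x \<bullet> x)) + \<i> * of_real (x \<bullet> a)"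
  have "((\<lambda>x. - t\<^sup>2 / 2 * (x \<bullet> x)) has_derivative (\<lambda>h. - t\<^sup>2 * (x \<bullet> h))) (at x)"
    by (rule derivative_eq_intros refl)+ (simp add: inner_commute field_simps)
  then have "(?g has_derivative (\<lambda>h. of_real (- t\<^sup>2 * (x \<bullet> h)) + \<i> * of_real (h \<bullet> a))) (at x)"
    by (intro has_derivative_add has_derivative_of_real has_derivative_mult_right has_derivative_inner_left has_derivative_ident)
  from has_derivative_compose[OF this DERIV_exp[unfolded has_field_derivative_def]]
  have "((\<lambda>x. exp (?g x)) has_derivative (\<lambda>h. exp (?g x) * (of_real (- t\<^sup>2 * (x \<bullet> h)) + \<i> * of_real (h \<bullet> a)))) (at x)" .
  then show ?thesis
    unfolding * by (intro exI conjI) (assumption, simp add: inner_commute mult_ac)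
qed

text \<open>Every iterated derivative is a polynomial times the wave. The class
  \<open>complex_polynomial\<close> is inductive so that closure under differentiation and
  polynomial growth are both rule inductions; the Gaussian then absorbs any power of the
  norm.\<close>

lemma gaussian_wave_schwartz:
  assumes t: "t > 0"
  shows "gaussian_wave t a \<in> schwartz"
proof -
  have iter: "\<exists>p. complex_polynomial p \<and> iter_deriv bs (gaussian_wave t a) = (\<lambda>x. p x * gaussian_wave t a x)" for bs
  proof (induction bs)
    case Nil
    show ?case
      by (intro exI[of _ "\<lambda>_. 1"]) (auto simp: iter_deriv_def intro: complex_polynomial.const)
  next
    case (Cons b bs)
    then obtain p where p: "complex_polynomial p" "iter_deriv bs (gaussian_wave t a) = (\<lambda>x. p x * gaussian_wave t a x)"
      by blast
    obtain p' where p': "complex_polynomial p'" "\<And>x. \<exists>D. (p has_derivative D) (at x) \<and> D b = p' x"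
      using complex_polynomial_derivative[OF p(1)] by blast
    let ?q = "\<lambda>x. p x * ((- of_real (t\<^sup>2)) * of_real (x \<bullet> b) + \<i> * of_real (b \<bullet> a)) + p' x"
    have "dir_deriv b (\<lambda>x. p x * gaussian_wave t a x) x = ?q x * gaussian_wave t a x" for x
    proof -
      obtain D where D: "(p has_derivative D) (at x)" "D b = p' x" using p' by blast
      obtain E where E: "(gaussian_wave t a has_derivative E) (at x)"
        "E b = (- of_real (t\<^sup>2) * of_real (x \<bullet> b) + \<i> * of_real (b \<bullet> a)) * gaussian_wave t a x"
        using gaussian_wave_derivative by blast
      show ?thesis
        using dir_deriv_eq(1)[OF has_derivative_mult[OF D(1) E(1)], of b] D(2) E(2)
        by (simp add: algebra_simps)
    qed
    moreover have "complex_polynomial ?q"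
      by (intro complex_polynomial.intros p p')
    moreover have "iter_deriv (b # bs) (gaussian_wave t a) = dir_deriv b (\<lambda>x. p x * gaussian_wave t a x)"
      using p(2) by (simp add: iter_deriv_def)
    ultimately show ?case by (intro exI[of _ ?q]) auto
  qed
  show ?thesis
    unfolding schwartz_def
  proof (intro CollectI ballI conjI allI)
    fix bs x k
    obtain p where p: "complex_polynomial p" "iter_deriv bs (gaussian_wave t a) = (\<lambda>x. p x * gaussian_wave t a x)"
      using iter by blast
    obtain D E where "(p has_derivative D) (at x)" "(gaussian_wave t a has_derivative E) (at x)"
      using complex_polynomial_derivative[OF p(1)] gaussian_wave_derivative by blast
    then show "iter_deriv bs (gaussian_wave t a) differentiable at x"
      unfolding p(2) by (intro differentiable_mult) (auto simp: differentiable_def)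
    obtain C m where C: "C \<ge> 0" "\<And>x. norm (p x) \<le> C * (1 + norm x) ^ m"
      using complex_polynomial_growth[OF p(1)] by blast
    obtain B where B: "\<And>x::'a. (1 + norm x) ^ (k + m) * damp t x \<le> B"
      using polynomial_damp_bounded[OF t] by blast
    have "norm x ^ k * norm (iter_deriv bs (gaussian_wave t a) x) \<le> C * B" for x
    proof -
      have "norm x ^ k * norm (iter_deriv bs (gaussian_wave t a) x) = norm x ^ k * (norm (p x) * damp t x)"
        by (simp add: p(2) gaussian_wave_def norm_mult)
      also have "\<dots> \<le> (1 + norm x) ^ k * ((C * (1 + norm x) ^ m) * damp t x)"
        by (intro mult_mono power_mono C) (auto intro!: mult_nonneg_nonneg C)
      also have "\<dots> = C * ((1 + norm x) ^ (k + m) * damp t x)"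
        by (simp add: power_add mult_ac)
      also have "\<dots> \<le> C * B"
        by (intro mult_left_mono B C)
      finally show ?thesis .
    qed
    then show "\<exists>C. \<forall>x. norm x ^ k * norm (iter_deriv bs (gaussian_wave t a) x) \<le> C" by blast
  qed
qed

section \<open>Spectral Barron spaces and the weak equation\<close>

text \<open>The character is symmetric in its two arguments, so Fubini moves the transform from one
  factor to the other.\<close>

lemma ift_exchange:
  fixes F G :: "'a::euclidean_space \<Rightarrow> complex"
  assumes F: "integrable lborel F" and G: "integrable lborel G"
  shows "(LBINT x. ift F x * G x) = (LBINT x. F x * ift G x)"
proof -
  have "(LBINT x. F x * ift G x) = (LBINT x. F x * (LBINT y. G y * cis (x \<bullet> y)))"
    by (simp add: ift_def)
  also have "\<dots> = (LBINT y. G y * (LBINT x. F x * cis (x \<bullet> y)))"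
    by (rule fubini_bounded[OF F G, where B=1]) (auto simp: case_prod_beta)
  also have "\<dots> = (LBINT x. ift F x * G x)"
    by (simp add: ift_def inner_commute mult.commute)
  finally show ?thesis by simp
qed

lemma integrable_mult_schwartz:
  assumes "integrable lborel G" "\<phi> \<in> schwartz"
  shows "integrable lborel (\<lambda>x. G x * \<phi> x)"
  using schwartz_bounded[OF assms(2)] integrable_bounded_mult(1)[OF assms(1) schwartz_measurable[OF assms(2)]]
  by metis

text \<open>Moving the transform from \<open>G\<close> to the test function, and inverting there,
  turns the pointwise identity into the distributional one.\<close>

lemma has_fourier_functionI:
  fixes g :: "'a::euclidean_space \<Rightarrow> real"
  assumes G: "integrable lborel G" and g: "\<And>x. of_real (g x) = ift G x"
  shows "has_fourier_function g G"
  unfolding has_fourier_function_def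
proof (intro conjI ballI)
  show "G \<in> borel_measurable borel"
    using borel_measurable_integrable[OF G] by simp
  fix \<phi> :: "'a \<Rightarrow> complex" assume \<phi>: "\<phi> \<in> schwartz"
  show "integrable lborel (\<lambda>\<xi>. G \<xi> * \<phi> \<xi>)"
    using G \<phi> by (rule integrable_mult_schwartz)
  show "fourier_distribution (real_distribution g) \<phi> = fun_distribution G \<phi>"
    using ift_exchange[OF G schwartz_integrable_fourier[OF \<phi>]] ift_fourier[OF \<phi>]
    by (simp add: fourier_distribution_def fun_distribution_def g)
qed

text \<open>This makes the Barron norm independent of the choice operator in
  \<open>fourier_function\<close>.\<close>

lemma has_fourier_function_unique:
  fixes g :: "'a::euclidean_space \<Rightarrow> real"
  assumes G: "has_fourier_function g G" and G': "has_fourier_function g G'"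
  shows "AE \<xi> in lborel. G \<xi> = G' \<xi>"
proof -
  \<comment> \<open>The two candidates are only known to be integrable against Schwartz functions. A
    Gaussian factor makes their difference an L1 function, whose inverse transform at
    \<open>x\<close> is the difference of the tests against
    \<open>gaussian_wave 1 x\<close>.\<close>
  let ?H = "\<lambda>\<xi>. (G \<xi> - G' \<xi>) * gaussian_wave 1 0 \<xi>"
  have i: "integrable lborel (\<lambda>\<xi>. G \<xi> * gaussian_wave 1 x \<xi>)" "integrable lborel (\<lambda>\<xi>. G' \<xi> * gaussian_wave 1 x \<xi>)"
    and eq: "(LBINT \<xi>. G \<xi> * gaussian_wave 1 x \<xi>) = (LBINT \<xi>. G' \<xi> * gaussian_wave 1 x \<xi>)" for x
    using G G' gaussian_wave_schwartz[of 1 x] unfolding has_fourier_function_def fun_distribution_def by auto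
  have H: "integrable lborel ?H"
    using Bochner_Integration.integrable_diff[OF i(1)[of 0] i(2)[of 0]] by (simp add: algebra_simps)
  have "ift ?H x = 0" for x
  proof -
    have "ift ?H x = (LBINT \<xi>. G \<xi> * gaussian_wave 1 x \<xi> - G' \<xi> * gaussian_wave 1 x \<xi>)"
      unfolding ift_def by (simp add: gaussian_wave_def algebra_simps inner_commute)
    then show ?thesis
      using i[of x] eq[of x] by simp
  qed
  from ift_injective[OF H this] show ?thesis
    by eventually_elim (use damp_bounds(1) in \<open>auto simp: gaussian_wave_def less_irrefl\<close>)
qed

lemma fourier_gaussian_wave:
  assumes t: "t > 0"
  shows "fourier (gaussian_wave t a) x = of_real ((1 / t) ^ DIM('a) * std_gaussian ((1 / t) *\<^sub>R (a - x :: 'a::euclidean_space)))"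
proof -
  have "ift (gaussian_wave t a) (- x) = ift (\<lambda>x. of_real (damp t x)) (a - x)"
    unfolding ift_def gaussian_wave_def
  proof (rule Bochner_Integration.integral_cong[OF refl])
    fix \<xi> :: 'a
    have "cis (\<xi> \<bullet> a) * cis (- x \<bullet> \<xi>) = cis ((a - x) \<bullet> \<xi>)"
      by (simp add: cis_mult inner_diff_left inner_commute[of \<xi> a])
    then show "of_real (damp t \<xi>) * cis (\<xi> \<bullet> a) * cis (- x \<bullet> \<xi>) = of_real (damp t \<xi>) * cis ((a - x) \<bullet> \<xi>)"
      by (simp only: mult.assoc)
  qed
  moreover have "1 / (2 * pi) ^ DIM('a) * ((2 * pi / t) ^ DIM('a) * r) = (1 / t) ^ DIM('a) * r" for r :: real
    by (simp add: power_divide)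
  ultimately show ?thesis
    by (simp only: fourier_eq_ift ift_damp[OF t] of_real_mult[symmetric])
qed

lemma std_gaussian_minus: "std_gaussian (- x) = std_gaussian x"
  by (simp add: std_gaussian_def)

text \<open>The difference \<open>h\<close> of the two sides is bounded and continuous but need not
  be integrable, so \<open>ift_injective\<close> does not apply to it. Testing against transforms of
  Gaussian waves shows that all its Gaussian averages around \<open>a\<close> vanish; letting the
  width tend to 0 gives the identity at every point, not just almost everywhere.\<close>

lemma fourier_representation:
  fixes g :: "'a::euclidean_space \<Rightarrow> real"
  assumes gG: "has_fourier_function g G" and G: "integrable lborel G"
    and g: "continuous_on UNIV g" "bounded (range g)"
  shows "of_real (g a) = ift G a"
proof -
  define h where "h x = of_real (g x) - ift G x" for x
  obtain B where B: "\<And>x. \<bar>g x\<bar> \<le> B"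
    using g(2) by (auto simp: bounded_iff)
  have h: "continuous_on UNIV h" "\<And>x. norm (h x) \<le> B + (LBINT \<xi>. norm (G \<xi>))"
  proof -
    show "continuous_on UNIV h"
      unfolding h_def by (intro continuous_intros g continuous_ift G)
    show "norm (h x) \<le> B + (LBINT \<xi>. norm (G \<xi>))" for x
      unfolding h_def using norm_triangle_ineq4[of "of_real (g x)" "ift G x"] B[of x] norm_ift_le[of G x] by simp
  qed
  have [measurable]: "g \<in> borel_measurable borel" "ift G \<in> borel_measurable borel"
    using g continuous_ift[OF G] by (auto intro: borel_measurable_continuous_onI)
  have zero: "(LBINT z. of_real (std_gaussian z) * h (a + t *\<^sub>R z)) = 0" if t: "t > 0" for t
  proof -
    note S = gaussian_wave_schwartz[OF t, of a]
    let ?F = "fourier (gaussian_wave t a)"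
    note iF = schwartz_integrable_fourier[OF S]
    have "(LBINT x. of_real (g x) * ?F x) = (LBINT \<xi>. G \<xi> * gaussian_wave t a \<xi>)"
      using gG S unfolding has_fourier_function_def fourier_distribution_def fun_distribution_def by auto
    also have "\<dots> = (LBINT x. ift G x * ?F x)"
      using ift_exchange[OF G iF] ift_fourier[OF S] by simp
    finally have "0 = (LBINT x. of_real (g x) * ?F x) - (LBINT x. ift G x * ?F x)"
      by simp
    also have "\<dots> = (LBINT x. of_real (g x) * ?F x - ift G x * ?F x)"
      by (rule Bochner_Integration.integral_diff[symmetric]; rule integrable_bounded_mult(2)[OF iF])
        (use B norm_ift_le in auto)
    also have "\<dots> = (LBINT x. h x * ?F x)"
      by (simp add: h_def algebra_simps)
    also have "\<dots> = t ^ DIM('a) *\<^sub>R (LBINT z. h (a + t *\<^sub>R z) * ?F (a + t *\<^sub>R z))"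
      using t by (subst integral_lborel_affine[of t _ a]) auto
    also have "\<dots> = (LBINT z. of_real (std_gaussian z) * h (a + t *\<^sub>R z))"
    proof -
      have "h (a + t *\<^sub>R z) * ?F (a + t *\<^sub>R z) = of_real ((1 / t) ^ DIM('a)) * (of_real (std_gaussian z) * h (a + t *\<^sub>R z))" for z
        using t by (simp add: fourier_gaussian_wave std_gaussian_minus)
      then show ?thesis
        using t by (simp add: scaleR_conv_of_real power_divide)
    qed
    finally show ?thesis by simp
  qed
  have "(\<lambda>n. 1 / real (Suc n)) \<longlonglongrightarrow> 0"
    using LIMSEQ_inverse_real_of_nat by (simp add: inverse_eq_divide)
  from gaussian_approx_identity[OF h this, of a] have "(\<lambda>n::nat. 0) \<longlonglongrightarrow> h a"
    by (subst (asm) zero) auto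
  then have "h a = 0" by (simp add: LIMSEQ_const_iff)
  then show ?thesis by (simp add: h_def)
qed

lemma continuous_AE_eq_0:
  fixes h :: "'a::euclidean_space \<Rightarrow> 'b::real_normed_vector"
  assumes h: "continuous_on UNIV h" and ae: "AE x in lborel. h x = 0"
  shows "h x = 0"
proof (rule ccontr)
  assume x: "h x \<noteq> 0"
  have op: "open {x. h x \<noteq> 0}"
    by (intro open_Collect_neq h continuous_intros)
  have "{x. h x \<noteq> 0} \<in> null_sets lborel"
    using ae op by (subst (asm) AE_iff_null) (auto simp: borel_open)
  then have "negligible {x. h x \<noteq> 0}"
    by (simp add: negligible_iff_null_sets null_sets_completionI)
  with op x show False using open_not_negligible by blast
qed

text \<open>A Gaussian factor makes the bounded function \<open>h\<close> integrable, and the tests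
  against \<open>gaussian_wave 1 \<xi>\<close> are the values of the transform of the product.
  Continuity upgrades the resulting identity from almost everywhere to everywhere.\<close>

lemma schwartz_test_eq_0:
  fixes h :: "'a::euclidean_space \<Rightarrow> complex"
  assumes h: "continuous_on UNIV h" and B: "\<And>x. norm (h x) \<le> B"
    and 0: "\<And>\<phi>. \<phi> \<in> schwartz \<Longrightarrow> (LBINT x. h x * \<phi> x) = 0"
  shows "h x = 0"
proof -
  have [measurable]: "h \<in> borel_measurable borel"
    using h by (rule borel_measurable_continuous_onI)
  let ?H = "\<lambda>x. h x * gaussian_wave 1 0 x"
  have H: "integrable lborel ?H"
    by (rule integrable_bounded_mult(2)[OF schwartz_integrable[OF gaussian_wave_schwartz] _ B]) auto
  have "ift ?H \<xi> = 0" for \<xi>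
    using 0[OF gaussian_wave_schwartz[of 1 \<xi>]]
    by (simp add: ift_def gaussian_wave_def inner_commute mult.assoc)
  from ift_injective[OF H this] have "AE x in lborel. h x = 0"
    by eventually_elim (use damp_bounds(1) in \<open>auto simp: gaussian_wave_def less_irrefl\<close>)
  with h show ?thesis by (rule continuous_AE_eq_0)
qed

section \<open>Weights and membership in the spectral Barron spaces\<close>

definition weight :: "real \<Rightarrow> 'a::euclidean_space \<Rightarrow> real" where
  "weight s \<xi> = (1 + (norm \<xi>)\<^sup>2) powr (s / 2)"

lemma measurable_weight [measurable]: "weight s \<in> borel_measurable borel"
  unfolding weight_def by measurable

lemma weight_pos [simp]: "weight s \<xi> > 0" "weight s \<xi> \<ge> 0" "weight s \<xi> \<noteq> 0" "\<bar>weight s \<xi>\<bar> = weight s \<xi>"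
proof -
  have "1 + (norm \<xi>)\<^sup>2 > 0" by (simp add: add_pos_nonneg)
  then show "weight s \<xi> > 0" by (simp add: weight_def)
  then show "weight s \<xi> \<ge> 0" "weight s \<xi> \<noteq> 0" "\<bar>weight s \<xi>\<bar> = weight s \<xi>" by auto
qed

lemma weight_ge_1: "s \<ge> 0 \<Longrightarrow> weight s \<xi> \<ge> 1"
  unfolding weight_def by (rule ge_one_powr_ge_zero) auto

lemma integrable_of_weight:
  fixes G :: "'a::euclidean_space \<Rightarrow> complex"
  assumes s: "s \<ge> 0" and G: "integrable lborel (\<lambda>\<xi>. of_real (weight s \<xi>) * G \<xi>)"
  shows "integrable lborel G"
proof -
  have "integrable lborel (\<lambda>\<xi>. of_real (1 / weight s \<xi>) * (of_real (weight s \<xi>) * G \<xi>))"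
    using weight_ge_1[OF s] by (intro integrable_bounded_mult(2)[OF G, where B=1]) (auto simp: norm_divide)
  then show ?thesis by (simp add: mult.assoc[symmetric] flip: of_real_mult)
qed

text \<open>Replaces the distributional definition by what the proof works with: a transform that is
  integrable with its weight, represents \<open>g\<close> at every point and computes its
  norm.\<close>

lemma barron_spaceD:
  fixes g :: "'a::euclidean_space \<Rightarrow> real"
  assumes g: "g \<in> barron_space s" and s: "s \<ge> 0"
  obtains G where "integrable lborel (\<lambda>\<xi>. of_real (weight s \<xi>) * G \<xi>)" "integrable lborel G"
    "\<And>x. of_real (g x) = ift G x"
    "barron_norm s g = (\<integral>\<^sup>+\<xi>. ennreal (norm (of_real (weight s \<xi>) * G \<xi>)) \<partial>lborel)"
proof -
  let ?G = "fourier_function g"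
  have gG: "has_fourier_function g ?G"
    using g someI_ex[of "has_fourier_function g"] by (auto simp: barron_space_def fourier_function_def)
  then have [measurable]: "?G \<in> borel_measurable borel"
    by (simp add: has_fourier_function_def)
  have n: "barron_norm s g = (\<integral>\<^sup>+\<xi>. ennreal (norm (of_real (weight s \<xi>) * ?G \<xi>)) \<partial>lborel)"
    by (simp add: barron_norm_def weight_def[symmetric] norm_mult mult.commute)
  have i: "integrable lborel (\<lambda>\<xi>. of_real (weight s \<xi>) * ?G \<xi>)"
    using g n by (simp add: integrable_iff_bounded barron_space_def)
  have i': "integrable lborel ?G"
    by (rule integrable_of_weight[OF s i])
  show ?thesis
    using that[OF i i' _ n] fourier_representation[OF gG i'] g by (auto simp: barron_space_def)
qed

text \<open>The function selected in \<open>fourier_function\<close> may differ from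
  \<open>G\<close> on a null set, which the integral in the norm ignores.\<close>

lemma barron_spaceI:
  fixes g :: "'a::euclidean_space \<Rightarrow> real"
  assumes s: "s \<ge> 0" and i: "integrable lborel (\<lambda>\<xi>. of_real (weight s \<xi>) * G \<xi>)"
    and g: "\<And>x. of_real (g x) = ift G x"
  shows "g \<in> barron_space s"
    and "barron_norm s g = (\<integral>\<^sup>+\<xi>. ennreal (norm (of_real (weight s \<xi>) * G \<xi>)) \<partial>lborel)"
proof -
  have G: "integrable lborel G" by (rule integrable_of_weight[OF s i])
  have gG: "has_fourier_function g G" using G g by (rule has_fourier_functionI)
  then have "has_fourier_function g (fourier_function g)"
    unfolding fourier_function_def by (rule someI[of "has_fourier_function g"])
  from has_fourier_function_unique[OF this gG]
  show n: "barron_norm s g = (\<integral>\<^sup>+\<xi>. ennreal (norm (of_real (weight s \<xi>) * G \<xi>)) \<partial>lborel)"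
    unfolding barron_norm_def
    by (intro nn_integral_cong_AE, eventually_elim) (simp add: weight_def[symmetric] norm_mult mult.commute)
  have re: "g = (\<lambda>x. Re (ift G x))" using g by (metis Re_complex_of_real ext)
  have "continuous_on UNIV g"
    unfolding re by (intro continuous_intros continuous_ift G)
  moreover have "bounded (range g)"
    unfolding bounded_iff re
    by (intro exI[of _ "LBINT \<xi>. norm (G \<xi>)"]) (auto intro: order_trans[OF abs_Re_le_cmod norm_ift_le])
  ultimately show "g \<in> barron_space s"
    using gG i n by (auto simp: barron_space_def integrable_iff_bounded)
qed

text \<open>Integrability of |\<xi>|^2 U makes minus the distributional Laplacian of
  \<open>u\<close> a bounded continuous function. The residual \<open>h\<close> of the equation is
  then bounded and continuous as well, and vanishes as a distribution exactly when it vanishes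
  pointwise.\<close>

lemma schroedinger_solution_iff:
  fixes V u f :: "'a::euclidean_space \<Rightarrow> real"
  assumes U: "integrable lborel U" "integrable lborel (\<lambda>\<xi>. of_real ((norm \<xi>)\<^sup>2) * U \<xi>)"
    and u: "\<And>x. of_real (u x) = ift U x"
    and V: "continuous_on UNIV V" "bounded (range V)"
    and f: "continuous_on UNIV f" "bounded (range f)"
  shows "schroedinger_solution V f u \<longleftrightarrow>
    (\<forall>x. ift (\<lambda>\<xi>. of_real ((norm \<xi>)\<^sup>2) * U \<xi>) x + of_real (V x * u x) = of_real (f x))"
proof -
  let ?L = "ift (\<lambda>\<xi>. of_real ((norm \<xi>)\<^sup>2) * U \<xi>)"
  define h where "h x = ?L x + of_real (V x * u x) - of_real (f x)" for x
  obtain B where B: "\<And>x. \<bar>V x\<bar> \<le> B" using V(2) by (auto simp: bounded_iff)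
  obtain A where A: "\<And>x. \<bar>f x\<bar> \<le> A" using f(2) by (auto simp: bounded_iff)
  have re: "u = (\<lambda>x. Re (ift U x))" using u by (metis Re_complex_of_real ext)
  have cu: "continuous_on UNIV u"
    unfolding re by (intro continuous_intros continuous_ift U)
  have Bu: "\<bar>u x\<bar> \<le> (LBINT \<xi>. norm (U \<xi>))" for x
    using norm_ift_le[of U x] unfolding u[symmetric] by simp
  have [measurable]: "u \<in> borel_measurable borel" "V \<in> borel_measurable borel" "f \<in> borel_measurable borel"
    "?L \<in> borel_measurable borel"
    using cu V f continuous_ift[OF U(2)] by (auto intro: borel_measurable_continuous_onI)
  have BVu: "\<bar>V x * u x\<bar> \<le> B * (LBINT \<xi>. norm (U \<xi>))" for x
    unfolding abs_mult using B[of x] by (intro mult_mono B Bu) auto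
  have test: "- laplacian_distribution (real_distribution u) \<phi> + real_distribution (\<lambda>x. V x * u x) \<phi>
      - real_distribution f \<phi> = (LBINT x. h x * \<phi> x)" if \<phi>: "\<phi> \<in> schwartz" for \<phi>
  proof -
    note i\<phi> = schwartz_integrable[OF \<phi>]
    have "laplacian_distribution (real_distribution u) \<phi> = (LBINT x. ift U x * laplacian \<phi> x)"
      by (simp add: laplacian_distribution_def fun_distribution_def u)
    also have "\<dots> = (LBINT x. U x * ift (laplacian \<phi>) x)"
      by (rule ift_exchange[OF U(1) schwartz_laplacian_integrable[OF \<phi>]])
    also have "\<dots> = - (LBINT x. (of_real ((norm x)\<^sup>2) * U x) * ift \<phi> x)"
      by (simp add: ift_laplacian[OF \<phi>] mult_ac)
    also have "\<dots> = - (LBINT x. ?L x * \<phi> x)"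
      by (simp only: ift_exchange[OF U(2) i\<phi>])
    finally have 1: "laplacian_distribution (real_distribution u) \<phi> = - (LBINT x. ?L x * \<phi> x)" .
    have i1: "integrable lborel (\<lambda>x. ?L x * \<phi> x)"
      by (rule integrable_bounded_mult(2)[OF i\<phi> _ norm_ift_le]) measurable
    have i2: "integrable lborel (\<lambda>x. of_real (V x * u x) * \<phi> x)"
      by (rule integrable_bounded_mult(2)[OF i\<phi>, where B="B * (LBINT \<xi>. norm (U \<xi>))"])
        (use BVu in \<open>auto simp del: of_real_mult\<close>)
    have i3: "integrable lborel (\<lambda>x. of_real (f x) * \<phi> x)"
      by (rule integrable_bounded_mult(2)[OF i\<phi>, where B=A]) (use A in auto)
    have "(LBINT x. h x * \<phi> x) = (LBINT x. ?L x * \<phi> x + of_real (V x * u x) * \<phi> x - of_real (f x) * \<phi> x)"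
      by (simp add: h_def algebra_simps)
    also have "\<dots> = (LBINT x. ?L x * \<phi> x) + (LBINT x. of_real (V x * u x) * \<phi> x) - (LBINT x. of_real (f x) * \<phi> x)"
      using i1 i2 i3 by simp
    finally show ?thesis
      by (simp add: 1 fun_distribution_def)
  qed
  have ch: "continuous_on UNIV h"
    unfolding h_def by (intro continuous_intros continuous_ift U V f cu)
  have Bh: "norm (h x) \<le> (LBINT \<xi>. norm (of_real ((norm \<xi>)\<^sup>2) * U \<xi>)) + B * (LBINT \<xi>. norm (U \<xi>)) + A" for x
  proof -
    have "norm (h x) \<le> norm (?L x) + norm (complex_of_real (V x * u x)) + norm (complex_of_real (f x))"
      unfolding h_def by (intro norm_triangle_le_diff add_right_mono norm_triangle_ineq)
    also have "\<dots> \<le> (LBINT \<xi>. norm (of_real ((norm \<xi>)\<^sup>2) * U \<xi>)) + B * (LBINT \<xi>. norm (U \<xi>)) + A"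
      unfolding norm_of_real by (intro add_mono norm_ift_le BVu A)
    finally show ?thesis .
  qed
  have "schroedinger_solution V f u \<longleftrightarrow> (\<forall>\<phi>\<in>schwartz. (LBINT x. h x * \<phi> x) = 0)"
    unfolding schroedinger_solution_def
  proof (rule ball_cong[OF refl])
    fix \<phi> :: "'a \<Rightarrow> complex" assume "\<phi> \<in> schwartz"
    from test[OF this]
    show "(- laplacian_distribution (real_distribution u) \<phi> + real_distribution (\<lambda>x. V x * u x) \<phi> = real_distribution f \<phi>)
      \<longleftrightarrow> (LBINT x. h x * \<phi> x) = 0"
      by (metis eq_iff_diff_eq_0)
  qed
  also have "\<dots> \<longleftrightarrow> (\<forall>x. h x = 0)"
    using schwartz_test_eq_0[OF ch Bh] by auto
  finally show ?thesis by (simp add: h_def)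
qed

section \<open>The Fredholm alternative and the space \<open>L\<^sup>1\<close>\<close>

text \<open>Injectivity keeps the image of a basis independent and of the same cardinality. A basis
  vector outside the span of that image would give one independent vector too many.\<close>

lemma finite_dimensional_injective_imp_surjective:
  fixes G :: "'x::real_vector \<Rightarrow> 'x"
  assumes G: "linear G" and A: "finite A" and inj: "inj_on G (span A)" and sub: "G ` span A \<subseteq> span A"
  shows "span A \<subseteq> G ` span A"
proof -
  obtain B where B: "B \<subseteq> A" "independent B" "A \<subseteq> span B"
    using maximal_independent_subset[of A] by blast
  have span: "span B = span A"
    using B by (metis span_minimal span_mono subset_antisym subspace_span)
  have fB: "finite B" using A B(1) finite_subset by blast
  have ind: "independent (G ` B)"
    using inj B by (intro linear_independent_injective_image G) (auto simp: span)
  have card: "card (G ` B) = card B"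
    using inj B(1) by (intro card_image inj_on_subset[OF inj]) (auto intro: span_base)
  have "b \<in> span (G ` B)" if b: "b \<in> B" for b
  proof (rule ccontr)
    assume nb: "b \<notin> span (G ` B)"
    have 1: "independent (insert b (G ` B))"
      by (rule independent_insertI[OF nb ind])
    have 2: "insert b (G ` B) \<subseteq> span B"
      using b sub B(1) by (auto simp: span intro: span_base)
    have "card (insert b (G ` B)) \<le> card B"
      by (rule independent_span_bound[OF fB 1 2, THEN conjunct2])
    moreover have "b \<notin> G ` B" using nb by (metis span_base)
    then have "card (insert b (G ` B)) = Suc (card B)"
      unfolding card[symmetric] using fB by (intro card_insert_disjoint finite_imageI)
    ultimately show False by linarith
  qed
  then have "span B \<subseteq> span (G ` B)"
    by (intro span_minimal) auto
  also have "span (G ` B) = G ` span B"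
    by (rule linear_span_image[OF G])
  finally show ?thesis by (simp add: span)
qed

text \<open>With \<open>F\<close> the finite rank operator below and \<open>R = (I + T - F)\<^sup>-\<^sup>1\<close>, the equation \<open>w + T w = g\<close> becomes
  \<open>w + R F w = R g\<close>, whose left side differs from the identity by an operator into the
  finite-dimensional span of the vectors \<open>R (a i)\<close>.\<close>

lemma fredholm_alternative:
  fixes T :: "'x::banach \<Rightarrow> 'x" and a :: "'i \<Rightarrow> 'x" and \<phi> :: "'i \<Rightarrow> 'x \<Rightarrow> real"
  assumes T: "bounded_linear T" and I: "finite I" and \<phi>: "\<And>i. i \<in> I \<Longrightarrow> bounded_linear (\<phi> i)"
    and small: "\<And>x. norm (T x - (\<Sum>i\<in>I. \<phi> i x *\<^sub>R a i)) \<le> c * norm x" and c: "0 \<le> c" "c < 1"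
    and inj: "\<And>x. x + T x = 0 \<Longrightarrow> x = 0"
  shows "\<exists>C\<ge>0. \<forall>g. \<exists>w. w + T w = g \<and> norm w \<le> C * norm g"
proof -
  define F where "F x = (\<Sum>i\<in>I. \<phi> i x *\<^sub>R a i)" for x
  define S where "S x = T x - F x" for x
  have F: "bounded_linear F"
    unfolding F_def by (intro bounded_linear_sum bounded_linear_scaleR_const \<phi>)
  have S: "bounded_linear S"
    unfolding S_def by (intro bounded_linear_sub T F)
  have Sc: "norm (S x) \<le> c * norm x" for x
    using small by (simp add: S_def F_def)
  note linT = bounded_linear.linear[OF T] and linF = bounded_linear.linear[OF F] and linS = bounded_linear.linear[OF S]
  \<comment> \<open>Solutions are the fixed points of the map from \<open>w\<close> to
    \<open>g - S w\<close>, a contraction with constant \<open>c\<close>.\<close>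
  have ex1: "\<exists>!w. w + S w = g" for g
  proof -
    have "\<exists>!w. g - S w = w"
    proof (intro banach_fix_type[OF c] allI)
      show "dist (g - S x) (g - S y) \<le> c * dist x y" for x y
        using Sc[of "y - x"] by (simp add: dist_norm linear_diff[OF linS] norm_minus_commute)
    qed
    moreover have "g - S w = w \<longleftrightarrow> w + S w = g" for w by (auto simp: algebra_simps)
    ultimately show ?thesis by simp
  qed
  define R where "R g = (THE w. w + S w = g)" for g
  have R: "R g + S (R g) = g" for g
    unfolding R_def by (rule theI'[OF ex1])
  have RI: "R g = w" if "w + S w = g" for g w
    using ex1[of g] R[of g] that by blast
  have Rbl: "bounded_linear R"
  proof (rule bounded_linear_intro[where K="1 / (1 - c)"])
    show "R (x + y) = R x + R y" for x y
      using R[of x] R[of y] by (intro RI) (simp add: linear_add[OF linS] algebra_simps)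
    show "R (r *\<^sub>R x) = r *\<^sub>R R x" for r x
      using R[of x] by (intro RI) (simp add: linear_scale[OF linS] flip: scaleR_right_distrib)
    show "norm (R x) \<le> norm x * (1 / (1 - c))" for x
    proof -
      have "norm (R x) = norm (x - S (R x))" using R[of x] by (metis add_diff_cancel_right')
      also have "\<dots> \<le> norm x + c * norm (R x)"
        using norm_triangle_ineq4[of x "S (R x)"] Sc[of "R x"] by linarith
      finally show ?thesis using c by (simp add: field_simps)
    qed
  qed
  note linR = bounded_linear.linear[OF Rbl]
  define G where "G y = y + R (F y)" for y
  have G: "bounded_linear G"
    unfolding G_def by (intro bounded_linear_add bounded_linear_ident bounded_linear_compose[OF Rbl F])
  note linG = bounded_linear.linear[OF G]
  have G_iff: "G w = R g \<longleftrightarrow> w + T w = g" for w g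
  proof
    assume "G w = R g"
    then have "w = R (g - F w)" by (simp add: G_def linear_diff[OF linR] eq_diff_eq)
    with R[of "g - F w"] have "w + S w = g - F w" by simp
    then show "w + T w = g" by (simp add: S_def algebra_simps)
  next
    assume "w + T w = g"
    then have "R (g - F w) = w" by (intro RI) (simp add: S_def algebra_simps)
    then show "G w = R g" by (simp add: G_def linear_diff[OF linR] diff_eq_eq add.commute)
  qed
  let ?A = "(\<lambda>i. R (a i)) ` I"
  have RF: "R (F y) = (\<Sum>i\<in>I. \<phi> i y *\<^sub>R R (a i))" for y
    by (simp add: F_def linear_sum[OF linR] linear_scale[OF linR])
  have RFA: "R (F y) \<in> span ?A" for y
    unfolding RF by (intro span_sum span_scale span_base) auto
  have "inj G"
    unfolding linear_injective_0[OF linG]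
  proof (intro allI impI)
    fix y assume "G y = 0"
    then have "G y = R 0" by (simp add: linear_0[OF linR])
    then have "y + T y = 0" by (simp only: G_iff)
    then show "y = 0" by (rule inj)
  qed
  have "span ?A \<subseteq> G ` span ?A"
  proof (rule finite_dimensional_injective_imp_surjective[OF linG])
    show "inj_on G (span ?A)" using \<open>inj G\<close> inj_on_subset by blast
    show "G ` span ?A \<subseteq> span ?A"
      unfolding G_def using RFA by (auto intro: span_add)
  qed (use I in auto)
  then have "\<forall>i\<in>I. \<exists>y. G y = R (a i)"
    using span_base[of _ ?A] by (metis (no_types, lifting) image_eqI image_iff subset_iff)
  then obtain y where y: "\<And>i. i \<in> I \<Longrightarrow> G (y i) = R (a i)" by metis
  \<comment> \<open>\<open>G (R g)\<close> exceeds \<open>R g\<close> by a combination of the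
    vectors \<open>R (a i)\<close>, and the \<open>y i\<close> are their preimages under
    \<open>G\<close>; subtracting them gives a solution by formula. Since the formula is bounded and
    linear in \<open>g\<close>, the constant \<open>C\<close> comes with it.\<close>
  define W where "W g = R g - (\<Sum>i\<in>I. \<phi> i (R g) *\<^sub>R y i)" for g
  have "bounded_linear W"
    unfolding W_def
    by (intro bounded_linear_sub bounded_linear_sum bounded_linear_scaleR_const Rbl)
      (rule bounded_linear_compose[OF \<phi> Rbl])
  then obtain C where C: "C \<ge> 0" "\<And>g. norm (W g) \<le> norm g * C"
    using bounded_linear.nonneg_bounded by blast
  have "W g + T (W g) = g" for g
  proof -
    have "G (W g) = G (R g) - (\<Sum>i\<in>I. \<phi> i (R g) *\<^sub>R R (a i))"
      by (simp add: W_def linear_diff[OF linG] linear_sum[OF linG] linear_scale[OF linG] y)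
    also have "\<dots> = R g" by (simp add: G_def RF)
    finally show ?thesis by (simp add: G_iff)
  qed
  then show ?thesis using C by (metis mult.commute)
qed

\<comment> \<open>The fixed point theorem behind \<open>fredholm_alternative\<close> is stated for a
  type of a complete class, so L1 is made into a type. The quotient is partial because only
  integrable functions represent a class.\<close>
quotient_type (overloaded) 'a l1 = "'a::euclidean_space \<Rightarrow> complex" /
  partial: "\<lambda>f g. integrable lborel f \<and> integrable lborel g \<and> (AE x in lborel. f x = g x)"
proof (rule part_equivpI)
  show "\<exists>f :: 'a \<Rightarrow> complex. integrable lborel f \<and> integrable lborel f \<and> (AE x in lborel. f x = f x)"
    by (intro exI[of _ "\<lambda>_. 0"]) auto
  show "symp (\<lambda>f g :: 'a \<Rightarrow> complex. integrable lborel f \<and> integrable lborel g \<and> (AE x in lborel. f x = g x))"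
    by (auto simp: symp_def)
  show "transp (\<lambda>f g :: 'a \<Rightarrow> complex. integrable lborel f \<and> integrable lborel g \<and> (AE x in lborel. f x = g x))"
  proof (rule transpI)
    fix f g h :: "'a \<Rightarrow> complex"
    assume a: "integrable lborel f \<and> integrable lborel g \<and> (AE x in lborel. f x = g x)"
      and b: "integrable lborel g \<and> integrable lborel h \<and> (AE x in lborel. g x = h x)"
    then have "AE x in lborel. f x = g x" "AE x in lborel. g x = h x" by auto
    then have "AE x in lborel. f x = h x" by eventually_elim simp
    with a b show "integrable lborel f \<and> integrable lborel h \<and> (AE x in lborel. f x = h x)" by auto
  qed
qed

instantiation l1 :: (euclidean_space) real_vector
begin

lift_definition zero_l1 :: "'a l1" is "\<lambda>_. 0" by auto

lift_definition plus_l1 :: "'a l1 \<Rightarrow> 'a l1 \<Rightarrow> 'a l1" is "\<lambda>f g x. f x + g x" by auto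

lift_definition minus_l1 :: "'a l1 \<Rightarrow> 'a l1 \<Rightarrow> 'a l1" is "\<lambda>f g x. f x - g x" by auto

lift_definition uminus_l1 :: "'a l1 \<Rightarrow> 'a l1" is "\<lambda>f x. - f x" by auto

lift_definition scaleR_l1 :: "real \<Rightarrow> 'a l1 \<Rightarrow> 'a l1" is "\<lambda>r f x. r *\<^sub>R f x" by auto

instance
proof
  fix x y z :: "'a l1" and a b :: real
  show "x + y + z = x + (y + z)" by transfer (auto simp: add.assoc)
  show "x + y = y + x" by transfer (auto simp: add.commute)
  show "0 + x = x" by transfer auto
  show "- x + x = 0" by transfer auto
  show "x - y = x + - y" by transfer auto
  show "a *\<^sub>R (x + y) = a *\<^sub>R x + a *\<^sub>R y" by transfer (auto simp: scaleR_right_distrib)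
  show "(a + b) *\<^sub>R x = a *\<^sub>R x + b *\<^sub>R x" by transfer (auto simp: scaleR_left_distrib)
  show "a *\<^sub>R b *\<^sub>R x = (a * b) *\<^sub>R x" by transfer auto
  show "1 *\<^sub>R x = x" by transfer auto
qed

end

instantiation l1 :: (euclidean_space) real_normed_vector
begin

lift_definition norm_l1 :: "'a l1 \<Rightarrow> real" is "\<lambda>f. LBINT x. norm (f x)"
  by (intro integral_cong_AE) auto

definition dist_l1 :: "'a l1 \<Rightarrow> 'a l1 \<Rightarrow> real" where "dist_l1 x y = norm (x - y)"

definition sgn_l1 :: "'a l1 \<Rightarrow> 'a l1" where "sgn_l1 x = scaleR (inverse (norm x)) x"

definition uniformity_l1 :: "('a l1 \<times> 'a l1) filter" where
  "uniformity_l1 = (INF e\<in>{0<..}. principal {(x, y). dist x y < e})"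

definition open_l1 :: "'a l1 set \<Rightarrow> bool" where
  "open_l1 S = (\<forall>x\<in>S. \<forall>\<^sub>F (x', y) in uniformity. x' = x \<longrightarrow> y \<in> S)"

instance
proof
  fix x y :: "'a l1" and a :: real
  show "dist x y = norm (x - y)" by (simp add: dist_l1_def)
  show "sgn x = x /\<^sub>R norm x" by (simp add: sgn_l1_def)
  show "uniformity = (INF e\<in>{0<..}. principal {(x, y :: 'a l1). dist x y < e})"
    by (simp add: uniformity_l1_def)
  show "open U = (\<forall>x\<in>U. \<forall>\<^sub>F (x', y) in uniformity. x' = x \<longrightarrow> y \<in> U)" for U :: "'a l1 set"
    by (simp add: open_l1_def)
  show "norm x = 0 \<longleftrightarrow> x = 0"
    by transfer (auto simp: integral_nonneg_eq_0_iff_AE)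
  show "norm (x + y) \<le> norm x + norm y"
  proof transfer
    fix f g :: "'a \<Rightarrow> complex"
    assume f: "integrable lborel f \<and> integrable lborel f \<and> (AE x in lborel. f x = f x)"
      and g: "integrable lborel g \<and> integrable lborel g \<and> (AE x in lborel. g x = g x)"
    have "(LBINT x. norm (f x + g x)) \<le> (LBINT x. norm (f x) + norm (g x))"
      using f g by (intro integral_mono norm_triangle_ineq) auto
    then show "(LBINT x. norm (f x + g x)) \<le> (LBINT x. norm (f x)) + (LBINT x. norm (g x))"
      using f g by simp
  qed
  show "norm (a *\<^sub>R x) = \<bar>a\<bar> * norm x" by transfer simp
qed

end

section \<open>Passing between functions and their classes; completeness of L1\<close>

lemma integrable_rep_l1 [simp]: "integrable lborel (rep_l1 x)"
  using Quotient_rep_reflp[OF Quotient_l1, of x] by simp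

lemma abs_rep_l1 [simp]: "abs_l1 (rep_l1 x) = x"
  by (rule Quotient_abs_rep[OF Quotient_l1])

lemma abs_l1_eq_iff:
  assumes "integrable lborel f" "integrable lborel g"
  shows "abs_l1 f = abs_l1 g \<longleftrightarrow> (AE x in lborel. f x = g x)"
  using Quotient_rel[OF Quotient_l1, of f g] assms by auto

lemma rep_abs_l1:
  assumes "integrable lborel f"
  shows "AE x in lborel. rep_l1 (abs_l1 f) x = f x"
  using abs_l1_eq_iff[of "rep_l1 (abs_l1 f)" f] assms by simp

lemma abs_l1_add: "integrable lborel f \<Longrightarrow> integrable lborel g \<Longrightarrow> abs_l1 f + abs_l1 g = abs_l1 (\<lambda>x. f x + g x)"
  by (rule plus_l1.abs_eq) auto

lemma abs_l1_diff: "integrable lborel f \<Longrightarrow> integrable lborel g \<Longrightarrow> abs_l1 f - abs_l1 g = abs_l1 (\<lambda>x. f x - g x)"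
  by (rule minus_l1.abs_eq) auto

lemma abs_l1_scaleR: "integrable lborel f \<Longrightarrow> r *\<^sub>R abs_l1 f = abs_l1 (\<lambda>x. r *\<^sub>R f x)"
  by (rule scaleR_l1.abs_eq) auto

lemma norm_abs_l1: "integrable lborel f \<Longrightarrow> norm (abs_l1 f) = (LBINT x. norm (f x))"
  by (rule norm_l1.abs_eq) auto

lemma norm_rep_l1: "norm x = (LBINT \<xi>. norm (rep_l1 x \<xi>))"
  using norm_abs_l1[of "rep_l1 x"] by simp

text \<open>Exchanging sum and integral shows that the sum of the norms has a finite integral and is
  therefore finite almost everywhere.\<close>

lemma AE_summable_of_integrals:
  fixes g :: "nat \<Rightarrow> 'a::euclidean_space \<Rightarrow> complex"
  assumes g: "\<And>k. integrable lborel (g k)" and s: "summable (\<lambda>k. LBINT x. norm (g k x))"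
  shows "AE x in lborel. summable (\<lambda>k. norm (g k x))"
proof -
  note [measurable] = integrable_lborel_measurable[OF g]
  have "(\<integral>\<^sup>+x. (\<Sum>k. ennreal (norm (g k x))) \<partial>lborel) = (\<Sum>k. \<integral>\<^sup>+x. ennreal (norm (g k x)) \<partial>lborel)"
    by (rule nn_integral_suminf) auto
  also have "\<dots> = (\<Sum>k. ennreal (LBINT x. norm (g k x)))"
    using g by (intro suminf_cong nn_integral_eq_integral) auto
  also have "\<dots> = ennreal (\<Sum>k. LBINT x. norm (g k x))"
    using s by (intro suminf_ennreal2) auto
  finally have "(\<integral>\<^sup>+x. (\<Sum>k. ennreal (norm (g k x))) \<partial>lborel) \<noteq> \<infinity>" by simp
  then have "AE x in lborel. (\<Sum>k. ennreal (norm (g k x))) \<noteq> \<infinity>"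
    by (intro nn_integral_noteq_infinite) auto
  then show ?thesis
    by eventually_elim (auto intro!: summable_suminf_not_top)
qed

text \<open>The Riesz-Fischer argument: a subsequence with geometrically small increments telescopes
  to a series converging absolutely almost everywhere, and dominated convergence makes its pointwise
  sum an L1 limit.\<close>

instance l1 :: (euclidean_space) banach
proof
  fix X :: "nat \<Rightarrow> 'a l1" assume X: "Cauchy X"
  have "\<exists>N. \<forall>m\<ge>N. \<forall>n\<ge>N. dist (X m) (X n) < (1 / 2) ^ k" for k
    using X unfolding Cauchy_def by auto
  then obtain N where N: "\<And>k m n. m \<ge> N k \<Longrightarrow> n \<ge> N k \<Longrightarrow> dist (X m) (X n) < (1 / 2) ^ k" by metis
  \<comment> \<open>The sum ensures \<open>N k \<le> r k\<close>; the added \<open>k\<close> makes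
    \<open>r\<close> strictly increasing. Consecutive terms of the subsequence are then within
    \<open>(1 / 2) ^ k\<close>.\<close>
  define r where "r k = (\<Sum>j\<le>k. N j) + k" for k
  have r: "strict_mono r" unfolding strict_mono_Suc_iff by (simp add: r_def)
  have rN: "N k \<le> r k" for k
    unfolding r_def using member_le_sum[of k "{..k}" N] by simp
  define f where "f k = rep_l1 (X (r k))" for k
  define g where "g k x = f (Suc k) x - f k x" for k x
  have f: "integrable lborel (f k)" for k by (simp add: f_def)
  have g: "integrable lborel (g k)" for k unfolding g_def by (intro Bochner_Integration.integrable_diff f)
  have [measurable]: "f k \<in> borel_measurable borel" "g k \<in> borel_measurable borel" for k
    using f[THEN borel_measurable_integrable] g[THEN borel_measurable_integrable] by simp_all
  have ng: "(LBINT x. norm (g k x)) \<le> (1 / 2) ^ k" for k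
  proof -
    have "X (r (Suc k)) - X (r k) = abs_l1 (g k)"
      unfolding g_def using abs_l1_diff[OF f f, of "Suc k" k] by (simp add: f_def)
    then have "(LBINT x. norm (g k x)) = dist (X (r (Suc k))) (X (r k))"
      by (simp add: dist_norm norm_abs_l1 g)
    also have "\<dots> \<le> (1 / 2) ^ k"
      using rN[of k] strict_monoD[OF r, of k "Suc k"] by (intro less_imp_le[OF N]) auto
    finally show ?thesis .
  qed
  have sg: "summable (\<lambda>k. LBINT x. norm (g k x))"
    by (rule summable_comparison_test'[where g="\<lambda>k. (1 / 2) ^ k" and N=0]) (use ng in auto)
  have ae: "AE x in lborel. summable (\<lambda>k. norm (g k x))"
    using g sg by (rule AE_summable_of_integrals)
  define D where "D x = (\<Sum>k. norm (g k x))" for x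
  define H where "H x = f 0 x + (\<Sum>k. g k x)" for x
  have iD: "integrable lborel D"
    unfolding D_def by (rule integrable_suminf) (use g ae sg in auto)
  have iH: "integrable lborel H"
    unfolding H_def by (intro Bochner_Integration.integrable_add f integrable_suminf g ae sg)
  note [measurable] = integrable_lborel_measurable[OF iH]
  have fn: "f n x = f 0 x + (\<Sum>k<n. g k x)" for n x
    unfolding g_def using sum_lessThan_telescope[of "\<lambda>k. f k x" n] by simp
  have "(\<lambda>n. LBINT x. norm (f n x - H x)) \<longlonglongrightarrow> (\<integral>x. 0 \<partial>(lborel :: 'a measure))"
  proof (rule integral_dominated_convergence[where w="\<lambda>x. 2 * D x"])
    show "AE x in lborel. (\<lambda>n. norm (f n x - H x)) \<longlonglongrightarrow> 0"
      using ae
    proof eventually_elim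
      fix x assume "summable (\<lambda>k. norm (g k x))"
      then have "(\<lambda>n. \<Sum>k<n. g k x) \<longlonglongrightarrow> (\<Sum>k. g k x)"
        by (rule summable_LIMSEQ[OF summable_norm_cancel])
      then have "(\<lambda>n. norm ((\<Sum>k<n. g k x) - (\<Sum>k. g k x))) \<longlonglongrightarrow> 0"
        by (simp add: LIM_zero_iff tendsto_norm_zero_iff)
      then show "(\<lambda>n. norm (f n x - H x)) \<longlonglongrightarrow> 0"
        by (subst fn) (simp add: H_def)
    qed
    show "AE x in lborel. norm (norm (f n x - H x)) \<le> 2 * D x" for n
      using ae
    proof eventually_elim
      fix x assume s: "summable (\<lambda>k. norm (g k x))"
      have "norm (\<Sum>k<n. g k x) \<le> D x"
        unfolding D_def by (rule order_trans[OF norm_sum sum_le_suminf]) (use s in auto)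
      moreover have "norm (\<Sum>k. g k x) \<le> D x"
        unfolding D_def by (rule summable_norm[OF s])
      ultimately show "norm (norm (f n x - H x)) \<le> 2 * D x"
        using norm_triangle_ineq4[of "\<Sum>k<n. g k x" "\<Sum>k. g k x"]
        by (subst fn) (simp add: H_def)
    qed
  qed (use iD in auto)
  moreover have "dist ((X \<circ> r) n) (abs_l1 H) = (LBINT x. norm (f n x - H x))" for n
    using abs_l1_diff[OF f[of n] iH] f[of n] iH by (simp add: dist_norm f_def norm_abs_l1)
  ultimately have "(X \<circ> r) \<longlonglongrightarrow> abs_l1 H"
    by (subst tendsto_dist_iff) simp
  with X r show "convergent X"
    using Cauchy_converges_subseq convergentI by blast
qed

section \<open>Integral operators on \<open>L\<^sup>1\<close>\<close>

definition kernel_op :: "('a::euclidean_space \<Rightarrow> 'a \<Rightarrow> complex) \<Rightarrow> ('a \<Rightarrow> complex) \<Rightarrow> 'a \<Rightarrow> complex" where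
  "kernel_op K w \<xi> = (LBINT \<eta>. K \<xi> \<eta> * w \<eta>)"

text \<open>The condition is on columns: the output variable \<xi> is integrated while the input
  variable \<eta> is fixed. A uniform column bound is what controls the operator norm on L1.\<close>

definition kernel_bound :: "('a::euclidean_space \<Rightarrow> 'a \<Rightarrow> complex) \<Rightarrow> real \<Rightarrow> bool" where
  "kernel_bound K M \<longleftrightarrow> (\<lambda>(\<xi>, \<eta>). K \<xi> \<eta>) \<in> borel_measurable (borel \<Otimes>\<^sub>M borel) \<and>
    (\<forall>\<eta>. integrable lborel (\<lambda>\<xi>. K \<xi> \<eta>) \<and> (LBINT \<xi>. norm (K \<xi> \<eta>)) \<le> M)"

lemma kernel_boundD:
  assumes "kernel_bound K M"
  shows "(\<lambda>(\<xi>, \<eta>). K \<xi> \<eta>) \<in> borel_measurable (borel \<Otimes>\<^sub>M borel)"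
    "integrable lborel (\<lambda>\<xi>. K \<xi> \<eta>)" "(LBINT \<xi>. norm (K \<xi> \<eta>)) \<le> M" "0 \<le> M"
proof -
  show le: "(LBINT \<xi>. norm (K \<xi> \<eta>)) \<le> M" for \<eta> using assms by (auto simp: kernel_bound_def)
  have "0 \<le> (LBINT \<xi>. norm (K \<xi> 0))" by simp
  then show "0 \<le> M" using le[of 0] by linarith
qed (use assms in \<open>auto simp: kernel_bound_def\<close>)

context
  fixes K :: "'a::euclidean_space \<Rightarrow> 'a \<Rightarrow> complex" and M :: real
  assumes K: "kernel_bound K M"
begin

text \<open>The bounded factor \<open>h\<close> is the constant 1 when the image itself is studied
  and a character when its transform is computed.\<close>

lemma kernel_integrable_product:
  assumes w: "integrable lborel w" and [measurable]: "h \<in> borel_measurable borel" and h: "\<And>\<xi>. norm (h \<xi>) \<le> B"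
  shows "integrable (lborel \<Otimes>\<^sub>M lborel) (\<lambda>(\<eta>, \<xi>). K \<xi> \<eta> * w \<eta> * h \<xi>)"
proof (rule lborel_pair.Fubini_integrable)
  note [measurable] = integrable_lborel_measurable[OF w]
  note [measurable] = kernel_boundD(1)[OF K]
  have B: "0 \<le> B" using h[of 0] norm_ge_zero order_trans by blast
  have i: "integrable lborel (\<lambda>\<xi>. K \<xi> \<eta> * w \<eta> * h \<xi>)" for \<eta>
    by (rule integrable_bounded_mult(1)[OF _ _ h]) (use kernel_boundD(2)[OF K] in auto)
  then show "AE \<eta> in lborel. integrable lborel (\<lambda>\<xi>. case (\<eta>, \<xi>) of (\<eta>, \<xi>) \<Rightarrow> K \<xi> \<eta> * w \<eta> * h \<xi>)"
    by simp
  show "(\<lambda>(\<eta>, \<xi>). K \<xi> \<eta> * w \<eta> * h \<xi>) \<in> borel_measurable (lborel \<Otimes>\<^sub>M lborel)"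
    by measurable
  show "integrable lborel (\<lambda>\<eta>. LBINT \<xi>. norm (case (\<eta>, \<xi>) of (\<eta>, \<xi>) \<Rightarrow> K \<xi> \<eta> * w \<eta> * h \<xi>))"
  proof (rule Bochner_Integration.integrable_bound[where f="\<lambda>\<eta>. (M * B) * norm (w \<eta>)"])
    show "AE \<eta> in lborel. norm (LBINT \<xi>. norm (case (\<eta>, \<xi>) of (\<eta>, \<xi>) \<Rightarrow> K \<xi> \<eta> * w \<eta> * h \<xi>)) \<le> norm ((M * B) * norm (w \<eta>))"
    proof (rule AE_I2)
      fix \<eta>
      have "(LBINT \<xi>. norm (K \<xi> \<eta> * w \<eta> * h \<xi>)) \<le> (LBINT \<xi>. norm (K \<xi> \<eta>) * (B * norm (w \<eta>)))"
      proof (rule integral_mono[OF integrable_norm[OF i]])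
        show "integrable lborel (\<lambda>\<xi>. norm (K \<xi> \<eta>) * (B * norm (w \<eta>)))"
          using kernel_boundD(2)[OF K] by auto
        show "norm (K \<xi> \<eta> * w \<eta> * h \<xi>) \<le> norm (K \<xi> \<eta>) * (B * norm (w \<eta>))" for \<xi>
          using mult_left_mono[OF h[of \<xi>], of "norm (K \<xi> \<eta>) * norm (w \<eta>)"] by (simp add: norm_mult mult_ac)
      qed
      also have "\<dots> = (LBINT \<xi>. norm (K \<xi> \<eta>)) * (B * norm (w \<eta>))" by simp
      also have "\<dots> \<le> M * (B * norm (w \<eta>))"
        using B by (intro mult_right_mono kernel_boundD(3)[OF K]) auto
      finally show "norm (LBINT \<xi>. norm (case (\<eta>, \<xi>) of (\<eta>, \<xi>) \<Rightarrow> K \<xi> \<eta> * w \<eta> * h \<xi>)) \<le> norm ((M * B) * norm (w \<eta>))"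
        using B kernel_boundD(4)[OF K] by (simp add: abs_mult mult.assoc)
    qed
  qed (use w in auto)
qed

lemma kernel_integrable_product_plain:
  assumes w: "integrable lborel w"
  shows "integrable (lborel \<Otimes>\<^sub>M lborel) (\<lambda>(\<eta>, \<xi>). K \<xi> \<eta> * w \<eta>)"
  using kernel_integrable_product[OF w, of "\<lambda>_. 1" 1] by simp

lemma integrable_kernel_op:
  assumes w: "integrable lborel w"
  shows "integrable lborel (kernel_op K w)"
  using lborel_pair.integrable_snd[OF kernel_integrable_product_plain[OF w]] by (simp add: kernel_op_def[abs_def])

lemma AE_integrable_kernel_op:
  assumes w: "integrable lborel w"
  shows "AE \<xi> in lborel. integrable lborel (\<lambda>\<eta>. K \<xi> \<eta> * w \<eta>)"
  using lborel_pair.AE_integrable_snd[OF kernel_integrable_product_plain[OF w]] by simp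

lemma integral_kernel_op_mult:
  assumes w: "integrable lborel w" and h: "h \<in> borel_measurable borel" "\<And>\<xi>. norm (h \<xi>) \<le> B"
  shows "(LBINT \<xi>. kernel_op K w \<xi> * h \<xi>) = (LBINT \<eta>. w \<eta> * (LBINT \<xi>. K \<xi> \<eta> * h \<xi>))"
proof -
  have "(LBINT \<xi>. kernel_op K w \<xi> * h \<xi>) = (LBINT \<xi>. (LBINT \<eta>. K \<xi> \<eta> * w \<eta> * h \<xi>))"
    by (simp add: kernel_op_def)
  also have "\<dots> = (LBINT \<eta>. (LBINT \<xi>. K \<xi> \<eta> * w \<eta> * h \<xi>))"
    by (rule lborel_pair.Fubini_integral[OF kernel_integrable_product[OF w h]])
  also have "\<dots> = (LBINT \<eta>. (LBINT \<xi>. w \<eta> * (K \<xi> \<eta> * h \<xi>)))"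
    by (simp add: mult_ac)
  finally show ?thesis by simp
qed

lemma integral_norm_kernel_op_le:
  assumes w: "integrable lborel w"
  shows "(LBINT \<xi>. norm (kernel_op K w \<xi>)) \<le> M * (LBINT \<eta>. norm (w \<eta>))"
proof -
  note P = integrable_norm[OF kernel_integrable_product_plain[OF w]]
  have P': "integrable (lborel \<Otimes>\<^sub>M lborel) (\<lambda>(\<eta>, \<xi>). norm (K \<xi> \<eta>) * norm (w \<eta>))"
    using P by (simp add: case_prod_unfold norm_mult)
  have "(LBINT \<xi>. norm (kernel_op K w \<xi>)) \<le> (LBINT \<xi>. (LBINT \<eta>. norm (K \<xi> \<eta>) * norm (w \<eta>)))"
  proof (rule integral_mono)
    show "integrable lborel (\<lambda>\<xi>. norm (kernel_op K w \<xi>))"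
      using integrable_kernel_op[OF w] by auto
    show "integrable lborel (\<lambda>\<xi>. LBINT \<eta>. norm (K \<xi> \<eta>) * norm (w \<eta>))"
      using lborel_pair.integrable_snd[OF P'] .
    show "norm (kernel_op K w \<xi>) \<le> (LBINT \<eta>. norm (K \<xi> \<eta>) * norm (w \<eta>))" for \<xi>
      unfolding kernel_op_def by (rule order_trans[OF integral_norm_bound]) (simp add: norm_mult)
  qed
  also have "\<dots> = (LBINT \<eta>. (LBINT \<xi>. norm (K \<xi> \<eta>) * norm (w \<eta>)))"
    by (rule lborel_pair.Fubini_integral[OF P'])
  also have "\<dots> = (LBINT \<eta>. (LBINT \<xi>. norm (K \<xi> \<eta>)) * norm (w \<eta>))"
    by simp
  also have "\<dots> \<le> (LBINT \<eta>. M * norm (w \<eta>))"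
  proof (rule integral_mono)
    show "integrable lborel (\<lambda>\<eta>. (LBINT \<xi>. norm (K \<xi> \<eta>)) * norm (w \<eta>))"
      using lborel_pair.integrable_fst[OF P'] by simp
  qed (use w kernel_boundD(3)[OF K] in \<open>auto intro: mult_right_mono\<close>)
  finally show ?thesis by simp
qed

lemma kernel_op_cong_AE:
  assumes w: "integrable lborel w" and w': "integrable lborel w'" and eq: "AE \<eta> in lborel. w \<eta> = w' \<eta>"
  shows "kernel_op K w \<xi> = kernel_op K w' \<xi>"
proof -
  have [measurable]: "w \<in> borel_measurable borel" "w' \<in> borel_measurable borel"
    using w w' borel_measurable_integrable[of lborel] by auto
  note [measurable] = kernel_boundD(1)[OF K]
  show ?thesis
    unfolding kernel_op_def by (rule integral_cong_AE) (use eq in auto)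
qed

text \<open>Only almost everywhere: for \<xi> in a null set the integrand may fail to be integrable,
  and the default value 0 of the integral is not additive.\<close>

lemma kernel_op_add_AE:
  assumes w: "integrable lborel w" and w': "integrable lborel w'"
  shows "AE \<xi> in lborel. kernel_op K (\<lambda>\<eta>. w \<eta> + w' \<eta>) \<xi> = kernel_op K w \<xi> + kernel_op K w' \<xi>"
  using AE_integrable_kernel_op[OF w] AE_integrable_kernel_op[OF w']
  by eventually_elim (simp add: kernel_op_def distrib_left)

lemma bounded_linear_kernel_op:
  "bounded_linear (\<lambda>x. abs_l1 (kernel_op K (rep_l1 x)))"
proof (rule bounded_linear_intro[where K=M])
  fix x y :: "'a l1" and r :: real
  have "AE \<eta> in lborel. rep_l1 (x + y) \<eta> = rep_l1 x \<eta> + rep_l1 y \<eta>"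
    using rep_abs_l1[of "\<lambda>\<eta>. rep_l1 x \<eta> + rep_l1 y \<eta>"] abs_l1_add[of "rep_l1 x" "rep_l1 y"] by simp
  then have "kernel_op K (rep_l1 (x + y)) = kernel_op K (\<lambda>\<eta>. rep_l1 x \<eta> + rep_l1 y \<eta>)"
    by (intro ext kernel_op_cong_AE) auto
  then show "abs_l1 (kernel_op K (rep_l1 (x + y))) = abs_l1 (kernel_op K (rep_l1 x)) + abs_l1 (kernel_op K (rep_l1 y))"
    using kernel_op_add_AE[of "rep_l1 x" "rep_l1 y"]
    by (simp add: abs_l1_add integrable_kernel_op abs_l1_eq_iff)
  have "AE \<eta> in lborel. rep_l1 (r *\<^sub>R x) \<eta> = r *\<^sub>R rep_l1 x \<eta>"
    using rep_abs_l1[of "\<lambda>\<eta>. r *\<^sub>R rep_l1 x \<eta>"] abs_l1_scaleR[of "rep_l1 x" r] by simp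
  then have "kernel_op K (rep_l1 (r *\<^sub>R x)) = kernel_op K (\<lambda>\<eta>. r *\<^sub>R rep_l1 x \<eta>)"
    by (intro ext kernel_op_cong_AE) auto
  also have "\<dots> = (\<lambda>\<xi>. r *\<^sub>R kernel_op K (rep_l1 x) \<xi>)"
    by (rule ext) (simp add: kernel_op_def)
  finally show "abs_l1 (kernel_op K (rep_l1 (r *\<^sub>R x))) = r *\<^sub>R abs_l1 (kernel_op K (rep_l1 x))"
    by (simp add: abs_l1_scaleR integrable_kernel_op)
  show "norm (abs_l1 (kernel_op K (rep_l1 x))) \<le> norm x * M"
    using integral_norm_kernel_op_le[of "rep_l1 x"]
    by (simp add: norm_abs_l1 integrable_kernel_op norm_rep_l1[of x] mult.commute)
qed

end

lemma bounded_linear_integral_l1: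
  assumes [measurable]: "b \<in> borel_measurable borel" and b: "\<And>\<eta>. norm (b \<eta>) \<le> B"
  shows "bounded_linear (\<lambda>x. LBINT \<eta>. b \<eta> * rep_l1 x \<eta>)"
proof (rule bounded_linear_intro[where K=B])
  fix x y :: "'a l1" and r :: real
  have i: "integrable lborel (\<lambda>\<eta>. b \<eta> * rep_l1 x \<eta>)" for x
    by (rule integrable_bounded_mult(2)[OF _ _ b]) auto
  note [measurable] = integrable_lborel_measurable[OF integrable_rep_l1]
  have "AE \<eta> in lborel. rep_l1 (x + y) \<eta> = rep_l1 x \<eta> + rep_l1 y \<eta>"
    using rep_abs_l1[of "\<lambda>\<eta>. rep_l1 x \<eta> + rep_l1 y \<eta>"] abs_l1_add[of "rep_l1 x" "rep_l1 y"] by simp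
  then have "(LBINT \<eta>. b \<eta> * rep_l1 (x + y) \<eta>) = (LBINT \<eta>. b \<eta> * rep_l1 x \<eta> + b \<eta> * rep_l1 y \<eta>)"
    by (intro integral_cong_AE) (auto simp: distrib_left)
  then show "(LBINT \<eta>. b \<eta> * rep_l1 (x + y) \<eta>) = (LBINT \<eta>. b \<eta> * rep_l1 x \<eta>) + (LBINT \<eta>. b \<eta> * rep_l1 y \<eta>)"
    using i by simp
  have "AE \<eta> in lborel. rep_l1 (r *\<^sub>R x) \<eta> = r *\<^sub>R rep_l1 x \<eta>"
    using rep_abs_l1[of "\<lambda>\<eta>. r *\<^sub>R rep_l1 x \<eta>"] abs_l1_scaleR[of "rep_l1 x" r] by simp
  then have "(LBINT \<eta>. b \<eta> * rep_l1 (r *\<^sub>R x) \<eta>) = (LBINT \<eta>. r *\<^sub>R (b \<eta> * rep_l1 x \<eta>))"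
    by (intro integral_cong_AE) auto
  then show "(LBINT \<eta>. b \<eta> * rep_l1 (r *\<^sub>R x) \<eta>) = r *\<^sub>R (LBINT \<eta>. b \<eta> * rep_l1 x \<eta>)"
    by simp
  have "norm (LBINT \<eta>. b \<eta> * rep_l1 x \<eta>) \<le> (LBINT \<eta>. norm (b \<eta> * rep_l1 x \<eta>))"
    by (rule integral_norm_bound)
  also have "\<dots> \<le> (LBINT \<eta>. norm (rep_l1 x \<eta>) * B)"
    by (intro integral_mono integrable_norm i) (auto simp: norm_mult mult.commute[of _ B] intro!: mult_right_mono b)
  finally show "norm (LBINT \<eta>. b \<eta> * rep_l1 x \<eta>) \<le> norm x * B"
    by (simp add: norm_rep_l1[of x])
qed

text \<open>The abstract alternative uses real functionals, so a complex coefficient counts as two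
  real ones, acting on a vector and on \<i> times it.\<close>

lemma complex_mult_split: "c * z = Re c *\<^sub>R z + Im c *\<^sub>R (\<i> * z)"
  by (simp add: complex_eq_iff)

lemma abs_l1_sum:
  assumes "finite I" "\<And>i. i \<in> I \<Longrightarrow> integrable lborel (f i)"
  shows "(\<Sum>i\<in>I. abs_l1 (f i)) = abs_l1 (\<lambda>x. \<Sum>i\<in>I. f i x)"
  using assms
proof induction
  case empty
  show ?case by (simp add: zero_l1.abs_eq)
next
  case (insert i I)
  then show ?case by (simp add: abs_l1_add)
qed

text \<open>A sum of products of a function of \<xi> and a function of \<eta> is the kernel of a
  finite rank operator, and the column bound \<open>c\<close> of the remaining kernel bounds the
  difference of the operators.\<close>

lemma kernel_fredholm:
  fixes K :: "'a::euclidean_space \<Rightarrow> 'a \<Rightarrow> complex" and a b :: "'i \<Rightarrow> 'a \<Rightarrow> complex"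
  assumes K: "kernel_bound K M" and I: "finite I"
    and a: "\<And>i. i \<in> I \<Longrightarrow> integrable lborel (a i)"
    and b: "\<And>i. i \<in> I \<Longrightarrow> b i \<in> borel_measurable borel" "\<And>i \<eta>. i \<in> I \<Longrightarrow> norm (b i \<eta>) \<le> B"
    and D: "kernel_bound (\<lambda>\<xi> \<eta>. K \<xi> \<eta> - (\<Sum>i\<in>I. a i \<xi> * b i \<eta>)) c" and c: "c < 1"
    and inj: "\<And>w. integrable lborel w \<Longrightarrow> AE \<xi> in lborel. w \<xi> + kernel_op K w \<xi> = 0 \<Longrightarrow> AE \<xi> in lborel. w \<xi> = 0"
  shows "\<exists>C\<ge>0. \<forall>g. integrable lborel g \<longrightarrow> (\<exists>w. integrable lborel w \<and>
      (AE \<xi> in lborel. w \<xi> + kernel_op K w \<xi> = g \<xi>) \<and>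
      (LBINT \<xi>. norm (w \<xi>)) \<le> C * (LBINT \<xi>. norm (g \<xi>)))"
proof -
  let ?T = "\<lambda>x. abs_l1 (kernel_op K (rep_l1 x))"
  define \<beta> where "\<beta> i x = (LBINT \<eta>. b i \<eta> * rep_l1 x \<eta>)" for i x
  \<comment> \<open>The Boolean in the index selects the real or the imaginary part of the complex
    coefficient; \<open>A\<close> pairs the imaginary part with \<i> times the vector.\<close>
  define \<phi> where "\<phi> j x = (if snd j then Re (\<beta> (fst j) x) else Im (\<beta> (fst j) x))" for j :: "'i \<times> bool" and x
  define A where "A j = abs_l1 (if snd j then a (fst j) else (\<lambda>\<xi>. \<i> * a (fst j) \<xi>))" for j :: "'i \<times> bool"
  have \<beta>: "bounded_linear (\<beta> i)" if "i \<in> I" for i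
    unfolding \<beta>_def using b that by (intro bounded_linear_integral_l1)
  have rank: "(\<Sum>j\<in>I \<times> UNIV. \<phi> j x *\<^sub>R A j) = abs_l1 (\<lambda>\<xi>. \<Sum>i\<in>I. \<beta> i x * a i \<xi>)" for x
  proof -
    have "(\<Sum>j\<in>I \<times> UNIV. \<phi> j x *\<^sub>R A j) = (\<Sum>i\<in>I. \<Sum>t\<in>UNIV. \<phi> (i, t) x *\<^sub>R A (i, t))"
      by (simp add: sum.cartesian_product)
    also have "\<dots> = (\<Sum>i\<in>I. abs_l1 (\<lambda>\<xi>. \<beta> i x * a i \<xi>))"
    proof (rule sum.cong[OF refl])
      fix i assume i: "i \<in> I"
      have "(\<Sum>t\<in>UNIV. \<phi> (i, t) x *\<^sub>R A (i, t)) = Re (\<beta> i x) *\<^sub>R abs_l1 (a i) + Im (\<beta> i x) *\<^sub>R abs_l1 (\<lambda>\<xi>. \<i> * a i \<xi>)"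
        by (simp add: UNIV_bool \<phi>_def A_def add.commute)
      also have "\<dots> = abs_l1 (\<lambda>\<xi>. \<beta> i x * a i \<xi>)"
        using a[OF i] by (simp add: abs_l1_scaleR abs_l1_add complex_mult_split[of "\<beta> i x"])
      finally show "(\<Sum>t\<in>UNIV. \<phi> (i, t) x *\<^sub>R A (i, t)) = abs_l1 (\<lambda>\<xi>. \<beta> i x * a i \<xi>)" .
    qed
    also have "\<dots> = abs_l1 (\<lambda>\<xi>. \<Sum>i\<in>I. \<beta> i x * a i \<xi>)"
      using a I by (intro abs_l1_sum) auto
    finally show ?thesis .
  qed
  have "\<exists>C\<ge>0. \<forall>g. \<exists>w. w + ?T w = g \<and> norm w \<le> C * norm g"
  proof (rule fredholm_alternative[OF bounded_linear_kernel_op[OF K]])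
    show "finite (I \<times> (UNIV :: bool set))" using I by simp
    show "bounded_linear (\<phi> j)" if "j \<in> I \<times> UNIV" for j
    proof (cases "snd j")
      case True
      then show ?thesis
        unfolding \<phi>_def using that bounded_linear_compose[OF bounded_linear_Re \<beta>[of "fst j"]] by (simp add: mem_Times_iff)
    next
      case False
      then show ?thesis
        unfolding \<phi>_def using that bounded_linear_compose[OF bounded_linear_Im \<beta>[of "fst j"]] by (simp add: mem_Times_iff)
    qed
    show "norm (?T x - (\<Sum>j\<in>I \<times> UNIV. \<phi> j x *\<^sub>R A j)) \<le> c * norm x" for x
    proof -
      let ?D = "\<lambda>\<xi> \<eta>. K \<xi> \<eta> - (\<Sum>i\<in>I. a i \<xi> * b i \<eta>)"
      have iF: "integrable lborel (\<lambda>\<xi>. \<Sum>i\<in>I. \<beta> i x * a i \<xi>)"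
        using a by (intro Bochner_Integration.integrable_sum) auto
      have "AE \<xi> in lborel. kernel_op K (rep_l1 x) \<xi> - (\<Sum>i\<in>I. \<beta> i x * a i \<xi>) = kernel_op ?D (rep_l1 x) \<xi>"
        using AE_integrable_kernel_op[OF K integrable_rep_l1[of x]]
      proof eventually_elim
        fix \<xi> assume i: "integrable lborel (\<lambda>\<eta>. K \<xi> \<eta> * rep_l1 x \<eta>)"
        have ib: "integrable lborel (\<lambda>\<eta>. b i \<eta> * rep_l1 x \<eta>)" if "i \<in> I" for i
          by (rule integrable_bounded_mult(2)[OF _ b(1)[OF that] b(2)[OF that]]) auto
        have iS: "integrable lborel (\<lambda>\<eta>. \<Sum>i\<in>I. a i \<xi> * (b i \<eta> * rep_l1 x \<eta>))"
          using ib by (intro Bochner_Integration.integrable_sum) auto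
        have "kernel_op ?D (rep_l1 x) \<xi> = (LBINT \<eta>. K \<xi> \<eta> * rep_l1 x \<eta> - (\<Sum>i\<in>I. a i \<xi> * (b i \<eta> * rep_l1 x \<eta>)))"
          by (simp add: kernel_op_def left_diff_distrib sum_distrib_right mult.assoc)
        also have "\<dots> = kernel_op K (rep_l1 x) \<xi> - (LBINT \<eta>. (\<Sum>i\<in>I. a i \<xi> * (b i \<eta> * rep_l1 x \<eta>)))"
          using i iS by (simp add: kernel_op_def)
        also have "(LBINT \<eta>. (\<Sum>i\<in>I. a i \<xi> * (b i \<eta> * rep_l1 x \<eta>))) = (\<Sum>i\<in>I. \<beta> i x * a i \<xi>)"
          using ib by (subst Bochner_Integration.integral_sum) (auto simp: \<beta>_def mult.commute)
        finally show "kernel_op K (rep_l1 x) \<xi> - (\<Sum>i\<in>I. \<beta> i x * a i \<xi>) = kernel_op ?D (rep_l1 x) \<xi>" by simp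
      qed
      then have "?T x - (\<Sum>j\<in>I \<times> UNIV. \<phi> j x *\<^sub>R A j) = abs_l1 (kernel_op ?D (rep_l1 x))"
        unfolding rank using iF
        by (simp add: abs_l1_diff abs_l1_eq_iff integrable_kernel_op[OF K] integrable_kernel_op[OF D])
      then show ?thesis
        using integral_norm_kernel_op_le[OF D integrable_rep_l1[of x]]
        by (simp add: norm_abs_l1 integrable_kernel_op[OF D] norm_rep_l1[of x])
    qed
    show "0 \<le> c" using kernel_boundD(4)[OF D] .
    show "x = 0" if "x + ?T x = 0" for x
    proof -
      have "abs_l1 (\<lambda>\<xi>. rep_l1 x \<xi> + kernel_op K (rep_l1 x) \<xi>) = abs_l1 (\<lambda>_. 0)"
        using that abs_l1_add[OF integrable_rep_l1 integrable_kernel_op[OF K integrable_rep_l1], of x x]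
        by (simp add: zero_l1.abs_eq)
      then have "AE \<xi> in lborel. rep_l1 x \<xi> + kernel_op K (rep_l1 x) \<xi> = 0"
        by (subst (asm) abs_l1_eq_iff) (auto intro!: Bochner_Integration.integrable_add integrable_kernel_op[OF K])
      then have "AE \<xi> in lborel. rep_l1 x \<xi> = 0"
        by (rule inj[OF integrable_rep_l1])
      then have "abs_l1 (rep_l1 x) = abs_l1 (\<lambda>_. 0)"
        by (subst abs_l1_eq_iff) auto
      then show ?thesis by (simp add: zero_l1.abs_eq)
    qed
  qed (rule c)
  then obtain C where C: "C \<ge> 0" "\<And>g. \<exists>w. w + ?T w = g \<and> norm w \<le> C * norm g" by blast
  show ?thesis
  proof (intro exI[of _ C] conjI allI impI C(1))
    fix g :: "'a \<Rightarrow> complex" assume g: "integrable lborel g"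
    obtain w where w: "w + ?T w = abs_l1 g" "norm w \<le> C * norm (abs_l1 g)" using C(2) by blast
    have "abs_l1 (\<lambda>\<xi>. rep_l1 w \<xi> + kernel_op K (rep_l1 w) \<xi>) = abs_l1 g"
      using w(1) abs_l1_add[OF integrable_rep_l1 integrable_kernel_op[OF K integrable_rep_l1], of w w] by simp
    then have "AE \<xi> in lborel. rep_l1 w \<xi> + kernel_op K (rep_l1 w) \<xi> = g \<xi>"
      using g by (subst (asm) abs_l1_eq_iff) (auto intro!: Bochner_Integration.integrable_add integrable_kernel_op[OF K])
    then show "\<exists>w. integrable lborel w \<and> (AE \<xi> in lborel. w \<xi> + kernel_op K w \<xi> = g \<xi>) \<and>
      (LBINT \<xi>. norm (w \<xi>)) \<le> C * (LBINT \<xi>. norm (g \<xi>))"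
      using w(2) g by (intro exI[of _ "rep_l1 w"]) (auto simp: norm_rep_l1[of w] norm_abs_l1)
  qed
qed

section \<open>Weighted L1 under translation\<close>

lemma weight_add_le: "s \<ge> 0 \<Longrightarrow> weight s (x + y) \<le> 2 powr (s / 2) * weight s x * weight s y"
proof -
  assume s: "s \<ge> 0"
  have "(norm (x + y))\<^sup>2 \<le> (norm x + norm y)\<^sup>2"
    by (intro power_mono norm_triangle_ineq) auto
  also have "\<dots> \<le> 2 * (norm x)\<^sup>2 + 2 * (norm y)\<^sup>2"
    using sum_squares_bound[of "norm x" "norm y"] by (simp add: power2_sum)
  finally have sq: "(norm (x + y))\<^sup>2 \<le> 2 * (norm x)\<^sup>2 + 2 * (norm y)\<^sup>2" .
  \<comment> \<open>A Peetre-type inequality; its factor 2 becomes \<open>2 powr (s / 2)\<close>. A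
    translation can thus be paid for by the weight of the shift.\<close>
  have "1 + (norm (x + y))\<^sup>2 \<le> 2 * (1 + (norm x)\<^sup>2) * (1 + (norm y)\<^sup>2)"
  proof -
    have "2 * (1 + (norm x)\<^sup>2) * (1 + (norm y)\<^sup>2)
        = 2 + 2 * (norm x)\<^sup>2 + 2 * (norm y)\<^sup>2 + 2 * ((norm x)\<^sup>2 * (norm y)\<^sup>2)"
      by (simp add: algebra_simps)
    moreover have "0 \<le> (norm x)\<^sup>2 * (norm y)\<^sup>2" by simp
    ultimately show ?thesis using sq by linarith
  qed
  then have "weight s (x + y) \<le> (2 * (1 + (norm x)\<^sup>2) * (1 + (norm y)\<^sup>2)) powr (s / 2)"
    unfolding weight_def using s by (intro powr_mono2) auto
  also have "\<dots> = 2 powr (s / 2) * weight s x * weight s y"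
    by (simp add: weight_def powr_mult del: distrib_left_numeral)
  finally show ?thesis .
qed

lemma isCont_weight: "isCont (weight s) (x :: 'a::euclidean_space)"
proof -
  have "1 + (norm x)\<^sup>2 > 0" by (simp add: add_pos_nonneg)
  then show ?thesis unfolding weight_def by (auto intro!: continuous_intros)
qed

lemma weighted_shift_integrable:
  fixes G :: "'a::euclidean_space \<Rightarrow> complex"
  assumes s: "s \<ge> 0" and G: "integrable lborel (\<lambda>\<xi>. of_real (weight s \<xi>) * G \<xi>)"
  shows "integrable lborel (\<lambda>\<xi>. of_real (weight s (\<xi> + \<eta>)) * G \<xi>)"
    and "(LBINT \<xi>. weight s (\<xi> + \<eta>) * norm (G \<xi>))
      \<le> 2 powr (s / 2) * weight s \<eta> * (LBINT \<xi>. weight s \<xi> * norm (G \<xi>))"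
    and "integrable lborel (\<lambda>\<xi>. of_real (weight s \<xi>) * G (\<xi> - \<eta>))"
proof -
  note [measurable] = integrable_lborel_measurable[OF integrable_of_weight[OF s G]]
  have le: "weight s (\<xi> + \<eta>) * norm (G \<xi>) \<le> (2 powr (s / 2) * weight s \<eta>) * (weight s \<xi> * norm (G \<xi>))" for \<xi>
    using mult_right_mono[OF weight_add_le[OF s, of \<xi> \<eta>], of "norm (G \<xi>)"] by (simp add: mult_ac)
  have iG: "integrable lborel (\<lambda>\<xi>. weight s \<xi> * norm (G \<xi>))"
    using integrable_norm[OF G] by (simp add: norm_mult)
  show 1: "integrable lborel (\<lambda>\<xi>. of_real (weight s (\<xi> + \<eta>)) * G \<xi>)"
  proof (rule Bochner_Integration.integrable_bound)
    show "integrable lborel (\<lambda>\<xi>. (2 powr (s / 2) * weight s \<eta>) * (weight s \<xi> * norm (G \<xi>)))"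
      using iG by (intro integrable_mult_right)
    show "AE \<xi> in lborel. norm (of_real (weight s (\<xi> + \<eta>)) * G \<xi>)
        \<le> norm ((2 powr (s / 2) * weight s \<eta>) * (weight s \<xi> * norm (G \<xi>)))"
      using le by (intro AE_I2) (simp add: norm_mult abs_mult)
  qed auto
  have "(LBINT \<xi>. weight s (\<xi> + \<eta>) * norm (G \<xi>))
      \<le> (LBINT \<xi>. (2 powr (s / 2) * weight s \<eta>) * (weight s \<xi> * norm (G \<xi>)))"
    using integrable_norm[OF 1] iG le by (intro integral_mono) (auto simp: norm_mult)
  then show "(LBINT \<xi>. weight s (\<xi> + \<eta>) * norm (G \<xi>))
      \<le> 2 powr (s / 2) * weight s \<eta> * (LBINT \<xi>. weight s \<xi> * norm (G \<xi>))"
    by simp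
  show "integrable lborel (\<lambda>\<xi>. of_real (weight s \<xi>) * G (\<xi> - \<eta>))"
    using 1 integrable_lborel_shift[of "\<lambda>\<xi>. of_real (weight s \<xi>) * G (\<xi> - \<eta>)" \<eta>] by simp
qed

text \<open>The weight does not commute with translation. The weighted difference splits into the
  translation difference of weight times \<open>G\<close>, handled by unweighted continuity, and a
  term in which the two values of the weight are compared, handled by dominated convergence after
  translating back.\<close>

lemma weighted_shift_continuous:
  fixes G :: "'a::euclidean_space \<Rightarrow> complex"
  assumes s: "s \<ge> 0" and G: "integrable lborel (\<lambda>\<xi>. of_real (weight s \<xi>) * G \<xi>)" and e: "e > 0"
  shows "\<exists>\<delta>>0. \<forall>h. norm h < \<delta> \<longrightarrow> (LBINT \<xi>. weight s \<xi> * norm (G (\<xi> - h) - G \<xi>)) < e"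
proof (rule ccontr)
  note [measurable] = integrable_lborel_measurable[OF integrable_of_weight[OF s G]]
  let ?wG = "\<lambda>\<xi>. of_real (weight s \<xi>) * G \<xi>"
  assume "\<not> ?thesis"
  moreover have "1 / real (Suc n) > 0" for n by simp
  ultimately have "\<forall>n. \<exists>h. norm h < 1 / real (Suc n) \<and> (LBINT \<xi>. weight s \<xi> * norm (G (\<xi> - h) - G \<xi>)) \<ge> e"
    by (meson not_less)
  then obtain h where h: "\<And>n. norm (h n) < 1 / real (Suc n)"
    "\<And>n. (LBINT \<xi>. weight s \<xi> * norm (G (\<xi> - h n) - G \<xi>)) \<ge> e" by metis
  have h0: "h \<longlonglongrightarrow> 0"
  proof (rule Lim_null_comparison)
    show "\<forall>\<^sub>F n in sequentially. norm (h n) \<le> 1 / real (Suc n)"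
      using h(1) by (intro always_eventually allI less_imp_le)
    show "(\<lambda>n. 1 / real (Suc n)) \<longlonglongrightarrow> 0"
      using LIMSEQ_inverse_real_of_nat by (simp add: inverse_eq_divide)
  qed
  have mh0: "(\<lambda>n. - h n) \<longlonglongrightarrow> 0" using tendsto_minus[OF h0] by simp
  have lim1: "(\<lambda>n. LBINT \<xi>. norm (?wG (\<xi> + - h n) - ?wG \<xi>)) \<longlonglongrightarrow> 0"
    using L1_continuous_shift_integrable[OF G] mh0 unfolding L1_continuous_shift_def by blast
  have wlim: "(\<lambda>n. weight s (\<xi> + h n)) \<longlonglongrightarrow> weight s \<xi>" for \<xi>
    using tendsto_add[OF tendsto_const h0, of \<xi>] by (intro isCont_tendsto_compose[OF isCont_weight]) simp
  \<comment> \<open>The weights of the shifts converge, hence are bounded; this gives a dominating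
    function independent of \<open>n\<close>.\<close>
  obtain B where B: "\<And>n. weight s (h n) \<le> B"
    using convergent_imp_Bseq[OF convergentI[OF wlim[of 0]]] by (auto simp: Bseq_def)
  have lim2: "(\<lambda>n. LBINT \<xi>. \<bar>weight s (\<xi> + h n) - weight s \<xi>\<bar> * norm (G \<xi>)) \<longlonglongrightarrow> (\<integral>x. 0 \<partial>(lborel :: 'a measure))"
  proof (rule integral_dominated_convergence[where w="\<lambda>\<xi>. (2 powr (s / 2) * B + 1) * (weight s \<xi> * norm (G \<xi>))"])
    show "integrable lborel (\<lambda>\<xi>. (2 powr (s / 2) * B + 1) * (weight s \<xi> * norm (G \<xi>)))"
      using integrable_norm[OF G] by (intro integrable_mult_right) (simp add: norm_mult)
    have "(\<lambda>n. \<bar>weight s (\<xi> + h n) - weight s \<xi>\<bar> * norm (G \<xi>)) \<longlonglongrightarrow> \<bar>weight s \<xi> - weight s \<xi>\<bar> * norm (G \<xi>)" for \<xi>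
      by (intro tendsto_intros wlim)
    then show "AE \<xi> in lborel. (\<lambda>n. \<bar>weight s (\<xi> + h n) - weight s \<xi>\<bar> * norm (G \<xi>)) \<longlonglongrightarrow> 0"
      by simp
    have "\<bar>weight s (\<xi> + h n) - weight s \<xi>\<bar> \<le> (2 powr (s / 2) * B + 1) * weight s \<xi>" for n \<xi>
    proof -
      have "weight s (\<xi> + h n) \<le> 2 powr (s / 2) * weight s \<xi> * B"
        by (rule order_trans[OF weight_add_le[OF s]]) (intro mult_left_mono B, simp)
      moreover have "(2 powr (s / 2) * B + 1) * weight s \<xi> = 2 powr (s / 2) * weight s \<xi> * B + weight s \<xi>"
        by (simp add: algebra_simps)
      ultimately show ?thesis
        using weight_pos(1)[of s \<xi>] weight_pos(1)[of s "\<xi> + h n"] by (intro abs_leI) linarith+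
    qed
    then show "AE \<xi> in lborel. norm (\<bar>weight s (\<xi> + h n) - weight s \<xi>\<bar> * norm (G \<xi>)) \<le> (2 powr (s / 2) * B + 1) * (weight s \<xi> * norm (G \<xi>))" for n
      by (intro AE_I2) (simp add: abs_mult mult_right_mono flip: mult.assoc)
  qed auto
  have "e \<le> (LBINT \<xi>. norm (?wG (\<xi> + - h n) - ?wG \<xi>))
      + (LBINT \<xi>. \<bar>weight s (\<xi> + h n) - weight s \<xi>\<bar> * norm (G \<xi>))" for n
  proof -
    let ?q = "\<lambda>\<xi>. \<bar>weight s (\<xi> + h n) - weight s \<xi>\<bar> * norm (G \<xi>)"
    have iq: "integrable lborel ?q"
    proof -
      have "integrable lborel (\<lambda>\<xi>. norm (of_real (weight s (\<xi> + h n)) * G \<xi> - of_real (weight s \<xi>) * G \<xi>))"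
        by (intro integrable_norm Bochner_Integration.integrable_diff weighted_shift_integrable(1)[OF s G] G)
      then show ?thesis
        by (simp add: left_diff_distrib[symmetric] norm_mult del: of_real_diff flip: of_real_diff)
    qed
    have iq': "integrable lborel (\<lambda>\<xi>. ?q (\<xi> - h n))"
      using iq integrable_lborel_shift[of ?q "- h n"] by simp
    have i1: "integrable lborel (\<lambda>\<xi>. norm (?wG (\<xi> + - h n) - ?wG \<xi>))"
      using G integrable_lborel_shift[of ?wG "- h n"] by (intro integrable_norm Bochner_Integration.integrable_diff) auto
    have i0: "integrable lborel (\<lambda>\<xi>. weight s \<xi> * norm (G (\<xi> - h n) - G \<xi>))"
    proof -
      have "integrable lborel (\<lambda>\<xi>. norm (of_real (weight s \<xi>) * G (\<xi> - h n) - of_real (weight s \<xi>) * G \<xi>))"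
        by (intro integrable_norm Bochner_Integration.integrable_diff weighted_shift_integrable(3)[OF s G] G)
      then show ?thesis by (simp add: right_diff_distrib[symmetric] norm_mult)
    qed
    have "e \<le> (LBINT \<xi>. weight s \<xi> * norm (G (\<xi> - h n) - G \<xi>))" by (rule h)
    also have "\<dots> \<le> (LBINT \<xi>. norm (?wG (\<xi> + - h n) - ?wG \<xi>) + ?q (\<xi> - h n))"
    proof (rule integral_mono[OF i0 Bochner_Integration.integrable_add[OF i1 iq']])
      fix \<xi>
      have "weight s \<xi> * norm (G (\<xi> - h n) - G \<xi>) = norm (of_real (weight s \<xi>) * (G (\<xi> - h n) - G \<xi>))"
        by (simp add: norm_mult)
      also have "of_real (weight s \<xi>) * (G (\<xi> - h n) - G \<xi>)
        = (?wG (\<xi> + - h n) - ?wG \<xi>) + of_real (weight s \<xi> - weight s (\<xi> - h n)) * G (\<xi> - h n)"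
        by (simp add: algebra_simps)
      also have "norm \<dots> \<le> norm (?wG (\<xi> + - h n) - ?wG \<xi>) + norm (of_real (weight s \<xi> - weight s (\<xi> - h n)) * G (\<xi> - h n))"
        by (rule norm_triangle_ineq)
      also have "norm (of_real (weight s \<xi> - weight s (\<xi> - h n)) * G (\<xi> - h n)) = ?q (\<xi> - h n)"
        by (simp add: norm_mult del: of_real_diff)
      finally show "weight s \<xi> * norm (G (\<xi> - h n) - G \<xi>) \<le> norm (?wG (\<xi> + - h n) - ?wG \<xi>) + ?q (\<xi> - h n)" .
    qed
    also have "\<dots> = (LBINT \<xi>. norm (?wG (\<xi> + - h n) - ?wG \<xi>)) + (LBINT \<xi>. ?q (\<xi> - h n))"
      by (rule Bochner_Integration.integral_add[OF i1 iq'])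
    also have "(LBINT \<xi>. ?q (\<xi> - h n)) = (LBINT \<xi>. ?q \<xi>)"
      using integral_lborel_shift[of ?q "- h n"] by simp
    finally show ?thesis .
  qed
  moreover have "(\<lambda>n. (LBINT \<xi>. norm (?wG (\<xi> + - h n) - ?wG \<xi>))
      + (LBINT \<xi>. \<bar>weight s (\<xi> + h n) - weight s \<xi>\<bar> * norm (G \<xi>))) \<longlonglongrightarrow> 0"
    using tendsto_add[OF lim1 lim2] by simp
  ultimately have "e \<le> 0" by (intro LIMSEQ_le_const) auto
  with e show False by simp
qed

section \<open>Compactness and the maximum principle\<close>

definition resolvent_weight :: "real \<Rightarrow> real \<Rightarrow> 'a::euclidean_space \<Rightarrow> real" where
  "resolvent_weight s \<alpha> \<eta> = 1 / (weight s \<eta> * (\<alpha> + (norm \<eta>)\<^sup>2))"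

definition schroedinger_kernel :: "real \<Rightarrow> real \<Rightarrow> ('a::euclidean_space \<Rightarrow> complex) \<Rightarrow> 'a \<Rightarrow> 'a \<Rightarrow> complex" where
  "schroedinger_kernel s \<alpha> G \<xi> \<eta> = of_real (weight s \<xi>) * G (\<xi> - \<eta>) * of_real (resolvent_weight s \<alpha> \<eta>)"

lemma measurable_resolvent_weight [measurable]: "resolvent_weight s \<alpha> \<in> borel_measurable borel"
  unfolding resolvent_weight_def by measurable

lemma resolvent_weight_bounds:
  assumes "s \<ge> 0" "\<alpha> > 0"
  shows "0 < resolvent_weight s \<alpha> \<eta>" "resolvent_weight s \<alpha> \<eta> \<le> 1 / \<alpha>"
    "resolvent_weight s \<alpha> \<eta> * weight s \<eta> = 1 / (\<alpha> + (norm \<eta>)\<^sup>2)"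
proof -
  have p: "0 < \<alpha> + (norm \<eta>)\<^sup>2" using assms by (simp add: add_pos_nonneg)
  show "0 < resolvent_weight s \<alpha> \<eta>" using p by (simp add: resolvent_weight_def)
  show "resolvent_weight s \<alpha> \<eta> * weight s \<eta> = 1 / (\<alpha> + (norm \<eta>)\<^sup>2)"
    by (simp add: resolvent_weight_def)
  have "1 * \<alpha> \<le> weight s \<eta> * (\<alpha> + (norm \<eta>)\<^sup>2)"
    using assms by (intro mult_mono weight_ge_1) auto
  then show "resolvent_weight s \<alpha> \<eta> \<le> 1 / \<alpha>"
    unfolding resolvent_weight_def using assms p by (intro divide_left_mono) auto
qed

context
  fixes s \<alpha> :: real and G :: "'a::euclidean_space \<Rightarrow> complex"
  assumes s: "s \<ge> 0" and \<alpha>: "\<alpha> > 0" and G: "integrable lborel (\<lambda>\<xi>. of_real (weight s \<xi>) * G \<xi>)"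
begin

lemma measurable_symbol: "G \<in> borel_measurable borel"
  using borel_measurable_integrable[OF integrable_of_weight[OF s G]] by simp

text \<open>Shifting the weight costs \<open>weight s \<eta>\<close>, which the reciprocal weight in
  \<open>resolvent_weight\<close> cancels. The remaining factor 1 / (\<alpha> + |\<eta>|^2) is the
  decay that makes high frequencies negligible.\<close>

lemma schroedinger_kernel_column:
  shows "integrable lborel (\<lambda>\<xi>. schroedinger_kernel s \<alpha> G \<xi> \<eta>)"
    and "(LBINT \<xi>. norm (schroedinger_kernel s \<alpha> G \<xi> \<eta>))
      \<le> 2 powr (s / 2) * (LBINT \<xi>. weight s \<xi> * norm (G \<xi>)) / (\<alpha> + (norm \<eta>)\<^sup>2)"
proof -
  show "integrable lborel (\<lambda>\<xi>. schroedinger_kernel s \<alpha> G \<xi> \<eta>)"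
    unfolding schroedinger_kernel_def
    using weighted_shift_integrable(3)[OF s G] by auto
  have "(LBINT \<xi>. norm (schroedinger_kernel s \<alpha> G \<xi> \<eta>))
      = resolvent_weight s \<alpha> \<eta> * (LBINT \<xi>. weight s \<xi> * norm (G (\<xi> - \<eta>)))"
    using resolvent_weight_bounds(1)[OF s \<alpha>, of \<eta>]
    by (simp add: schroedinger_kernel_def norm_mult abs_of_pos mult.commute)
  also have "(LBINT \<xi>. weight s \<xi> * norm (G (\<xi> - \<eta>))) = (LBINT \<xi>. weight s (\<xi> + \<eta>) * norm (G \<xi>))"
    using integral_lborel_shift[of "\<lambda>\<xi>. weight s \<xi> * norm (G (\<xi> - \<eta>))" \<eta>] by simp
  also have "resolvent_weight s \<alpha> \<eta> * \<dots> \<le> resolvent_weight s \<alpha> \<eta> *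
      (2 powr (s / 2) * weight s \<eta> * (LBINT \<xi>. weight s \<xi> * norm (G \<xi>)))"
    using resolvent_weight_bounds(1)[OF s \<alpha>, of \<eta>]
    by (intro mult_left_mono weighted_shift_integrable(2)[OF s G]) auto
  also have "\<dots> = (resolvent_weight s \<alpha> \<eta> * weight s \<eta>) * (2 powr (s / 2) * (LBINT \<xi>. weight s \<xi> * norm (G \<xi>)))"
    by (simp only: mult_ac)
  finally show "(LBINT \<xi>. norm (schroedinger_kernel s \<alpha> G \<xi> \<eta>))
      \<le> 2 powr (s / 2) * (LBINT \<xi>. weight s \<xi> * norm (G \<xi>)) / (\<alpha> + (norm \<eta>)\<^sup>2)"
    by (simp add: resolvent_weight_bounds(3)[OF s \<alpha>])
qed

lemma measurable_schroedinger_kernel [measurable]: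
  "(\<lambda>(\<xi>, \<eta>). schroedinger_kernel s \<alpha> G \<xi> \<eta>) \<in> borel_measurable (borel \<Otimes>\<^sub>M borel)"
proof -
  note [measurable] = measurable_symbol
  show ?thesis unfolding schroedinger_kernel_def by measurable
qed

lemma kernel_bound_schroedinger_kernel:
  "kernel_bound (schroedinger_kernel s \<alpha> G) (2 powr (s / 2) * (LBINT \<xi>. weight s \<xi> * norm (G \<xi>)) / \<alpha>)"
  unfolding kernel_bound_def
proof (intro conjI allI)
  fix \<eta> :: 'a
  have "2 powr (s / 2) * (LBINT \<xi>. weight s \<xi> * norm (G \<xi>)) / (\<alpha> + (norm \<eta>)\<^sup>2)
      \<le> 2 powr (s / 2) * (LBINT \<xi>. weight s \<xi> * norm (G \<xi>)) / \<alpha>"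
    using \<alpha> by (intro divide_left_mono mult_nonneg_nonneg mult_pos_pos) (auto intro: add_pos_nonneg)
  with schroedinger_kernel_column(2)
  show "(LBINT \<xi>. norm (schroedinger_kernel s \<alpha> G \<xi> \<eta>))
      \<le> 2 powr (s / 2) * (LBINT \<xi>. weight s \<xi> * norm (G \<xi>)) / \<alpha>"
    by (rule order_trans)
qed (use schroedinger_kernel_column(1) measurable_schroedinger_kernel in auto)

text \<open>Freezing \<eta> at \<open>p\<close> only inside \<open>G\<close> leaves a product of a
  function of \<xi> and a function of \<eta>. Translating by \<open>p\<close> turns the error into a
  translation modulus of \<open>G\<close>, at the cost of \<open>weight s p\<close>.\<close>

lemma schroedinger_kernel_column_difference:
  fixes p \<eta> :: 'a
  shows "(LBINT \<xi>. norm (schroedinger_kernel s \<alpha> G \<xi> \<eta> - of_real (weight s \<xi>) * G (\<xi> - p) * of_real (resolvent_weight s \<alpha> \<eta>)))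
    \<le> 1 / \<alpha> * (2 powr (s / 2) * weight s p * (LBINT \<xi>. weight s \<xi> * norm (G (\<xi> - (\<eta> - p)) - G \<xi>)))"
proof -
  let ?H = "\<lambda>\<xi>. G (\<xi> - (\<eta> - p)) - G \<xi>"
  have H: "integrable lborel (\<lambda>\<xi>. of_real (weight s \<xi>) * ?H \<xi>)"
    using Bochner_Integration.integrable_diff[OF weighted_shift_integrable(3)[OF s G, of "\<eta> - p"] G]
    by (simp add: right_diff_distrib)
  have eq: "schroedinger_kernel s \<alpha> G \<xi> \<eta> - of_real (weight s \<xi>) * G (\<xi> - p) * of_real (resolvent_weight s \<alpha> \<eta>)
      = of_real (resolvent_weight s \<alpha> \<eta>) * (of_real (weight s \<xi>) * (G (\<xi> - \<eta>) - G (\<xi> - p)))" for \<xi>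
    by (simp add: schroedinger_kernel_def algebra_simps)
  have "(LBINT \<xi>. norm (schroedinger_kernel s \<alpha> G \<xi> \<eta> - of_real (weight s \<xi>) * G (\<xi> - p) * of_real (resolvent_weight s \<alpha> \<eta>)))
      = resolvent_weight s \<alpha> \<eta> * (LBINT \<xi>. weight s \<xi> * norm (G (\<xi> - \<eta>) - G (\<xi> - p)))"
    unfolding eq using resolvent_weight_bounds(1)[OF s \<alpha>, of \<eta>] by (simp add: norm_mult abs_of_pos)
  also have "(LBINT \<xi>. weight s \<xi> * norm (G (\<xi> - \<eta>) - G (\<xi> - p))) = (LBINT \<xi>. weight s (\<xi> + p) * norm (?H \<xi>))"
    using integral_lborel_shift[of "\<lambda>\<xi>. weight s \<xi> * norm (G (\<xi> - \<eta>) - G (\<xi> - p))" p]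
    by (simp add: algebra_simps)
  also have "resolvent_weight s \<alpha> \<eta> * \<dots> \<le> 1 / \<alpha> * (2 powr (s / 2) * weight s p * (LBINT \<xi>. weight s \<xi> * norm (?H \<xi>)))"
    using \<alpha> by (intro mult_mono resolvent_weight_bounds(2)[OF s] weighted_shift_integrable(2)[OF s H]) auto
  finally show ?thesis .
qed

text \<open>Frequencies \<open>\<eta>\<close> outside a large ball contribute little because of the resolvent factor; the ball is cut
  into small cells on which \<open>\<eta>\<close> is frozen inside \<open>G\<close>, using continuity of translation.\<close>

lemma schroedinger_kernel_finite_rank:
  obtains n :: nat and a b :: "nat \<Rightarrow> 'a \<Rightarrow> complex" and B where
    "\<And>i. integrable lborel (a i)" "\<And>i. b i \<in> borel_measurable borel" "\<And>i \<eta>. norm (b i \<eta>) \<le> B"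
    "kernel_bound (\<lambda>\<xi> \<eta>. schroedinger_kernel s \<alpha> G \<xi> \<eta> - (\<Sum>i<n. a i \<xi> * b i \<eta>)) (1 / 2)"
proof -
  let ?K = "schroedinger_kernel s \<alpha> G"
  define N where "N = 2 powr (s / 2) * (LBINT \<xi>. weight s \<xi> * norm (G \<xi>))"
  have N: "N \<ge> 0" unfolding N_def by (intro mult_nonneg_nonneg) auto
  \<comment> \<open>The summand 1 gives R \<ge> 1, so |\<eta>|^2 \<ge> R outside the ball and the
    column norm there is at most \<open>N / (2 * N + 1)\<close>, below 1/2.\<close>
  define R where "R = 2 * N + 1"
  have R: "R \<ge> 1" using N by (simp add: R_def)
  define Wr where "Wr = (1 + R\<^sup>2) powr (s / 2)"
  have Wr: "Wr > 0" by (simp add: Wr_def add_pos_nonneg less_imp_neq[symmetric])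
  have wWr: "weight s p \<le> Wr" if "norm p \<le> R" for p :: 'a
    unfolding weight_def Wr_def using that s by (intro powr_mono2) (auto intro: power_mono)
  \<comment> \<open>Chosen so that the column difference bound, with \<open>Wr\<close> bounding the
    weight of every centre, comes out as exactly 1/2.\<close>
  define e where "e = \<alpha> / (2 * (2 powr (s / 2) * Wr))"
  have e: "e > 0" using \<alpha> Wr by (simp add: e_def)
  obtain \<delta> where \<delta>: "\<delta> > 0"
    "\<And>h. norm h < \<delta> \<Longrightarrow> (LBINT \<xi>. weight s \<xi> * norm (G (\<xi> - h) - G \<xi>)) < e"
    using weighted_shift_continuous[OF s G e] by blast
  have "seq_compact (cball (0::'a) R)" using compact_cball compact_imp_seq_compact by blast
  from seq_compact_imp_totally_bounded[OF this, rule_format, OF \<delta>(1)]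
  obtain P where P: "finite P" "P \<subseteq> cball (0::'a) R" "cball 0 R \<subseteq> (\<Union>x\<in>P. ball x \<delta>)" by metis
  obtain n and p :: "nat \<Rightarrow> 'a" where p: "P = p ` {i. i < n}"
    using finite_imp_nat_seg_image_inj_on[OF P(1)] by metis
  \<comment> \<open>The covering balls are made disjoint so that for each \<eta> in the large ball
    exactly one summand is nonzero and errors from overlapping cells do not add up.\<close>
  define E where "E i = cball 0 R \<inter> disjointed (\<lambda>i. ball (p i) \<delta>) i" for i
  have [measurable]: "E i \<in> sets borel" for i unfolding E_def disjointed_def by auto
  define a where "a i \<xi> = of_real (weight s \<xi>) * G (\<xi> - p i)" for i \<xi>
  define b where "b i \<eta> = complex_of_real (indicator (E i) \<eta> * resolvent_weight s \<alpha> \<eta>)" for i \<eta>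
  have a: "integrable lborel (a i)" for i
    unfolding a_def by (rule weighted_shift_integrable(3)[OF s G])
  note [measurable] = integrable_lborel_measurable[OF a]
  have b[measurable]: "b i \<in> borel_measurable borel" for i unfolding b_def by measurable
  have bB: "norm (b i \<eta>) \<le> 1 / \<alpha>" for i \<eta>
    using resolvent_weight_bounds[OF s \<alpha>, of \<eta>] \<alpha> by (auto simp: b_def indicator_def norm_mult abs_of_pos)
  have "kernel_bound (\<lambda>\<xi> \<eta>. ?K \<xi> \<eta> - (\<Sum>i<n. a i \<xi> * b i \<eta>)) (1 / 2)"
    unfolding kernel_bound_def
  proof (intro conjI allI)
    show "(\<lambda>(\<xi>, \<eta>). ?K \<xi> \<eta> - (\<Sum>i<n. a i \<xi> * b i \<eta>)) \<in> borel_measurable (borel \<Otimes>\<^sub>M borel)"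
      by measurable
    fix \<eta> :: 'a
    show "integrable lborel (\<lambda>\<xi>. ?K \<xi> \<eta> - (\<Sum>i<n. a i \<xi> * b i \<eta>))"
      using a by (intro Bochner_Integration.integrable_diff schroedinger_kernel_column Bochner_Integration.integrable_sum) auto
    show "(LBINT \<xi>. norm (?K \<xi> \<eta> - (\<Sum>i<n. a i \<xi> * b i \<eta>))) \<le> 1 / 2"
    proof (cases "\<eta> \<in> cball 0 R")
      case False
      then have b0: "b i \<eta> = 0" for i by (simp add: b_def E_def)
      have "(LBINT \<xi>. norm (?K \<xi> \<eta> - (\<Sum>i<n. a i \<xi> * b i \<eta>))) \<le> N / (\<alpha> + (norm \<eta>)\<^sup>2)"
        using schroedinger_kernel_column(2)[of \<eta>] by (simp add: b0 N_def)
      also have "\<dots> \<le> N / (2 * N + 1)"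
      proof (rule divide_left_mono[OF _ N])
        have "R \<le> norm \<eta>" using False by simp
        then have "R * 1 \<le> norm \<eta> * norm \<eta>" using R by (intro mult_mono) auto
        then show "2 * N + 1 \<le> \<alpha> + (norm \<eta>)\<^sup>2" using \<alpha> by (simp add: R_def power2_eq_square)
        then show "0 < (\<alpha> + (norm \<eta>)\<^sup>2) * (2 * N + 1)" using N by (intro mult_pos_pos) auto
      qed
      also have "\<dots> \<le> 1 / 2" using N by (simp add: field_simps)
      finally show ?thesis .
    next
      case True
      then obtain x where "x \<in> P" "\<eta> \<in> ball x \<delta>" using P(3) by (meson UN_E subsetD)
      then have "\<eta> \<in> (\<Union>i\<in>{0..<n}. ball (p i) \<delta>)" unfolding p by auto
      then have "\<eta> \<in> (\<Union>i\<in>{0..<n}. disjointed (\<lambda>i. ball (p i) \<delta>) i)"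
        by (simp only: finite_UN_disjointed_eq)
      then obtain j where j: "j < n" "\<eta> \<in> disjointed (\<lambda>i. ball (p i) \<delta>) j"
        by auto
      have bj: "b i \<eta> = (if i = j then complex_of_real (resolvent_weight s \<alpha> \<eta>) else 0)" for i
      proof (cases "i = j")
        case True
        then show ?thesis using j \<open>\<eta> \<in> cball 0 R\<close> by (simp add: b_def E_def)
      next
        case False
        then have "\<eta> \<notin> disjointed (\<lambda>i. ball (p i) \<delta>) i"
          using disjoint_family_disjointed[of "\<lambda>i. ball (p i) \<delta>"] j(2) unfolding disjoint_family_on_def by blast
        then show ?thesis using False by (simp add: b_def E_def)
      qed
      have near: "norm (\<eta> - p j) < \<delta>"
        using j(2) disjointed_subset[of "\<lambda>i. ball (p i) \<delta>" j] by (auto simp: dist_norm norm_minus_commute)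
      have pj: "norm (p j) \<le> R" using P(2) p j(1) by auto
      have "(\<Sum>i<n. a i \<xi> * b i \<eta>) = of_real (weight s \<xi>) * G (\<xi> - p j) * of_real (resolvent_weight s \<alpha> \<eta>)" for \<xi>
        using j(1) by (simp add: bj a_def if_distrib[of "\<lambda>z. _ * z"] cong: if_cong)
      then have "(LBINT \<xi>. norm (?K \<xi> \<eta> - (\<Sum>i<n. a i \<xi> * b i \<eta>)))
         \<le> 1 / \<alpha> * (2 powr (s / 2) * weight s (p j) * (LBINT \<xi>. weight s \<xi> * norm (G (\<xi> - (\<eta> - p j)) - G \<xi>)))"
        using schroedinger_kernel_column_difference[of \<eta> "p j"] by simp
      also have "\<dots> \<le> 1 / \<alpha> * (2 powr (s / 2) * Wr * e)"
        using \<alpha> Wr by (intro mult_left_mono mult_mono wWr pj less_imp_le[OF \<delta>(2)[OF near]]) auto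
      also have "\<dots> = 1 / 2" using \<alpha> Wr by (simp add: e_def)
      finally show ?thesis .
    qed
  qed
  then show ?thesis by (rule that[OF a b bB])
qed

end

section \<open>Convolution and products of inverse transforms\<close>

lemma kernel_bound_convolution:
  fixes G :: "'a::euclidean_space \<Rightarrow> complex"
  assumes G: "integrable lborel G"
  shows "kernel_bound (\<lambda>\<xi> \<eta>. G (\<xi> - \<eta>)) (LBINT \<xi>. norm (G \<xi>))"
proof -
  note [measurable] = integrable_lborel_measurable[OF G]
  have "integrable lborel (\<lambda>\<xi>. G (\<xi> - \<eta>))" for \<eta>
    using G integrable_lborel_shift[of G "- \<eta>"] by simp
  moreover have "(LBINT \<xi>. norm (G (\<xi> - \<eta>))) = (LBINT \<xi>. norm (G \<xi>))" for \<eta>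
    using integral_lborel_shift[of "\<lambda>\<xi>. norm (G \<xi>)" "- \<eta>"] by simp
  ultimately show ?thesis by (simp add: kernel_bound_def)
qed

text \<open>Fubini reduces the claim to translating the inner integral, which pulls out the
  character at \<eta>. This identifies the potential term of the equation with a convolution of
  transforms.\<close>

lemma ift_convolution:
  fixes G U :: "'a::euclidean_space \<Rightarrow> complex"
  assumes G: "integrable lborel G" and U: "integrable lborel U"
  shows "ift (kernel_op (\<lambda>\<xi> \<eta>. G (\<xi> - \<eta>)) U) x = ift G x * ift U x"
proof -
  have shift: "(LBINT \<xi>. G (\<xi> - \<eta>) * cis (x \<bullet> \<xi>)) = cis (x \<bullet> \<eta>) * ift G x" for \<eta>
  proof -
    have "(LBINT \<xi>. G (\<xi> - \<eta>) * cis (x \<bullet> \<xi>)) = (LBINT \<xi>. G \<xi> * cis (x \<bullet> (\<xi> + \<eta>)))"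
      using integral_lborel_shift[of "\<lambda>\<xi>. G (\<xi> - \<eta>) * cis (x \<bullet> \<xi>)" \<eta>] by simp
    also have "\<dots> = (LBINT \<xi>. cis (x \<bullet> \<eta>) * (G \<xi> * cis (x \<bullet> \<xi>)))"
      by (simp add: inner_add_right mult_ac flip: cis_mult)
    finally show ?thesis by (simp add: ift_def)
  qed
  have "ift (kernel_op (\<lambda>\<xi> \<eta>. G (\<xi> - \<eta>)) U) x = (LBINT \<eta>. U \<eta> * (LBINT \<xi>. G (\<xi> - \<eta>) * cis (x \<bullet> \<xi>)))"
    unfolding ift_def by (rule integral_kernel_op_mult[OF kernel_bound_convolution[OF G] U, where B=1]) auto
  also have "\<dots> = (LBINT \<eta>. U \<eta> * cis (x \<bullet> \<eta>)) * ift G x"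
    unfolding shift by (simp flip: mult.assoc)
  finally show ?thesis by (simp add: ift_def mult.commute)
qed

section \<open>Second differences and the maximum principle\<close>

lemma second_difference_cis:
  "cis (c + y) + cis (c - y) - 2 * cis c = - of_real ((2 * sin (y / 2))\<^sup>2) * cis c"
proof -
  have "cis (c + y) + cis (c - y) - 2 * cis c = of_real (2 * cos y - 2) * cis c"
    by (simp add: complex_eq_iff cos_add sin_add cos_diff sin_diff algebra_simps)
  also have "2 * cos y - 2 = - ((2 * sin (y / 2))\<^sup>2)"
    using cos_double_sin[of "y / 2"] by (simp add: power_mult_distrib)
  finally show ?thesis by simp
qed

text \<open>On the transform side the difference quotient multiplies \<open>U\<close> by an explicit
  squared sine factor. By |sin x| \<le> |x| this factor is at most |\<xi>|^2 in modulus, so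
  |\<xi>|^2 |U| dominates and the limit may be taken under the integral.\<close>

lemma ift_second_difference_tendsto:
  fixes U :: "'a::euclidean_space \<Rightarrow> complex"
  assumes U: "integrable lborel U" "integrable lborel (\<lambda>\<xi>. of_real ((norm \<xi>)\<^sup>2) * U \<xi>)" and b: "b \<in> Basis"
  shows "(\<lambda>n. (ift U (x + (1 / real (Suc n)) *\<^sub>R b) + ift U (x - (1 / real (Suc n)) *\<^sub>R b) - 2 * ift U x) * of_real ((real (Suc n))\<^sup>2))
    \<longlonglongrightarrow> - ift (\<lambda>\<xi>. of_real ((\<xi> \<bullet> b)\<^sup>2) * U \<xi>) x"
proof -
  note [measurable] = integrable_lborel_measurable[OF U(1)]
  let ?r = "\<lambda>n. real (Suc n)"
  let ?q = "\<lambda>n \<xi>. (2 * sin ((\<xi> \<bullet> b) * (1 / ?r n) / 2) * ?r n)\<^sup>2"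
  have eq: "(ift U (x + (1 / ?r n) *\<^sub>R b) + ift U (x - (1 / ?r n) *\<^sub>R b) - 2 * ift U x) * of_real ((?r n)\<^sup>2)
     = (LBINT \<xi>. - of_real (?q n \<xi>) * U \<xi> * cis (x \<bullet> \<xi>))" for n
  proof -
    let ?t = "1 / ?r n"
    note i = integrable_cis[OF U(1)]
    have "ift U (x + ?t *\<^sub>R b) + ift U (x - ?t *\<^sub>R b) - 2 * ift U x
      = (LBINT \<xi>. U \<xi> * cis ((x + ?t *\<^sub>R b) \<bullet> \<xi>) + U \<xi> * cis ((x - ?t *\<^sub>R b) \<bullet> \<xi>) - 2 * (U \<xi> * cis (x \<bullet> \<xi>)))"
      unfolding ift_def using i[of "x + ?t *\<^sub>R b"] i[of "x - ?t *\<^sub>R b"] i[of x] by simp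
    also have "\<dots> = (LBINT \<xi>. U \<xi> * (- of_real ((2 * sin ((\<xi> \<bullet> b) * ?t / 2))\<^sup>2) * cis (x \<bullet> \<xi>)))"
    proof (rule Bochner_Integration.integral_cong[OF refl])
      fix \<xi>
      have "U \<xi> * cis ((x + ?t *\<^sub>R b) \<bullet> \<xi>) + U \<xi> * cis ((x - ?t *\<^sub>R b) \<bullet> \<xi>) - 2 * (U \<xi> * cis (x \<bullet> \<xi>))
        = U \<xi> * (cis (x \<bullet> \<xi> + (\<xi> \<bullet> b) * ?t) + cis (x \<bullet> \<xi> - (\<xi> \<bullet> b) * ?t) - 2 * cis (x \<bullet> \<xi>))"
        by (simp add: inner_add_left inner_diff_left inner_commute[of b \<xi>] algebra_simps)
      then show "U \<xi> * cis ((x + ?t *\<^sub>R b) \<bullet> \<xi>) + U \<xi> * cis ((x - ?t *\<^sub>R b) \<bullet> \<xi>) - 2 * (U \<xi> * cis (x \<bullet> \<xi>))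
        = U \<xi> * (- of_real ((2 * sin ((\<xi> \<bullet> b) * ?t / 2))\<^sup>2) * cis (x \<bullet> \<xi>))"
        by (simp only: second_difference_cis)
    qed
    finally have "(ift U (x + ?t *\<^sub>R b) + ift U (x - ?t *\<^sub>R b) - 2 * ift U x) * of_real ((?r n)\<^sup>2)
      = (LBINT \<xi>. U \<xi> * (- of_real ((2 * sin ((\<xi> \<bullet> b) * ?t / 2))\<^sup>2) * cis (x \<bullet> \<xi>)) * of_real ((?r n)\<^sup>2))"
      by simp
    also have "\<dots> = (LBINT \<xi>. - of_real (?q n \<xi>) * U \<xi> * cis (x \<bullet> \<xi>))"
      by (simp only: power_mult_distrib of_real_mult mult_minus_left mult_minus_right mult_ac)
    finally show ?thesis .
  qed
  have sin_lim: "(\<lambda>n. 2 * sin (c * (1 / ?r n) / 2) * ?r n) \<longlonglongrightarrow> c" for c :: real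
  proof -
    have "((\<lambda>t. 2 * sin (c * t / 2)) has_real_derivative c) (at 0)"
      by (auto intro!: derivative_eq_intros)
    then have "((\<lambda>t. 2 * sin (c * t / 2) / t) \<longlongrightarrow> c) (at 0)"
      by (simp add: has_field_derivative_iff)
    moreover have "filterlim (\<lambda>n. 1 / ?r n) (at 0) sequentially"
      using LIMSEQ_inverse_real_of_nat by (simp add: filterlim_at inverse_eq_divide)
    ultimately have "(\<lambda>n. 2 * sin (c * (1 / ?r n) / 2) / (1 / ?r n)) \<longlonglongrightarrow> c"
      by (rule filterlim_compose)
    then show ?thesis by simp
  qed
  have q_le: "?q n \<xi> \<le> (norm \<xi>)\<^sup>2" for n \<xi>
  proof -
    have cancel: "2 * \<bar>c * (1 / r) / 2\<bar> * r = \<bar>c\<bar>" if "r > 0" for c r :: real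
      using that by (simp add: abs_mult)
    have "\<bar>2 * sin ((\<xi> \<bullet> b) * (1 / ?r n) / 2) * ?r n\<bar> \<le> 2 * \<bar>(\<xi> \<bullet> b) * (1 / ?r n) / 2\<bar> * ?r n"
      unfolding abs_mult using abs_sin_x_le_abs_x[of "(\<xi> \<bullet> b) * (1 / ?r n) / 2"] by (intro mult_mono) (auto simp: abs_mult)
    also have "\<dots> = \<bar>\<xi> \<bullet> b\<bar>" by (rule cancel) simp
    also have "\<dots> \<le> \<bar>norm \<xi>\<bar>" using Basis_le_norm[OF b] by simp
    finally show ?thesis by (simp only: abs_le_square_iff)
  qed
  have "(\<lambda>n. LBINT \<xi>. - of_real (?q n \<xi>) * U \<xi> * cis (x \<bullet> \<xi>))
    \<longlonglongrightarrow> (LBINT \<xi>. - of_real ((\<xi> \<bullet> b)\<^sup>2) * U \<xi> * cis (x \<bullet> \<xi>))"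
  proof (rule integral_dominated_convergence[where w="\<lambda>\<xi>. norm (of_real ((norm \<xi>)\<^sup>2) * U \<xi>)"])
    show "integrable lborel (\<lambda>\<xi>. norm (of_real ((norm \<xi>)\<^sup>2) * U \<xi>))"
      by (rule integrable_norm[OF U(2)])
    show "AE \<xi> in lborel. (\<lambda>n. - of_real (?q n \<xi>) * U \<xi> * cis (x \<bullet> \<xi>)) \<longlonglongrightarrow> - of_real ((\<xi> \<bullet> b)\<^sup>2) * U \<xi> * cis (x \<bullet> \<xi>)"
      by (intro AE_I2 tendsto_mult tendsto_const tendsto_minus tendsto_of_real tendsto_power sin_lim)
    show "AE \<xi> in lborel. norm (- of_real (?q n \<xi>) * U \<xi> * cis (x \<bullet> \<xi>)) \<le> norm (of_real ((norm \<xi>)\<^sup>2) * U \<xi>)" for n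
    proof (rule AE_I2)
      fix \<xi>
      have "norm (- of_real (?q n \<xi>) * U \<xi> * cis (x \<bullet> \<xi>)) = ?q n \<xi> * norm (U \<xi>)"
        unfolding norm_mult norm_minus_cancel norm_of_real norm_cis by simp
      also have "\<dots> \<le> (norm \<xi>)\<^sup>2 * norm (U \<xi>)" by (rule mult_right_mono[OF q_le]) simp
      finally show "norm (- of_real (?q n \<xi>) * U \<xi> * cis (x \<bullet> \<xi>)) \<le> norm (of_real ((norm \<xi>)\<^sup>2) * U \<xi>)"
        by (simp add: norm_mult norm_power)
    qed
  qed measurable
  then show ?thesis
    unfolding eq by (simp add: ift_def)
qed

text \<open>If \<open>u = Re (ift U)\<close> were positive somewhere, then, as \<open>u\<close> vanishes at
  infinity, \<open>u + \<epsilon> |x|\<^sup>2\<close> would have an interior maximum on a large ball for small \<open>\<epsilon>\<close>, at a point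
  where \<open>u > 0\<close>; there \<open>\<Delta>u \<le> - 2 d \<epsilon> < 0\<close>, contradicting \<open>\<Delta>u = V u \<ge> 0\<close>.\<close>

lemma maximum_principle:
  fixes U :: "'a::euclidean_space \<Rightarrow> complex" and V :: "'a \<Rightarrow> real"
  assumes U: "integrable lborel U" "integrable lborel (\<lambda>\<xi>. of_real ((norm \<xi>)\<^sup>2) * U \<xi>)"
    and V: "\<And>x. V x \<ge> 0"
    and eq: "\<And>x. Re (ift (\<lambda>\<xi>. of_real ((norm \<xi>)\<^sup>2) * U \<xi>) x) + V x * Re (ift U x) = 0"
  shows "Re (ift U x0) \<le> 0"
proof (rule ccontr)
  define u where "u x = Re (ift U x)" for x
  assume "\<not> Re (ift U x0) \<le> 0"
  then have pos: "u x0 > 0" by (simp add: u_def)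
  define m where "m = u x0"
  obtain R0 where R0: "\<And>x. norm x \<ge> R0 \<Longrightarrow> norm (ift U x) < m / 2"
    using riemann_lebesgue[OF U(1), of "m / 2"] pos by (auto simp: m_def)
  \<comment> \<open>The ball contains \<open>x0\<close>, and on its sphere \<open>ift U\<close> is
    already below \<open>m / 2\<close> in modulus; the summand 1 keeps the radius positive.\<close>
  define R where "R = max R0 (norm x0 + 1)"
  have R: "norm x0 < R" "R0 \<le> R" "R > 0" using norm_ge_zero[of x0] by (auto simp: R_def simp del: norm_ge_zero)
  \<comment> \<open>The perturbation is at most m/4 on the ball. On the sphere \<open>v\<close>
    therefore stays below 3m/4, less than its value at \<open>x0\<close>, so the maximum is
    interior; at it, \<open>u\<close> is at least 3m/4.\<close>
  define \<epsilon> where "\<epsilon> = m / (4 * R\<^sup>2)"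
  have \<epsilon>: "\<epsilon> > 0" "\<epsilon> * R\<^sup>2 = m / 4" using pos R by (simp_all add: \<epsilon>_def m_def)
  define v where "v x = u x + \<epsilon> * (norm x)\<^sup>2" for x
  have "continuous_on UNIV v"
    unfolding v_def u_def by (intro continuous_intros continuous_ift U)
  then have "continuous_on (cball 0 R) v" using continuous_on_subset by blast
  moreover have "cball (0::'a) R \<noteq> {}" using R by auto
  ultimately obtain x1 where x1: "norm x1 \<le> R" "\<And>y. norm y \<le> R \<Longrightarrow> v y \<le> v x1"
    using continuous_attains_sup[OF compact_cball] by (metis mem_cball_0)
  have v1: "v x1 \<ge> m"
  proof -
    have "m \<le> v x0" using \<epsilon>(1) by (simp add: v_def m_def)
    also have "\<dots> \<le> v x1" using R by (intro x1) simp
    finally show ?thesis .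
  qed
  have sq: "\<epsilon> * (norm x1)\<^sup>2 \<le> m / 4"
  proof -
    have "\<epsilon> * (norm x1)\<^sup>2 \<le> \<epsilon> * R\<^sup>2" using x1(1) \<epsilon>(1) by (intro mult_left_mono power_mono) auto
    then show ?thesis using \<epsilon> by simp
  qed
  have u1: "u x1 > 0" using v1 sq pos by (simp add: v_def m_def)
  have "norm x1 < R"
  proof (rule ccontr)
    assume "\<not> norm x1 < R"
    then have "u x1 < m / 2"
      using R0[of x1] R complex_Re_le_cmod[of "ift U x1"] by (simp add: u_def)
    then show False using v1 sq pos by (simp add: v_def m_def)
  qed
  then obtain N where N: "1 / real (Suc N) < R - norm x1"
    using reals_Archimedean[of "R - norm x1"] by (auto simp: inverse_eq_divide)
  have direction: "2 * \<epsilon> \<le> Re (ift (\<lambda>\<xi>. of_real ((\<xi> \<bullet> b)\<^sup>2) * U \<xi>) x1)" if b: "b \<in> Basis" for b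
  proof -
    let ?d = "\<lambda>n. (ift U (x1 + (1 / real (Suc n)) *\<^sub>R b) + ift U (x1 - (1 / real (Suc n)) *\<^sub>R b) - 2 * ift U x1) * of_real ((real (Suc n))\<^sup>2)"
    have "(\<lambda>n. Re (?d n)) \<longlonglongrightarrow> Re (- ift (\<lambda>\<xi>. of_real ((\<xi> \<bullet> b)\<^sup>2) * U \<xi>) x1)"
      by (intro tendsto_Re ift_second_difference_tendsto U b)
    moreover have "Re (?d n) \<le> - 2 * \<epsilon>" if n: "n \<ge> N" for n
    proof -
      define t where "t = 1 / real (Suc n)"
      have t: "t > 0" "t * real (Suc n) = 1" by (simp_all add: t_def)
      have tN: "t \<le> 1 / real (Suc N)" unfolding t_def using n by (intro divide_left_mono) auto
      have "norm (x1 + t *\<^sub>R b) \<le> R" "norm (x1 - t *\<^sub>R b) \<le> R"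
        using norm_triangle_ineq[of x1 "t *\<^sub>R b"] norm_triangle_ineq4[of x1 "t *\<^sub>R b"] t tN N b by auto
      then have "v (x1 + t *\<^sub>R b) \<le> v x1" "v (x1 - t *\<^sub>R b) \<le> v x1" by (auto intro: x1)
      \<comment> \<open>By the parallelogram law the second difference of the quadratic perturbation
        is exactly \<open>2 * \<epsilon> * t\<^sup>2\<close>, so at the maximum of \<open>v\<close>
        that of \<open>u\<close> is at most the negative of this.\<close>
      moreover have par: "(norm (x1 + t *\<^sub>R b))\<^sup>2 + (norm (x1 - t *\<^sub>R b))\<^sup>2 = 2 * (norm x1)\<^sup>2 + 2 * t\<^sup>2"
      proof -
        have "(norm (x1 + y))\<^sup>2 + (norm (x1 - y))\<^sup>2 = 2 * (norm x1)\<^sup>2 + 2 * (norm y)\<^sup>2" for y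
          unfolding power2_norm_eq_inner
          by (simp add: inner_add_left inner_add_right inner_diff_left inner_diff_right inner_commute)
        from this[of "t *\<^sub>R b"] b show ?thesis by simp
      qed
      have "\<epsilon> * (norm (x1 + t *\<^sub>R b))\<^sup>2 + \<epsilon> * (norm (x1 - t *\<^sub>R b))\<^sup>2 = \<epsilon> * (2 * (norm x1)\<^sup>2 + 2 * t\<^sup>2)"
        by (simp only: par distrib_left[symmetric])
      then have "\<epsilon> * (norm (x1 + t *\<^sub>R b))\<^sup>2 + \<epsilon> * (norm (x1 - t *\<^sub>R b))\<^sup>2 = 2 * (\<epsilon> * (norm x1)\<^sup>2) + 2 * \<epsilon> * t\<^sup>2"
        by (simp only: distrib_left mult.assoc mult.left_commute[of \<epsilon>])
      ultimately have "u (x1 + t *\<^sub>R b) + u (x1 - t *\<^sub>R b) - 2 * u x1 \<le> - 2 * \<epsilon> * t\<^sup>2"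
        unfolding v_def by linarith
      then have "(u (x1 + t *\<^sub>R b) + u (x1 - t *\<^sub>R b) - 2 * u x1) * (real (Suc n))\<^sup>2 \<le> - 2 * \<epsilon> * t\<^sup>2 * (real (Suc n))\<^sup>2"
        by (rule mult_right_mono) simp
      also have "- 2 * \<epsilon> * t\<^sup>2 * (real (Suc n))\<^sup>2 = - 2 * \<epsilon> * (t * real (Suc n))\<^sup>2"
        by (simp only: power_mult_distrib mult.assoc)
      finally have "(u (x1 + t *\<^sub>R b) + u (x1 - t *\<^sub>R b) - 2 * u x1) * (real (Suc n))\<^sup>2 \<le> - 2 * \<epsilon>"
        by (simp only: t(2) power_one mult_1_right)
      then show ?thesis
        unfolding u_def t_def[symmetric] by (simp only: times_complex.sel Re_complex_of_real Im_complex_of_real minus_complex.sel plus_complex.sel) simp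
    qed
    ultimately have "Re (- ift (\<lambda>\<xi>. of_real ((\<xi> \<bullet> b)\<^sup>2) * U \<xi>) x1) \<le> - 2 * \<epsilon>"
      by (intro LIMSEQ_le_const2) auto
    then show ?thesis by simp
  qed
  note [measurable] = integrable_lborel_measurable[OF U(1)]
  have ib: "integrable lborel (\<lambda>\<xi>. of_real ((\<xi> \<bullet> b)\<^sup>2) * U \<xi>)" if b: "b \<in> Basis" for b
  proof (rule Bochner_Integration.integrable_bound[OF U(2)])
    have "(\<xi> \<bullet> b)\<^sup>2 \<le> (norm \<xi>)\<^sup>2" for \<xi>
      using Basis_le_norm[OF b, of \<xi>] by (simp add: abs_le_square_iff[symmetric])
    then show "AE \<xi> in lborel. norm (of_real ((\<xi> \<bullet> b)\<^sup>2) * U \<xi>) \<le> norm (of_real ((norm \<xi>)\<^sup>2) * U \<xi>)"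
      unfolding norm_mult norm_of_real by (intro AE_I2 mult_right_mono) auto
  qed measurable
  have "ift (\<lambda>\<xi>. of_real ((norm \<xi>)\<^sup>2) * U \<xi>) x1 = (\<Sum>b\<in>Basis. ift (\<lambda>\<xi>. of_real ((\<xi> \<bullet> b)\<^sup>2) * U \<xi>) x1)"
  proof -
      have "ift (\<lambda>\<xi>. of_real ((norm \<xi>)\<^sup>2) * U \<xi>) x1 = (LBINT \<xi>. (\<Sum>b\<in>Basis. of_real ((\<xi> \<bullet> b)\<^sup>2) * U \<xi> * cis (x1 \<bullet> \<xi>)))"
      unfolding ift_def norm_square_eq_sum by (simp add: sum_distrib_right)
    also have "\<dots> = (\<Sum>b\<in>Basis. ift (\<lambda>\<xi>. of_real ((\<xi> \<bullet> b)\<^sup>2) * U \<xi>) x1)"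
      unfolding ift_def by (intro Bochner_Integration.integral_sum integrable_cis ib)
    finally show ?thesis .
  qed
  then have "Re (ift (\<lambda>\<xi>. of_real ((norm \<xi>)\<^sup>2) * U \<xi>) x1) \<ge> (\<Sum>b\<in>(Basis :: 'a set). 2 * \<epsilon>)"
    using direction by (simp only: Re_sum) (intro sum_mono)
  moreover have "(\<Sum>b\<in>(Basis :: 'a set). 2 * \<epsilon>) > 0" using \<epsilon> by simp
  moreover have "V x1 * Re (ift U x1) \<ge> 0" using V u1 by (simp add: u_def)
  ultimately show False using eq[of x1] by linarith
qed

lemma ift_cmult: "ift (\<lambda>\<xi>. c * U \<xi>) x = c * ift U x"
  by (simp add: ift_def mult.assoc)

text \<open>The homogeneous equation is linear, so the one-sided bound also applies to
  \<open>- U\<close>.\<close>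

lemma maximum_principle_Re:
  fixes U :: "'a::euclidean_space \<Rightarrow> complex" and V :: "'a \<Rightarrow> real"
  assumes U: "integrable lborel U" "integrable lborel (\<lambda>\<xi>. of_real ((norm \<xi>)\<^sup>2) * U \<xi>)"
    and V: "\<And>x. V x \<ge> 0"
    and eq: "\<And>x. Re (ift (\<lambda>\<xi>. of_real ((norm \<xi>)\<^sup>2) * U \<xi>) x) + V x * Re (ift U x) = 0"
  shows "Re (ift U x) = 0"
proof -
  have m: "ift (\<lambda>\<xi>. - U \<xi>) y = - ift U y" "ift (\<lambda>\<xi>. of_real ((norm \<xi>)\<^sup>2) * - U \<xi>) y = - ift (\<lambda>\<xi>. of_real ((norm \<xi>)\<^sup>2) * U \<xi>) y" for y
    by (simp_all add: ift_def)
  have "Re (ift (\<lambda>\<xi>. - U \<xi>) x) \<le> 0"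
  proof (rule maximum_principle[OF _ _ V])
    show "Re (ift (\<lambda>\<xi>. of_real ((norm \<xi>)\<^sup>2) * - U \<xi>) y) + V y * Re (ift (\<lambda>\<xi>. - U \<xi>) y) = 0" for y
      unfolding m using eq[of y] by simp
  qed (use U in auto)
  then show ?thesis
    using maximum_principle[OF U V eq, of x] by (simp add: m)
qed

text \<open>Multiplication by \<i> turns imaginary parts into real parts up to sign. Only the
  imaginary part of the equation is assumed homogeneous, which is what a real right-hand side
  provides.\<close>

lemma maximum_principle_Im:
  fixes U :: "'a::euclidean_space \<Rightarrow> complex" and V :: "'a \<Rightarrow> real"
  assumes U: "integrable lborel U" "integrable lborel (\<lambda>\<xi>. of_real ((norm \<xi>)\<^sup>2) * U \<xi>)"
    and V: "\<And>x. V x \<ge> 0"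
    and eq: "\<And>x. Im (ift (\<lambda>\<xi>. of_real ((norm \<xi>)\<^sup>2) * U \<xi>) x) + V x * Im (ift U x) = 0"
  shows "Im (ift U x) = 0"
proof -
  have m: "ift (\<lambda>\<xi>. of_real ((norm \<xi>)\<^sup>2) * (\<i> * U \<xi>)) y = \<i> * ift (\<lambda>\<xi>. of_real ((norm \<xi>)\<^sup>2) * U \<xi>) y" for y
    unfolding ift_cmult[symmetric] by (simp add: mult.left_commute)
  have "Re (ift (\<lambda>\<xi>. \<i> * U \<xi>) x) = 0"
  proof (rule maximum_principle_Re[OF _ _ V])
    show "Re (ift (\<lambda>\<xi>. of_real ((norm \<xi>)\<^sup>2) * (\<i> * U \<xi>)) y) + V y * Re (ift (\<lambda>\<xi>. \<i> * U \<xi>) y) = 0" for y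
      unfolding m ift_cmult using eq[of y] by simp
    show "integrable lborel (\<lambda>\<xi>. of_real ((norm \<xi>)\<^sup>2) * (\<i> * U \<xi>))"
      using integrable_mult_right[OF U(2), of "\<i>"] by (simp add: mult.left_commute)
  qed (use U in auto)
  then show ?thesis by (simp add: ift_cmult)
qed

section \<open>Solvability and uniqueness in spectral Barron spaces\<close>

lemma integrable_norm_square_of_weight:
  fixes U :: "'a::euclidean_space \<Rightarrow> complex"
  assumes s: "s \<ge> 0" and U: "integrable lborel (\<lambda>\<xi>. of_real (weight (s + 2) \<xi>) * U \<xi>)"
  shows "integrable lborel (\<lambda>\<xi>. of_real ((norm \<xi>)\<^sup>2) * U \<xi>)"
proof (rule Bochner_Integration.integrable_bound[OF U])
  have iU: "integrable lborel U" using s by (intro integrable_of_weight[OF _ U]) auto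
  note [measurable] = integrable_lborel_measurable[OF iU]
  show "(\<lambda>\<xi>. of_real ((norm \<xi>)\<^sup>2) * U \<xi>) \<in> borel_measurable lborel" by measurable
  have "(norm \<xi>)\<^sup>2 \<le> weight (s + 2) \<xi>" for \<xi> :: 'a
  proof -
    have "(norm \<xi>)\<^sup>2 \<le> (1 + (norm \<xi>)\<^sup>2) powr 1" by simp
    also have "\<dots> \<le> (1 + (norm \<xi>)\<^sup>2) powr ((s + 2) / 2)"
      using s by (intro powr_mono) auto
    finally show ?thesis by (simp add: weight_def)
  qed
  then show "AE \<xi> in lborel. norm (of_real ((norm \<xi>)\<^sup>2) * U \<xi>) \<le> norm (of_real (weight (s + 2) \<xi>) * U \<xi>)"
    unfolding norm_mult norm_of_real by (intro AE_I2 mult_right_mono) auto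
qed

lemma ift_add:
  assumes "integrable lborel F" "integrable lborel (G :: 'a::euclidean_space \<Rightarrow> complex)"
  shows "ift (\<lambda>\<xi>. F \<xi> + G \<xi>) x = ift F x + ift G x"
  using integrable_cis[OF assms(1), of x] integrable_cis[OF assms(2), of x]
  by (simp add: ift_def distrib_right)

lemma ift_cong_AE:
  assumes F: "integrable lborel F" and G: "integrable lborel (G :: 'a::euclidean_space \<Rightarrow> complex)"
    and eq: "AE \<xi> in lborel. F \<xi> = G \<xi>"
  shows "ift F x = ift G x"
proof -
  have [measurable]: "F \<in> borel_measurable borel" "G \<in> borel_measurable borel"
    using F G borel_measurable_integrable[of lborel] by auto
  show ?thesis
    unfolding ift_def by (rule integral_cong_AE) (use eq in auto)
qed

context
  fixes s \<alpha> :: real and V W :: "'a::euclidean_space \<Rightarrow> real" and G :: "'a \<Rightarrow> complex"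
  assumes s: "s \<ge> 0" and \<alpha>: "\<alpha> > 0" and G: "integrable lborel (\<lambda>\<xi>. of_real (weight s \<xi>) * G \<xi>)"
    and V: "\<And>x. V x = \<alpha> + W x" and W: "\<And>x. of_real (W x) = ift G x" and V0: "\<And>x. V x \<ge> 0"
begin

text \<open>The unknown \<open>w\<close> of the integral equation is \<open>weight s \<xi> * (\<alpha> + |\<xi>|\<^sup>2)\<close> times the Fourier
  transform of the solution.\<close>

lemma integral_equation_solution:
  assumes w: "integrable lborel w" and F: "integrable lborel (\<lambda>\<xi>. of_real (weight s \<xi>) * F \<xi>)"
    and eq: "AE \<xi> in lborel. w \<xi> + kernel_op (schroedinger_kernel s \<alpha> G) w \<xi> = of_real (weight s \<xi>) * F \<xi>"
    and U_def: "U = (\<lambda>\<xi>. of_real (resolvent_weight s \<alpha> \<xi>) * w \<xi>)"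
  shows "integrable lborel (\<lambda>\<xi>. of_real (weight (s + 2) \<xi>) * U \<xi>)"
    and "(LBINT \<xi>. norm (of_real (weight (s + 2) \<xi>) * U \<xi>)) \<le> max 1 (1 / \<alpha>) * (LBINT \<xi>. norm (w \<xi>))"
    and "ift (\<lambda>\<xi>. of_real ((norm \<xi>)\<^sup>2) * U \<xi>) x + of_real (V x) * ift U x = ift F x"
proof -
  note [measurable] = integrable_lborel_measurable[OF w]
  have pos: "0 < \<alpha> + (norm \<xi>)\<^sup>2" for \<xi> :: 'a using \<alpha> by (simp add: add_pos_nonneg)
  have le: "norm (of_real (weight (s + 2) \<xi>) * U \<xi>) \<le> max 1 (1 / \<alpha>) * norm (w \<xi>)" for \<xi>
  proof -
    have "weight (s + 2) \<xi> = weight s \<xi> * (1 + (norm \<xi>)\<^sup>2)"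
    proof -
      have e: "(s + 2) / 2 = s / 2 + 1" by simp
      have "0 \<le> 1 + (norm \<xi>)\<^sup>2" by simp
      then show ?thesis unfolding weight_def e powr_add by simp
    qed
    then have eq: "weight (s + 2) \<xi> * resolvent_weight s \<alpha> \<xi> = (1 + (norm \<xi>)\<^sup>2) / (\<alpha> + (norm \<xi>)\<^sup>2)"
      by (simp add: resolvent_weight_def)
    \<comment> \<open>The constant bounds (1 + r) / (\<alpha> + r) for all r \<ge> 0. This is the
      gain of two orders: the extra weight is absorbed by the resolvent factor.\<close>
    have "1 \<le> max 1 (1 / \<alpha>) * \<alpha>"
      using \<alpha> by (simp add: max_def field_simps)
    then have "1 + (norm \<xi>)\<^sup>2 \<le> max 1 (1 / \<alpha>) * \<alpha> + max 1 (1 / \<alpha>) * (norm \<xi>)\<^sup>2"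
      using mult_right_mono[of 1 "max 1 (1 / \<alpha>)" "(norm \<xi>)\<^sup>2"] by simp
    then have "(1 + (norm \<xi>)\<^sup>2) / (\<alpha> + (norm \<xi>)\<^sup>2) \<le> max 1 (1 / \<alpha>)"
      using pos[of \<xi>] by (simp add: pos_divide_le_eq distrib_left)
    then have "weight (s + 2) \<xi> * resolvent_weight s \<alpha> \<xi> * norm (w \<xi>) \<le> max 1 (1 / \<alpha>) * norm (w \<xi>)"
      unfolding eq by (rule mult_right_mono) simp
    then show ?thesis
      using resolvent_weight_bounds(1)[OF s \<alpha>, of \<xi>] by (simp add: U_def norm_mult abs_of_pos mult.assoc)
  qed
  show i2: "integrable lborel (\<lambda>\<xi>. of_real (weight (s + 2) \<xi>) * U \<xi>)"
  proof (rule Bochner_Integration.integrable_bound[where f="\<lambda>\<xi>. max 1 (1 / \<alpha>) * norm (w \<xi>)"])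
    show "AE \<xi> in lborel. norm (of_real (weight (s + 2) \<xi>) * U \<xi>) \<le> norm (max 1 (1 / \<alpha>) * norm (w \<xi>))"
      using le by (intro AE_I2) (metis abs_ge_self order_trans real_norm_def)
  qed (use w in \<open>auto simp: U_def\<close>)
  have "(LBINT \<xi>. norm (of_real (weight (s + 2) \<xi>) * U \<xi>)) \<le> (LBINT \<xi>. max 1 (1 / \<alpha>) * norm (w \<xi>))"
    using w by (intro integral_mono integrable_norm[OF i2] le) auto
  then show "(LBINT \<xi>. norm (of_real (weight (s + 2) \<xi>) * U \<xi>)) \<le> max 1 (1 / \<alpha>) * (LBINT \<xi>. norm (w \<xi>))"
    by simp
  have iU: "integrable lborel U" using s by (intro integrable_of_weight[OF _ i2]) auto
  note iL = integrable_norm_square_of_weight[OF s i2]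
  have iG: "integrable lborel G" by (rule integrable_of_weight[OF s G])
  have iF: "integrable lborel F" by (rule integrable_of_weight[OF s F])
  let ?conv = "kernel_op (\<lambda>\<xi> \<eta>. G (\<xi> - \<eta>)) U"
  have iC: "integrable lborel ?conv"
    by (rule integrable_kernel_op[OF kernel_bound_convolution[OF iG] iU])
  have iA: "integrable lborel (\<lambda>\<xi>. of_real \<alpha> * U \<xi>)" using iU by (rule integrable_mult_right)
  have "AE \<xi> in lborel. of_real ((norm \<xi>)\<^sup>2) * U \<xi> + (of_real \<alpha> * U \<xi> + ?conv \<xi>) = F \<xi>"
    using eq
  proof eventually_elim
    fix \<xi>
    assume eq: "w \<xi> + kernel_op (schroedinger_kernel s \<alpha> G) w \<xi> = of_real (weight s \<xi>) * F \<xi>"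
    have "kernel_op (schroedinger_kernel s \<alpha> G) w \<xi> = of_real (weight s \<xi>) * ?conv \<xi>"
      by (simp add: kernel_op_def schroedinger_kernel_def U_def mult.assoc)
    \<comment> \<open>The substitution is undone here; afterwards the common factor
      \<open>weight s \<xi>\<close> cancels and the transformed equation for \<open>U\<close>
      remains.\<close>
    moreover have "w \<xi> = of_real (weight s \<xi>) * (of_real (\<alpha> + (norm \<xi>)\<^sup>2) * U \<xi>)"
    proof -
      have "weight s \<xi> * (\<alpha> + (norm \<xi>)\<^sup>2) * resolvent_weight s \<alpha> \<xi> = 1"
        using pos[of \<xi>] by (simp add: resolvent_weight_def)
      then have "complex_of_real (weight s \<xi> * (\<alpha> + (norm \<xi>)\<^sup>2) * resolvent_weight s \<alpha> \<xi>) = 1" by simp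
      then show ?thesis
        unfolding U_def of_real_mult by (metis mult.assoc mult_1_left)
    qed
    ultimately have "of_real (weight s \<xi>) * (of_real (\<alpha> + (norm \<xi>)\<^sup>2) * U \<xi> + ?conv \<xi>) = of_real (weight s \<xi>) * F \<xi>"
      using eq by (simp add: distrib_left)
    then show "of_real ((norm \<xi>)\<^sup>2) * U \<xi> + (of_real \<alpha> * U \<xi> + ?conv \<xi>) = F \<xi>"
      by (simp add: distrib_right add_ac)
  qed
  then have "ift (\<lambda>\<xi>. of_real ((norm \<xi>)\<^sup>2) * U \<xi> + (of_real \<alpha> * U \<xi> + ?conv \<xi>)) x = ift F x"
    by (intro ift_cong_AE Bochner_Integration.integrable_add iL iA iC iF)
  also have "ift (\<lambda>\<xi>. of_real ((norm \<xi>)\<^sup>2) * U \<xi> + (of_real \<alpha> * U \<xi> + ?conv \<xi>)) x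
      = ift (\<lambda>\<xi>. of_real ((norm \<xi>)\<^sup>2) * U \<xi>) x + (of_real \<alpha> * ift U x + ift G x * ift U x)"
    by (simp only: ift_add[OF iL Bochner_Integration.integrable_add[OF iA iC]] ift_add[OF iA iC]
        ift_cmult ift_convolution[OF iG iU])
  finally show "ift (\<lambda>\<xi>. of_real ((norm \<xi>)\<^sup>2) * U \<xi>) x + of_real (V x) * ift U x = ift F x"
    by (simp add: V W[symmetric] distrib_right)
qed

text \<open>\<open>V\<close> is real, so real and imaginary parts can be treated separately;
  positivity of \<open>resolvent_weight\<close> carries the conclusion back from the transform of
  the solution to \<open>w\<close>.\<close>

lemma integral_equation_injective:
  assumes w: "integrable lborel w"
    and eq: "AE \<xi> in lborel. w \<xi> + kernel_op (schroedinger_kernel s \<alpha> G) w \<xi> = 0"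
  shows "AE \<xi> in lborel. w \<xi> = 0"
proof -
  let ?U = "\<lambda>\<xi>. of_real (resolvent_weight s \<alpha> \<xi>) * w \<xi>"
  \<comment> \<open>The right-hand side is written with \<open>F\<close> the zero function so that
    it matches \<open>integral_equation_solution\<close>.\<close>
  have eq': "AE \<xi> in lborel. w \<xi> + kernel_op (schroedinger_kernel s \<alpha> G) w \<xi> = of_real (weight s \<xi>) * (\<lambda>_. 0) \<xi>"
    using eq by simp
  have i0: "integrable lborel (\<lambda>\<xi>::'a. of_real (weight s \<xi>) * (\<lambda>_. 0 :: complex) \<xi>)" by simp
  note sol = integral_equation_solution[OF w i0 eq' refl]
  have iU: "integrable lborel ?U" using s by (intro integrable_of_weight[OF _ sol(1)]) auto
  note iL = integrable_norm_square_of_weight[OF s sol(1)]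
  have eqn: "ift (\<lambda>\<xi>. of_real ((norm \<xi>)\<^sup>2) * ?U \<xi>) x + of_real (V x) * ift ?U x = 0" for x
    using sol(3)[of x] by (simp add: ift_def[of "\<lambda>_. 0"])
  have "Re (ift ?U x) = 0" for x
  proof (rule maximum_principle_Re[OF iU iL V0])
    show "Re (ift (\<lambda>\<xi>. of_real ((norm \<xi>)\<^sup>2) * ?U \<xi>) x) + V x * Re (ift ?U x) = 0" for x
      using arg_cong[OF eqn[of x], of Re] by simp
  qed
  moreover have "Im (ift ?U x) = 0" for x
  proof (rule maximum_principle_Im[OF iU iL V0])
    show "Im (ift (\<lambda>\<xi>. of_real ((norm \<xi>)\<^sup>2) * ?U \<xi>) x) + V x * Im (ift ?U x) = 0" for x
      using arg_cong[OF eqn[of x], of Im] by simp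
  qed
  ultimately have "ift ?U x = 0" for x by (simp add: complex_eq_iff)
  from ift_injective[OF iU this] show ?thesis
    by eventually_elim (use resolvent_weight_bounds(1)[OF s \<alpha>] in \<open>auto simp: less_le\<close>)
qed

lemma integral_equation_solvable:
  "\<exists>C\<ge>0. \<forall>g. integrable lborel g \<longrightarrow> (\<exists>w. integrable lborel w \<and>
      (AE \<xi> in lborel. w \<xi> + kernel_op (schroedinger_kernel s \<alpha> G) w \<xi> = g \<xi>) \<and>
      (LBINT \<xi>. norm (w \<xi>)) \<le> C * (LBINT \<xi>. norm (g \<xi>)))"
proof -
  obtain n :: nat and a b :: "nat \<Rightarrow> 'a \<Rightarrow> complex" and B where
    ab: "\<And>i. integrable lborel (a i)" "\<And>i. b i \<in> borel_measurable borel" "\<And>i \<eta>. norm (b i \<eta>) \<le> B"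
    "kernel_bound (\<lambda>\<xi> \<eta>. schroedinger_kernel s \<alpha> G \<xi> \<eta> - (\<Sum>i<n. a i \<xi> * b i \<eta>)) (1 / 2)"
    by (rule schroedinger_kernel_finite_rank[OF s \<alpha> G]) (rule that)
  have half: "1 / 2 < (1 :: real)" by simp
  show ?thesis
    by (rule kernel_fredholm[OF kernel_bound_schroedinger_kernel[OF s \<alpha> G] finite_lessThan ab half
          integral_equation_injective])
qed

lemma barron_solution_exists:
  assumes Vb: "continuous_on UNIV V" "bounded (range V)"
  shows "\<exists>C\<ge>0. \<forall>f\<in>barron_space s. \<exists>u\<in>barron_space (s + 2). schroedinger_solution V f u \<and>
      barron_norm (s + 2) u \<le> ennreal C * barron_norm s f"
proof -
  obtain C where C: "C \<ge> 0" "\<And>g. integrable lborel g \<Longrightarrow> \<exists>w. integrable lborel w \<and>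
      (AE \<xi> in lborel. w \<xi> + kernel_op (schroedinger_kernel s \<alpha> G) w \<xi> = g \<xi>) \<and>
      (LBINT \<xi>. norm (w \<xi>)) \<le> C * (LBINT \<xi>. norm (g \<xi>))"
    using integral_equation_solvable by blast
  \<comment> \<open>\<open>C\<close> bounds \<open>w\<close> in L1, and the other factor converts
    this into a bound of order \<open>s + 2\<close>; both are fixed before \<open>f\<close>.\<close>
  let ?C = "max 1 (1 / \<alpha>) * C"
  have C0: "?C \<ge> 0" using C(1) by (intro mult_nonneg_nonneg) auto
  have "\<exists>u\<in>barron_space (s + 2). schroedinger_solution V f u \<and> barron_norm (s + 2) u \<le> ennreal ?C * barron_norm s f"
    if f: "f \<in> barron_space s" for f
  proof -
    obtain F where F: "integrable lborel (\<lambda>\<xi>. of_real (weight s \<xi>) * F \<xi>)" "integrable lborel F"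
      "\<And>x. of_real (f x) = ift F x"
      "barron_norm s f = (\<integral>\<^sup>+\<xi>. ennreal (norm (of_real (weight s \<xi>) * F \<xi>)) \<partial>lborel)"
      using barron_spaceD[OF f s] by blast
    have fb: "continuous_on UNIV f" "bounded (range f)" using f by (auto simp: barron_space_def)
    obtain w where w: "integrable lborel w"
      "AE \<xi> in lborel. w \<xi> + kernel_op (schroedinger_kernel s \<alpha> G) w \<xi> = of_real (weight s \<xi>) * F \<xi>"
      "(LBINT \<xi>. norm (w \<xi>)) \<le> C * (LBINT \<xi>. norm (of_real (weight s \<xi>) * F \<xi>))"
      using C(2)[OF F(1)] by blast
    define U where "U = (\<lambda>\<xi>. of_real (resolvent_weight s \<alpha> \<xi>) * w \<xi>)"
    note sol = integral_equation_solution[OF w(1) F(1) w(2) U_def]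
    have s2: "s + 2 \<ge> 0" using s by simp
    have iU: "integrable lborel U" by (rule integrable_of_weight[OF s2 sol(1)])
    note iL = integrable_norm_square_of_weight[OF s sol(1)]
    have eqn: "ift (\<lambda>\<xi>. of_real ((norm \<xi>)\<^sup>2) * U \<xi>) x + of_real (V x) * ift U x = of_real (f x)" for x
      using sol(3)[of x] F(3)[of x] by simp
    \<comment> \<open>\<open>f\<close> is real, so the imaginary part of the equation is
      homogeneous.\<close>
    have "Im (ift U x) = 0" for x
    proof (rule maximum_principle_Im[OF iU iL V0])
      show "Im (ift (\<lambda>\<xi>. of_real ((norm \<xi>)\<^sup>2) * U \<xi>) x) + V x * Im (ift U x) = 0" for x
        using arg_cong[OF eqn[of x], of Im] by simp
    qed
    then have u: "of_real (Re (ift U x)) = ift U x" for x by (simp add: complex_eq_iff)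
    let ?u = "\<lambda>x. Re (ift U x)"
    have "?u \<in> barron_space (s + 2)" by (rule barron_spaceI(1)[OF s2 sol(1) u])
    moreover have "schroedinger_solution V f ?u"
      unfolding schroedinger_solution_iff[OF iU iL u Vb fb] of_real_mult u using eqn by blast
    moreover have "barron_norm (s + 2) ?u \<le> ennreal ?C * barron_norm s f"
    proof -
      have "barron_norm (s + 2) ?u = (\<integral>\<^sup>+\<xi>. ennreal (norm (of_real (weight (s + 2) \<xi>) * U \<xi>)) \<partial>lborel)"
        by (rule barron_spaceI(2)[OF s2 sol(1) u])
      also have "\<dots> = ennreal (LBINT \<xi>. norm (of_real (weight (s + 2) \<xi>) * U \<xi>))"
        by (rule nn_integral_eq_integral[OF integrable_norm[OF sol(1)]]) auto
      also have "\<dots> \<le> ennreal (?C * (LBINT \<xi>. norm (of_real (weight s \<xi>) * F \<xi>)))"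
      proof (rule ennreal_leI)
        have "max 1 (1 / \<alpha>) * (LBINT \<xi>. norm (w \<xi>))
            \<le> max 1 (1 / \<alpha>) * (C * (LBINT \<xi>. norm (of_real (weight s \<xi>) * F \<xi>)))"
          by (rule mult_left_mono[OF w(3)]) simp
        with sol(2) show "(LBINT \<xi>. norm (of_real (weight (s + 2) \<xi>) * U \<xi>))
            \<le> ?C * (LBINT \<xi>. norm (of_real (weight s \<xi>) * F \<xi>))"
          by (simp only: mult.assoc)
      qed
      also have "\<dots> = ennreal ?C * ennreal (LBINT \<xi>. norm (of_real (weight s \<xi>) * F \<xi>))"
        using C0 by (rule ennreal_mult') 
      also have "ennreal (LBINT \<xi>. norm (of_real (weight s \<xi>) * F \<xi>)) = barron_norm s f"
        unfolding F(4) by (rule nn_integral_eq_integral[OF integrable_norm[OF F(1)], symmetric]) auto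
      finally show ?thesis .
    qed
    ultimately show ?thesis by blast
  qed
  then show ?thesis using C0 by blast
qed

end

lemma barron_solution_unique:
  fixes V f u u' :: "'a::euclidean_space \<Rightarrow> real"
  assumes s: "s \<ge> 0" and V0: "\<And>x. V x \<ge> 0"
    and V: "continuous_on UNIV V" "bounded (range V)"
    and f: "continuous_on UNIV f" "bounded (range f)"
    and u: "u \<in> barron_space (s + 2)" "schroedinger_solution V f u"
    and u': "u' \<in> barron_space (s + 2)" "schroedinger_solution V f u'"
  shows "u = u'"
proof
  fix x
  have s2: "s + 2 \<ge> 0" using s by simp
  obtain U where U: "integrable lborel (\<lambda>\<xi>. of_real (weight (s + 2) \<xi>) * U \<xi>)" "integrable lborel U"
    "\<And>x. of_real (u x) = ift U x"
    using barron_spaceD[OF u(1) s2] by blast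
  obtain U' where U': "integrable lborel (\<lambda>\<xi>. of_real (weight (s + 2) \<xi>) * U' \<xi>)" "integrable lborel U'"
    "\<And>x. of_real (u' x) = ift U' x"
    using barron_spaceD[OF u'(1) s2] by blast
  note iL = integrable_norm_square_of_weight[OF s U(1)] and iL' = integrable_norm_square_of_weight[OF s U'(1)]
  have eqn: "ift (\<lambda>\<xi>. of_real ((norm \<xi>)\<^sup>2) * U \<xi>) x + of_real (V x * u x) = of_real (f x)" for x
    using u(2) schroedinger_solution_iff[OF U(2) iL U(3) V f] by blast
  have eqn': "ift (\<lambda>\<xi>. of_real ((norm \<xi>)\<^sup>2) * U' \<xi>) x + of_real (V x * u' x) = of_real (f x)" for x
    using u'(2) schroedinger_solution_iff[OF U'(2) iL' U'(3) V f] by blast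
  \<comment> \<open>The factor \<open>- 1\<close> lets \<open>ift_add\<close> and
    \<open>ift_cmult\<close> compute the transform of the difference.\<close>
  let ?D = "\<lambda>\<xi>. U \<xi> + - 1 * U' \<xi>"
  have m: "integrable lborel (\<lambda>\<xi>. - 1 * U' \<xi>)" "integrable lborel (\<lambda>\<xi>. - 1 * (of_real ((norm \<xi>)\<^sup>2) * U' \<xi>))"
    by (rule integrable_mult_right[OF U'(2)], rule integrable_mult_right[OF iL'])
  have D: "ift ?D x = of_real (u x - u' x)" for x
    by (simp only: ift_add[OF U(2) m(1)] ift_cmult U(3)[symmetric] U'(3)[symmetric]) simp
  have LD_eq: "(\<lambda>\<xi>. of_real ((norm \<xi>)\<^sup>2) * ?D \<xi>) = (\<lambda>\<xi>. of_real ((norm \<xi>)\<^sup>2) * U \<xi> + - 1 * (of_real ((norm \<xi>)\<^sup>2) * U' \<xi>))"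
    by (simp add: fun_eq_iff right_diff_distrib)
  have LD: "ift (\<lambda>\<xi>. of_real ((norm \<xi>)\<^sup>2) * ?D \<xi>) x
      = ift (\<lambda>\<xi>. of_real ((norm \<xi>)\<^sup>2) * U \<xi>) x - ift (\<lambda>\<xi>. of_real ((norm \<xi>)\<^sup>2) * U' \<xi>) x" for x
    unfolding LD_eq by (simp only: ift_add[OF iL m(2)] ift_cmult) simp
  have "Re (ift ?D x) = 0"
  proof (rule maximum_principle_Re[OF _ _ V0])
    show "integrable lborel ?D" by (rule Bochner_Integration.integrable_add[OF U(2) m(1)])
    show "integrable lborel (\<lambda>\<xi>. of_real ((norm \<xi>)\<^sup>2) * ?D \<xi>)"
      unfolding LD_eq by (rule Bochner_Integration.integrable_add[OF iL m(2)])
    show "Re (ift (\<lambda>\<xi>. of_real ((norm \<xi>)\<^sup>2) * ?D \<xi>) x) + V x * Re (ift ?D x) = 0" for x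
      using arg_cong[OF eqn[of x], of Re] arg_cong[OF eqn'[of x], of Re]
      by (simp only: LD D) (simp add: algebra_simps)
  qed
  then show "u x = u' x" by (simp only: D) simp
qed

theorem theorem2p3:
  fixes V :: "real ^ 'n \<Rightarrow> real" and s :: real
  assumes "s \<ge> 0"
    and "\<And>x. V x \<ge> 0"
    and "\<exists>\<alpha>>0. \<exists>W\<in>barron_space s. \<forall>x. V x = \<alpha> + W x"
  shows "\<exists>C::real. C \<ge> 0 \<and> (\<forall>f\<in>barron_space s.
           (\<exists>!u. u \<in> barron_space (s + 2) \<and> schroedinger_solution V f u) \<and>
           (\<forall>u. u \<in> barron_space (s + 2) \<and> schroedinger_solution V f u \<longrightarrow>
                barron_norm (s + 2) u \<le> ennreal C * barron_norm s f))"
proof -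
  obtain \<alpha> W where \<alpha>: "\<alpha> > 0" and W: "W \<in> barron_space s" and V: "\<And>x. V x = \<alpha> + W x"
    using assms(3) by blast
  obtain G where G: "integrable lborel (\<lambda>\<xi>. of_real (weight s \<xi>) * G \<xi>)" "\<And>x. of_real (W x) = ift G x"
    using barron_spaceD[OF W assms(1)] by blast
  have V_eq: "V = (\<lambda>x. \<alpha> + W x)" using V by blast
  have Vb: "continuous_on UNIV V" "bounded (range V)"
  proof -
    show "continuous_on UNIV V"
      using W unfolding V_eq by (auto simp: barron_space_def intro!: continuous_intros)
    obtain B where B: "\<And>x. \<bar>W x\<bar> \<le> B" using W by (auto simp: barron_space_def bounded_iff)
    have "\<bar>V x\<bar> \<le> \<alpha> + B" for x
      using abs_triangle_ineq[of \<alpha> "W x"] B[of x] \<alpha> unfolding V by simp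
    then show "bounded (range V)" by (auto simp: bounded_iff)
  qed
  obtain C where C: "C \<ge> 0" "\<And>f. f \<in> barron_space s \<Longrightarrow> \<exists>u\<in>barron_space (s + 2).
      schroedinger_solution V f u \<and> barron_norm (s + 2) u \<le> ennreal C * barron_norm s f"
    using barron_solution_exists[OF assms(1) \<alpha> G(1) V G(2) assms(2) Vb] by blast
  show ?thesis
  proof (intro exI[of _ C] conjI ballI C(1))
    fix f :: "real ^ 'n \<Rightarrow> real"
    assume f: "f \<in> barron_space s"
    have fb: "continuous_on UNIV f" "bounded (range f)" using f by (auto simp: barron_space_def)
    note unique = barron_solution_unique[OF assms(1,2) Vb fb]
    obtain u where u: "u \<in> barron_space (s + 2)" "schroedinger_solution V f u"
      "barron_norm (s + 2) u \<le> ennreal C * barron_norm s f"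
      using C(2)[OF f] by blast
    show "\<exists>!u. u \<in> barron_space (s + 2) \<and> schroedinger_solution V f u"
      using u(1,2) unique by blast
    \<comment> \<open>The estimate is known for the constructed solution; uniqueness transfers it to
      every solution.\<close>
    show "\<forall>u. u \<in> barron_space (s + 2) \<and> schroedinger_solution V f u \<longrightarrow>
        barron_norm (s + 2) u \<le> ennreal C * barron_norm s f"
      using u unique[OF u(1,2)] by blast
  qed
qed

end
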